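(* Let $\mathcal{G}=(G_n,Q_n,U_n)_{n=1}^\infty$ be a family of random walks on finite groups driven by symmetric probabilities, $\mathcal{P}=(p_n)_{n=1}^\infty$ a sequence of positive reals, $q_n=p_1+\cdots+p_n$, let $\mathcal{G}^{\mathcal{P}}$ be the family whose $n$th random walk is the product of $(G_i,Q_i,U_i)_{i=1}^n$ with respect to the probability vector $(p_1/q_n,\dots,p_n/q_n)$, and let $\mathcal{G}^{\mathcal{P}}_c$ be the family of associated continuous time random walks. Let $E_n$ be the support of $Q_n$ and $\rho_n$ the diameter of $(G_n,E_n)$. Assume that, for some constants $A,d$ not depending on $n$, $G_n$ has $(A,d)$-moderate growth with respect to $E_n$ for all $n$, that $\inf\{Q_n(x): x\in E_n,\ n\ge1\}>0$, that $\rho_n\ge4$ for $n$ large enough, and that $p_n/\rho_n^2\asymp\ell_n$ for some sequence $(\ell_n)_{n=1}^\infty$ of positive reals. (1) If $\ell_n\le\ell_{n+1}$ for all $n$ and $u_n=\max\{\log(i+1)/\ell_i: 1\le i\le n\}$, then $\mathcal{G}^{\mathcal{P}}_c$ has a total variation cutoff if and only if $u_n\to\infty$. (2) If $\ell_n\ge\ell_{n+1}$ for all $n$ and $u_n=\max\{\log(i+1)/\ell_{n-i+1}: 1\le i\le n\}$, then $\mathcal{G}^{\mathcal{P}}_c$ has a total variation cutoff if and only if $u_n\ell_n\to\infty$. In either case of (1) and (2), if $\mathcal{G}^{\mathcal{P}}_c$ has a total variation cutoff, then the cutoff time is of order $u_nq_n$ (i.e. any cutoff time $t_n$ satisfies $t_n\asymp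 u_nq_n$). Further, if $E_n$ contains the identity of $G_n$ for all $n\ge1$, then the same conclusions hold for $\mathcal{G}^{\mathcal{P}}$ in place of $\mathcal{G}^{\mathcal{P}}_c$, that is: if $\ell_n\le\ell_{n+1}$ for all $n$ and $u_n=\max\{\log(i+1)/\ell_i: 1\le i\le n\}$, then $\mathcal{G}^{\mathcal{P}}$ has a total variation cutoff if and only if $u_n\to\infty$; if $\ell_n\ge\ell_{n+1}$ for all $n$ and $u_n=\max\{\log(i+1)/\ell_{n-i+1}: 1\le i\le n\}$, then $\mathcal{G}^{\mathcal{P}}$ has a total variation cutoff if and only if $u_n\ell_n\to\infty$; and in either of these two cases, if $\mathcal{G}^{\mathcal{P}}$ has a total variation cutoff, then any cutoff time $t_n$ satisfies $t_n\asymp u_nq_n$.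
   Context: Random walks. A (discrete time) random walk $(G,Q,U)$ on a finite group $G$ driven by a probability $Q$ is the Markov chain on $G$ with transition matrix $K(x,y)=Q(x^{-1}y)$; $U$ is the uniform distribution on $G$. $Q$ is symmetric if $Q(x)=Q(x^{-1})$ for all $x$. Random walks are taken irreducible. The associated continuous time random walk $(G,H_t,U)$ has semigroup $H_t=e^{t(K-I)}$, $t\ge0$. The total variations (independent of the starting point $x$) are $d_{\mathrm{TV}}(m)=\max_{F\subset G}\{K^m(x,F)-U(F)\}$ and $d^{(c)}_{\mathrm{TV}}(t)=\max_{F\subset G}\{H_t(x,F)-U(F)\}$; mixing times are $T_{\mathrm{TV}}(\epsilon)=\min\{m\in\mathbb{Z}_{\ge0}: d_{\mathrm{TV}}(m)\le\epsilon\}$ and $T^{(c)}_{\mathrm{TV}}(\epsilon)=\min\{t\ge0: d^{(c)}_{\mathrm{TV}}(t)\le\epsilon\}$. Products. The product of $(G_i,Q_i,U_i)_{i=1}^n$ with respect to a probability vector $(r_1,\dots,r_n)$ is the random walk on $G_1\times\cdots\times G_n$ which at each step chooses coordinate $i$ with probability $r_i$ and moves that coordinate according to $Q_i$, leaving the others fixed (i.e. driven by $Q=\sum_i r_i\check Q_i$, $\check Q_i$ being the image of $Q_i$ under the embedding of $G_i$ as $i$th factor). Its continuous time version has $H_t=H_{1,r_1t}\otimes\cdots\otimes H_{n,r_nt}$. Moderate growth. For $E\subset G$ and $m\ge1$, $E^m=\{x_1\cdots x_m: x_i\in E\}$; $E$ is a generating set if $E^m=G$ for some $m>0$. For a generating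 set $E$, $V(m)=|E^m|$ and the diameter of $(G,E)$ is $\rho=\min\{m\ge1: V(m)=|G|\}$. $G$ has $(A,d)$-moderate growth with respect to the generating set $E$ if $V(m)/V(\rho)\ge \frac1A(m/\rho)^d$ for all $1\le m\le\rho$. Cutoff. A family of discrete time walks with total variations $d_n$ and mixing times $T_n$, such that $T_n(\epsilon_0)\to\infty$ for some $\epsilon_0\in(0,1)$, has a total variation cutoff if $T_n(\epsilon)/T_n(\delta)\to1$ for all $\epsilon,\delta\in(0,1)$; equivalently there are $t_n>0$ with $d_n(\lceil at_n\rceil)\to0$ for all $a>1$ and $d_n(\lfloor at_n\rfloor)\to1$ for all $a\in(0,1)$. Such a sequence $t_n$ is called a cutoff time. For continuous time families the definition is the same without $\lceil\cdot\rceil,\lfloor\cdot\rfloor$ and without the requirement $T_n(\epsilon_0)\to\infty$. Notation. For positive sequences, $a_n\asymp b_n$ means that $a_n/b_n$ and $b_n/a_n$ are both bounded. *)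

theory Defs
  imports "HOL-Algebra.Product_Groups" "HOL-Probability.Probability_Mass_Function"
begin

section \<open>Random walks on finite groups\<close>

definition transition :: "('a, 'b) monoid_scheme \<Rightarrow> 'a pmf \<Rightarrow> 'a \<Rightarrow> 'a \<Rightarrow> real" where
  "transition G Q x y = pmf Q (inv\<^bsub>G\<^esub> x \<otimes>\<^bsub>G\<^esub> y)"

text \<open>Real matrices with rows and columns indexed by a finite set \<open>S\<close> are functions of two
  arguments; their values outside \<open>S\<close> are irrelevant.\<close>

definition mat_one :: "'a \<Rightarrow> 'a \<Rightarrow> real" where
  "mat_one x y = (if x = y then 1 else 0)"

primrec mat_pow :: "'a set \<Rightarrow> ('a \<Rightarrow> 'a \<Rightarrow> real) \<Rightarrow> nat \<Rightarrow> 'a \<Rightarrow> 'a \<Rightarrow> real" where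
  "mat_pow S M 0 x y = mat_one x y"
| "mat_pow S M (Suc m) x y = (\<Sum>z\<in>S. mat_pow S M m x z * M z y)"

definition mat_exp :: "'a set \<Rightarrow> ('a \<Rightarrow> 'a \<Rightarrow> real) \<Rightarrow> real \<Rightarrow> 'a \<Rightarrow> 'a \<Rightarrow> real" where
  "mat_exp S M t x y = (\<Sum>m. t ^ m / fact m * mat_pow S M m x y)"

definition discrete_kernel :: "('a, 'b) monoid_scheme \<Rightarrow> 'a pmf \<Rightarrow> nat \<Rightarrow> 'a \<Rightarrow> 'a \<Rightarrow> real" where
  "discrete_kernel G Q m = mat_pow (carrier G) (transition G Q) m"

definition heat_kernel :: "('a, 'b) monoid_scheme \<Rightarrow> 'a pmf \<Rightarrow> real \<Rightarrow> 'a \<Rightarrow> 'a \<Rightarrow> real" where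
  "heat_kernel G Q t = mat_exp (carrier G) (\<lambda>x y. transition G Q x y - mat_one x y) t"

definition random_walk :: "('a, 'b) monoid_scheme \<Rightarrow> 'a pmf \<Rightarrow> bool" where
  "random_walk G Q \<longleftrightarrow> group G \<and> finite (carrier G) \<and> set_pmf Q \<subseteq> carrier G \<and>
     (\<forall>x\<in>carrier G. \<forall>y\<in>carrier G. \<exists>m. discrete_kernel G Q m x y > 0)"

definition symmetric_prob :: "('a, 'b) monoid_scheme \<Rightarrow> 'a pmf \<Rightarrow> bool" where
  "symmetric_prob G Q \<longleftrightarrow> (\<forall>x\<in>carrier G. pmf Q x = pmf Q (inv\<^bsub>G\<^esub> x))"

section \<open>Total variation and mixing times\<close>

definition tv_to_uniform :: "('a, 'b) monoid_scheme \<Rightarrow> ('a \<Rightarrow> real) \<Rightarrow> real" where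
  "tv_to_uniform G \<mu> =
     Max ((\<lambda>F. (\<Sum>y\<in>F. \<mu> y) - measure_pmf.prob (pmf_of_set (carrier G)) F) ` Pow (carrier G))"

text \<open>By translation invariance the total variation does not depend on the starting point,
  which is taken to be the identity.\<close>

definition d_TV :: "('a, 'b) monoid_scheme \<Rightarrow> 'a pmf \<Rightarrow> nat \<Rightarrow> real" where
  "d_TV G Q m = tv_to_uniform G (discrete_kernel G Q m \<one>\<^bsub>G\<^esub>)"

definition d_TV_c :: "('a, 'b) monoid_scheme \<Rightarrow> 'a pmf \<Rightarrow> real \<Rightarrow> real" where
  "d_TV_c G Q t = tv_to_uniform G (heat_kernel G Q t \<one>\<^bsub>G\<^esub>)"

definition T_TV :: "('a, 'b) monoid_scheme \<Rightarrow> 'a pmf \<Rightarrow> real \<Rightarrow> nat" where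
  "T_TV G Q \<epsilon> = (LEAST m. d_TV G Q m \<le> \<epsilon>)"

definition T_TV_c :: "('a, 'b) monoid_scheme \<Rightarrow> 'a pmf \<Rightarrow> real \<Rightarrow> real" where
  "T_TV_c G Q \<epsilon> = (LEAST t. 0 \<le> t \<and> d_TV_c G Q t \<le> \<epsilon>)"

section \<open>Cutoff\<close>

text \<open>Families are indexed by \<open>n \<ge> 1\<close>; the entry at \<open>n = 0\<close> plays no role.\<close>

definition cutoff :: "(nat \<Rightarrow> ('a, 'b) monoid_scheme) \<Rightarrow> (nat \<Rightarrow> 'a pmf) \<Rightarrow> bool" where
  "cutoff G Q \<longleftrightarrow>
     (\<exists>\<epsilon>0\<in>{0<..<1}. filterlim (\<lambda>n. T_TV (G n) (Q n) \<epsilon>0) at_top sequentially) \<and>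
     (\<forall>\<epsilon>\<in>{0<..<1}. \<forall>\<delta>\<in>{0<..<1}.
        (\<lambda>n. real (T_TV (G n) (Q n) \<epsilon>) / real (T_TV (G n) (Q n) \<delta>)) \<longlonglongrightarrow> 1)"

definition cutoff_c :: "(nat \<Rightarrow> ('a, 'b) monoid_scheme) \<Rightarrow> (nat \<Rightarrow> 'a pmf) \<Rightarrow> bool" where
  "cutoff_c G Q \<longleftrightarrow>
     (\<forall>\<epsilon>\<in>{0<..<1}. \<forall>\<delta>\<in>{0<..<1}. (\<lambda>n. T_TV_c (G n) (Q n) \<epsilon> / T_TV_c (G n) (Q n) \<delta>) \<longlonglongrightarrow> 1)"

definition cutoff_time ::
    "(nat \<Rightarrow> ('a, 'b) monoid_scheme) \<Rightarrow> (nat \<Rightarrow> 'a pmf) \<Rightarrow> (nat \<Rightarrow> real) \<Rightarrow> bool" where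
  "cutoff_time G Q t \<longleftrightarrow>
     (\<forall>n\<ge>1. t n > 0) \<and>
     (\<forall>a>1. (\<lambda>n. d_TV (G n) (Q n) (nat \<lceil>a * t n\<rceil>)) \<longlonglongrightarrow> 0) \<and>
     (\<forall>a\<in>{0<..<1}. (\<lambda>n. d_TV (G n) (Q n) (nat \<lfloor>a * t n\<rfloor>)) \<longlonglongrightarrow> 1)"

definition cutoff_time_c ::
    "(nat \<Rightarrow> ('a, 'b) monoid_scheme) \<Rightarrow> (nat \<Rightarrow> 'a pmf) \<Rightarrow> (nat \<Rightarrow> real) \<Rightarrow> bool" where
  "cutoff_time_c G Q t \<longleftrightarrow>
     (\<forall>n\<ge>1. t n > 0) \<and>
     (\<forall>a>1. (\<lambda>n. d_TV_c (G n) (Q n) (a * t n)) \<longlonglongrightarrow> 0) \<and>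
     (\<forall>a\<in>{0<..<1}. (\<lambda>n. d_TV_c (G n) (Q n) (a * t n)) \<longlonglongrightarrow> 1)"

section \<open>Products of random walks\<close>

definition factor_embed :: "'i set \<Rightarrow> ('i \<Rightarrow> ('a, 'b) monoid_scheme) \<Rightarrow> 'i \<Rightarrow> 'a \<Rightarrow> ('i \<Rightarrow> 'a)" where
  "factor_embed I G i g = (\<lambda>j\<in>I. if j = i then g else \<one>\<^bsub>G j\<^esub>)"

text \<open>The probability driving the product walk on \<open>product_group I G\<close> with respect to the
  probability vector \<open>r\<close> (a distribution supported in \<open>I\<close>).\<close>

definition product_prob ::
    "'i set \<Rightarrow> 'i pmf \<Rightarrow> ('i \<Rightarrow> ('a, 'b) monoid_scheme) \<Rightarrow> ('i \<Rightarrow> 'a pmf) \<Rightarrow> ('i \<Rightarrow> 'a) pmf" where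
  "product_prob I r G Q = bind_pmf r (\<lambda>i. map_pmf (factor_embed I G i) (Q i))"

definition partial_sum :: "(nat \<Rightarrow> real) \<Rightarrow> nat \<Rightarrow> real" where
  "partial_sum p n = (\<Sum>i=1..n. p i)"

definition weight_pmf :: "(nat \<Rightarrow> real) \<Rightarrow> nat \<Rightarrow> nat pmf" where
  "weight_pmf p n = embed_pmf (\<lambda>i. if i \<in> {1..n} then p i / partial_sum p n else 0)"

lemma pmf_weight_pmf:
  assumes "\<And>i. 1 \<le> i \<Longrightarrow> p i > 0" and "1 \<le> n"
  shows "pmf (weight_pmf p n) i = (if i \<in> {1..n} then p i / partial_sum p n else 0)"
  unfolding weight_pmf_def
proof (rule pmf_embed_pmf)
  have pos: "partial_sum p n > 0"
    unfolding partial_sum_def using assms by (intro sum_pos) auto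
  show nn: "0 \<le> (if j \<in> {1..n} then p j / partial_sum p n else 0)" for j
    using pos assms(1)[of j] by auto
  let ?f = "\<lambda>j. if j \<in> {1..n} then p j / partial_sum p n else 0"
  have "(\<integral>\<^sup>+ j. ennreal (?f j) \<partial>count_space UNIV) = (\<Sum>j\<in>{1..n}. ennreal (?f j))"
    by (rule nn_integral_count_space'[of "{1..n}"]) auto
  also have "\<dots> = ennreal (\<Sum>j\<in>{1..n}. ?f j)"
    by (intro sum_ennreal nn)
  also have "(\<Sum>j\<in>{1..n}. ?f j) = (\<Sum>j\<in>{1..n}. p j / partial_sum p n)"
    by (intro sum.cong) auto
  also have "\<dots> = 1"
    using pos by (simp add: sum_divide_distrib[symmetric] partial_sum_def)
  finally show "(\<integral>\<^sup>+ j. ennreal (?f j) \<partial>count_space UNIV) = 1" by simp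
qed

text \<open>The family whose \<open>n\<close>th member is the product of the first \<open>n\<close> walks with respect to
  \<open>(p 1 / q n, \<dots>, p n / q n)\<close>, where \<open>q n = p 1 + \<dots> + p n\<close>.\<close>

definition prod_family_group ::
    "(nat \<Rightarrow> ('a, 'b) monoid_scheme) \<Rightarrow> nat \<Rightarrow> (nat \<Rightarrow> 'a) monoid" where
  "prod_family_group G n = product_group {1..n} G"

definition prod_family_prob ::
    "(nat \<Rightarrow> ('a, 'b) monoid_scheme) \<Rightarrow> (nat \<Rightarrow> 'a pmf) \<Rightarrow> (nat \<Rightarrow> real) \<Rightarrow> nat \<Rightarrow> (nat \<Rightarrow> 'a) pmf"
  where
  "prod_family_prob G Q p n = product_prob {1..n} (weight_pmf p n) G Q"

section \<open>Moderate growth\<close>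

primrec set_power :: "('a, 'b) monoid_scheme \<Rightarrow> 'a set \<Rightarrow> nat \<Rightarrow> 'a set" where
  "set_power G E 0 = {\<one>\<^bsub>G\<^esub>}"
| "set_power G E (Suc m) = set_power G E m <#>\<^bsub>G\<^esub> E"

text \<open>Exact products are required: \<open>E\<close> generates the group in the usual sense whenever it is a
  generating set here, but not conversely.\<close>

definition generating_set :: "('a, 'b) monoid_scheme \<Rightarrow> 'a set \<Rightarrow> bool" where
  "generating_set G E \<longleftrightarrow> E \<subseteq> carrier G \<and> (\<exists>m>0. set_power G E m = carrier G)"

definition group_diameter :: "('a, 'b) monoid_scheme \<Rightarrow> 'a set \<Rightarrow> nat" where
  "group_diameter G E = (LEAST m. 1 \<le> m \<and> card (set_power G E m) = card (carrier G))"

definition moderate_growth :: "('a, 'b) monoid_scheme \<Rightarrow> 'a set \<Rightarrow> real \<Rightarrow> real \<Rightarrow> bool" where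
  "moderate_growth G E A d \<longleftrightarrow> generating_set G E \<and>
     (let \<rho> = group_diameter G E in
       \<forall>m\<in>{1..\<rho>}. real (card (set_power G E m)) / real (card (set_power G E \<rho>))
                    \<ge> 1 / A * (real m / real \<rho>) powr d)"

section \<open>Order of magnitude\<close>

text \<open>Meant for sequences that are positive for \<open>n \<ge> 1\<close>; the value at \<open>n = 0\<close> does not
  affect boundedness.\<close>

definition same_order :: "(nat \<Rightarrow> real) \<Rightarrow> (nat \<Rightarrow> real) \<Rightarrow> bool" where
  "same_order a b \<longleftrightarrow> Bseq (\<lambda>n. a n / b n) \<and> Bseq (\<lambda>n. b n / a n)"

definition u_increasing :: "(nat \<Rightarrow> real) \<Rightarrow> nat \<Rightarrow> real" where
  "u_increasing l n = Max ((\<lambda>i. ln (real (i + 1)) / l i) ` {1..n})"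

definition u_decreasing :: "(nat \<Rightarrow> real) \<Rightarrow> nat \<Rightarrow> real" where
  "u_decreasing l n = Max ((\<lambda>i. ln (real (i + 1)) / l (n - i + 1)) ` {1..n})"

end

theory Submission
  imports Defs "HOL-Real_Asymp.Real_Asymp"
begin

text \<open>
  Whether a product walk has mixed is decided by the spectral gaps of its factors. Let \<open>\<gamma>\<^sub>i\<close> be the gap of
  the \<open>i\<close>th factor, \<open>r\<^sub>i\<close> the probability of choosing that factor and \<open>b\<^sub>i = r\<^sub>i \<gamma>\<^sub>i\<close> the rate at which the
  \<open>i\<close>th coordinate of the product relaxes. Write \<open>N(x)\<close> for the number of coordinates of rate at most \<open>x\<close>.

  Upper bound. The eigenvalues of the product, subtracted from one, are the sums of \<open>r\<^sub>i (1 - \<beta>)\<close>, one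
  eigenvalue \<open>\<beta>\<close> being taken from each factor. So the trace of the heat kernel, which bounds the total
  variation, is a product over the factors. In a factor of moderate growth with diameter \<open>\<rho>\<close>, the trace at
  time \<open>t\<close> is at most \<open>1 + C exp (- \<gamma> t)\<close> as soon as \<open>t\<close> is of order \<open>\<rho>\<^sup>2\<close>, and \<open>\<gamma>\<close> is of order
  \<open>1 / \<rho>\<^sup>2\<close> (\<open>spectral_gap\<close>). The trace bound comes from comparing eigenfunctions with their averages over the
  sets \<open>E\<^sup>m\<close>, whose sizes are bounded below by moderate growth; the gap is bounded below by a path argument
  and above by taking the word length as a test function. Hence, once every coordinate has been moved for a time of
  order \<open>\<rho>\<^sup>2\<close>, the square of the total variation at time \<open>t\<close> is at most \<open>exp (C F) - 1\<close>, where
  \<open>F\<close> is the sum of the \<open>exp (- 2 b\<^sub>i t)\<close> (\<open>heat_upper\<close>).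

  Lower bound. An eigenfunction for the gap of each coordinate is scaled to be 1 at the starting point. Adding these
  functions over the \<open>N(x)\<close> coordinates of rate at most \<open>x\<close> gives a statistic with mean at least
  \<open>N(x) exp (- x t)\<close> at time \<open>t\<close>, with mean zero at equilibrium, and with variance at most \<open>N(x)\<close> in both cases. By
  Chebyshev's inequality the total variation is at least \<open>1 - 8 exp (2 x t) / N(x)\<close> (\<open>heat_lower_many\<close>).

  The exponents of the two bounds agree, and both change their behaviour at the critical time \<open>\<theta>\<close>, the
  maximum of \<open>ln (1 + N(b\<^sub>i)) / (2 b\<^sub>i)\<close> over all \<open>i\<close>. If \<open>\<theta>\<close> times the smallest rate tends to
  infinity, the total variation drops from one to zero around \<open>\<theta>\<close>. Otherwise there is no cutoff, because along some
  subsequence the total variation is bounded away from one at a multiple of \<open>\<theta>\<close>, while the slowest coordinate alone keeps it away from zero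
  for arbitrarily large multiples of \<open>\<theta>\<close> (\<open>cutoff_iff\<close>).

  In discrete time \<open>exp (- t x)\<close> is replaced by \<open>(1 - x)\<^sup>m\<close>. If the supports contain the identities, then
  the eigenvalues stay away from \<open>-1\<close> and the negative ones are negligible; moreover the rates that decide
  the critical time are small, so that \<open>(1 - x)\<^sup>m\<close> is close to \<open>exp (- m x)\<close>, and the eigenfunctions of different
  coordinates are negatively correlated. So both bounds persist, and the two cases share one argument about rates.

  Finally, the rates are comparable with \<open>\<ell>\<^sub>i / q\<^sub>n\<close>. If \<open>\<ell>\<close> is increasing, the first
  \<open>i\<close> coordinates have rates at most of order \<open>\<ell>\<^sub>i / q\<^sub>n\<close>, and conversely among any \<open>i\<close> coordinates there
  is one with index, say, \<open>k \<ge> i\<close> and rate at least of order \<open>\<ell>\<^sub>k / q\<^sub>n\<close>; this makes \<open>\<theta>\<close> comparable with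
  \<open>u\<^sub>n q\<^sub>n\<close>. If \<open>\<ell>\<close> is decreasing, one counts from the other end. The smallest
  rate is of order \<open>1 / q\<^sub>n\<close> or \<open>\<ell>\<^sub>n / q\<^sub>n\<close> (\<open>increasing_comparison\<close>, \<open>decreasing_comparison\<close>).
\<close>

section \<open>Spectral decomposition on a finite set\<close>

text \<open>Completeness is carried along with orthonormality because both identities factorise over a
  product of index sets, so that tensor products of eigenbases are eigenbases.\<close>

locale eigenbasis =
  fixes S :: "'a set" and M :: "'a \<Rightarrow> 'a \<Rightarrow> real" and J :: "'j set"
    and \<beta> :: "'j \<Rightarrow> real" and \<phi> :: "'j \<Rightarrow> 'a \<Rightarrow> real"
  assumes finite_S: "finite S" and finite_J: "finite J"
    and eigen: "\<lbrakk>j \<in> J; x \<in> S\<rbrakk> \<Longrightarrow> (\<Sum>y\<in>S. M x y * \<phi> j y) = \<beta> j * \<phi> j x"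
    and orthonormal: "\<lbrakk>j \<in> J; k \<in> J\<rbrakk> \<Longrightarrow> (\<Sum>x\<in>S. \<phi> j x * \<phi> k x) = (if j = k then 1 else 0)"
    and complete: "\<lbrakk>x \<in> S; y \<in> S\<rbrakk> \<Longrightarrow> (\<Sum>j\<in>J. \<phi> j x * \<phi> j y) = (if x = y then 1 else 0)"

lemma sum_sum_mult:
  fixes c :: "'a \<Rightarrow> 'c::comm_semiring_0"
  shows "(\<Sum>y\<in>S. (\<Sum>i\<in>I. a i * b i y) * c y) = (\<Sum>i\<in>I. a i * (\<Sum>y\<in>S. b i y * c y))"
  by (simp add: sum_distrib_left sum_distrib_right mult.assoc) (rule sum.swap)

text \<open>The function \<open>r x\<close> is the point mass at \<open>x\<close> minus its projection to the span of the family.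
  The squared norms of these residuals add up to \<open>card S - n\<close>, which replaces dimension theory: as long
  as \<open>n < card S\<close> some residual is a nonzero vector orthogonal to the family, and for
  \<open>n = card S\<close> all residuals vanish, which is completeness.\<close>

lemma orthonormal_residual:
  fixes \<phi> :: "nat \<Rightarrow> 'a \<Rightarrow> real"
  assumes S: "finite S"
    and on: "\<And>j k. \<lbrakk>j < n; k < n\<rbrakk> \<Longrightarrow> (\<Sum>x\<in>S. \<phi> j x * \<phi> k x) = (if j = k then 1 else 0)"
  defines "r \<equiv> \<lambda>x y. (if x = y then 1 else 0) - (\<Sum>j<n. \<phi> j x * \<phi> j y)"
  shows "j < n \<Longrightarrow> (\<Sum>y\<in>S. r x y * \<phi> j y) = (if x \<in> S then 0 else - \<phi> j x)"
    and "(\<Sum>x\<in>S. \<Sum>y\<in>S. (r x y)\<^sup>2) = real (card S) - real n"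
proof -
  have proj: "(\<Sum>y\<in>S. (\<Sum>i<n. \<phi> i x * \<phi> i y) * \<phi> j y) = \<phi> j x" if "j < n" for x j
  proof -
    have "(\<Sum>y\<in>S. (\<Sum>i<n. \<phi> i x * \<phi> i y) * \<phi> j y) = (\<Sum>i<n. \<phi> i x * (\<Sum>y\<in>S. \<phi> i y * \<phi> j y))"
      by (rule sum_sum_mult)
    also have "\<dots> = (\<Sum>i<n. if i = j then \<phi> i x else 0)"
      using that by (intro sum.cong) (auto simp: on)
    finally show ?thesis using that by simp
  qed
  show "(\<Sum>y\<in>S. r x y * \<phi> j y) = (if x \<in> S then 0 else - \<phi> j x)" if "j < n" for x j
  proof -
    have "(\<Sum>y\<in>S. (if x = y then 1 else 0) * \<phi> j y) = (if x \<in> S then \<phi> j x else 0)"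
      using S by (simp add: if_distrib [of "\<lambda>c. c * _"] cong: if_cong)
    then show ?thesis
      using proj[OF that, of x] by (simp add: r_def left_diff_distrib sum_subtractf)
  qed
  note res = this
  have "(\<Sum>y\<in>S. (r x y)\<^sup>2) = r x x" if x: "x \<in> S" for x
  proof -
    have "(\<Sum>y\<in>S. (r x y)\<^sup>2) = (\<Sum>y\<in>S. r x y * (if x = y then 1 else 0))
        - (\<Sum>y\<in>S. r x y * (\<Sum>j<n. \<phi> j x * \<phi> j y))"
      by (simp add: sum_subtractf [symmetric] power2_eq_square right_diff_distrib [symmetric])
        (simp add: r_def)
    also have "(\<Sum>y\<in>S. r x y * (\<Sum>j<n. \<phi> j x * \<phi> j y)) = (\<Sum>j<n. \<phi> j x * (\<Sum>y\<in>S. r x y * \<phi> j y))"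
      by (simp add: sum_distrib_left mult.left_commute) (rule sum.swap)
    also have "\<dots> = 0" using res x by simp
    also have "(\<Sum>y\<in>S. r x y * (if x = y then 1 else 0)) = r x x"
      using S x by (simp add: if_distrib [of "\<lambda>c. _ * c"] cong: if_cong)
    finally show ?thesis by simp
  qed
  then have "(\<Sum>x\<in>S. \<Sum>y\<in>S. (r x y)\<^sup>2) = (\<Sum>x\<in>S. r x x)" by simp
  also have "\<dots> = real (card S) - (\<Sum>j<n. \<Sum>x\<in>S. \<phi> j x * \<phi> j x)"
    unfolding r_def sum_subtractf by (subst sum.swap [where B="{..<n}"]) simp
  also have "\<dots> = real (card S) - real n" using on by simp
  finally show "(\<Sum>x\<in>S. \<Sum>y\<in>S. (r x y)\<^sup>2) = real (card S) - real n" .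
qed

text \<open>The functions supported in \<open>S\<close> and of norm one lie in this cube, so that Tychonoff's theorem
  provides the compactness for maximising a Rayleigh quotient.\<close>

lemma compact_cube: "compact {f :: 'a \<Rightarrow> real. \<forall>x. f x \<in> (if x \<in> S then {-1..1} else {0})}"
proof -
  have "compact_space (subtopology euclideanreal (if x \<in> S then {-1..1} else {0}))" for x
    by (auto simp: compact_space_subtopology)
  then have "compactin (product_topology (\<lambda>_. euclideanreal) UNIV)
      (PiE UNIV (\<lambda>x. if x \<in> S then {-1..1::real} else {0}))"
    by (subst compactin_PiE) auto
  moreover have "PiE UNIV (\<lambda>x. if x \<in> S then {-1..1::real} else {0})
      = {f. \<forall>x. f x \<in> (if x \<in> S then {-1..1} else {0})}"
    by (auto simp: PiE_def Pi_def split: if_splits)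
  ultimately show ?thesis
    by (simp add: euclidean_product_topology)
qed

lemma linear_form_zero:
  fixes a b :: real
  assumes "\<And>e. 2 * e * a + e\<^sup>2 * b \<le> 0"
  shows "a = 0"
proof (rule ccontr)
  assume a: "a \<noteq> 0"
  define e where "e = a / (\<bar>b\<bar> + 1)"
  have a_e: "a = e * (\<bar>b\<bar> + 1)" by (simp add: e_def)
  with a have "e \<noteq> 0" by auto
  have "2 * e * a + e\<^sup>2 * b = e\<^sup>2 * (2 * (\<bar>b\<bar> + 1) + b)"
    by (subst a_e) (simp add: algebra_simps power2_eq_square)
  also have "\<dots> > 0" using \<open>e \<noteq> 0\<close> by (intro mult_pos_pos) auto
  finally show False using assms[of e] by simp
qed

text \<open>A maximiser \<open>f\<close> of the Rayleigh quotient on the orthogonal complement of the family is an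
  eigenfunction: with \<open>\<mu>\<close> the maximum, \<open>g = M f - \<mu> f\<close> stays in the complement, and the
  first variation of the quotient in the direction \<open>g\<close> is twice the squared norm of \<open>g\<close>.\<close>

lemma next_eigenfunction:
  fixes M :: "'a \<Rightarrow> 'a \<Rightarrow> real" and \<phi> :: "nat \<Rightarrow> 'a \<Rightarrow> real"
  assumes S: "finite S" and sym: "\<And>x y. \<lbrakk>x \<in> S; y \<in> S\<rbrakk> \<Longrightarrow> M x y = M y x"
    and n: "n < card S"
    and on: "\<And>j k. \<lbrakk>j < n; k < n\<rbrakk> \<Longrightarrow> (\<Sum>x\<in>S. \<phi> j x * \<phi> k x) = (if j = k then 1 else 0)"
    and eig: "\<And>j x. \<lbrakk>j < n; x \<in> S\<rbrakk> \<Longrightarrow> (\<Sum>y\<in>S. M x y * \<phi> j y) = \<beta> j * \<phi> j x"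
  shows "\<exists>f \<mu>. (\<Sum>x\<in>S. f x * f x) = 1 \<and> (\<forall>j<n. (\<Sum>x\<in>S. f x * \<phi> j x) = 0) \<and>
    (\<forall>x\<in>S. (\<Sum>y\<in>S. M x y * f y) = \<mu> * f x)"
proof -
  define ip where "ip f g = (\<Sum>x\<in>S. f x * g x)" for f g :: "'a \<Rightarrow> real"
  define A where "A f x = (if x \<in> S then \<Sum>y\<in>S. M x y * f y else 0)" for f x
  have ip_comm: "ip f g = ip g f" for f g by (simp add: ip_def mult.commute)
  have ip_add: "ip (\<lambda>x. f x + c * g x) h = ip f h + c * ip g h" for f g h c
    by (simp add: ip_def sum.distrib sum_distrib_left distrib_right mult.assoc)
  have ip_add2: "ip h (\<lambda>x. f x + c * g x) = ip h f + c * ip h g" for f g h c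
    by (simp add: ip_def sum.distrib sum_distrib_left distrib_left mult.left_commute)
  have A_sym: "ip (A f) g = ip f (A g)" for f g
  proof -
    have "ip (A f) g = (\<Sum>x\<in>S. \<Sum>y\<in>S. M x y * f y * g x)"
      unfolding ip_def A_def by (simp add: sum_distrib_right)
    also have "\<dots> = (\<Sum>y\<in>S. \<Sum>x\<in>S. M x y * f y * g x)" by (rule sum.swap)
    also have "\<dots> = ip f (A g)"
      unfolding ip_def A_def by (auto intro!: sum.cong simp: sum_distrib_left sym)
    finally show ?thesis .
  qed
  have A_add: "ip (A (\<lambda>x. f x + c * g x)) h = ip (A f) h + c * ip (A g) h" for f g h c
    by (simp add: ip_def A_def sum.distrib sum_distrib_left sum_distrib_right algebra_simps)
  have A_phi: "ip f (A (\<phi> j)) = \<beta> j * ip f (\<phi> j)" if "j < n" for f j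
    unfolding ip_def A_def using eig[OF that]
    by (simp add: sum_distrib_left mult.left_commute)
  define X where "X = {f. \<forall>x. f x \<in> (if x \<in> S then {-1..1::real} else {0})} \<inter>
     {f. ip f f = 1} \<inter> {f. \<forall>j<n. ip f (\<phi> j) = 0}"
  have cont: "continuous_on UNIV (\<lambda>f. \<Sum>x\<in>S. f x * h x)" for h :: "'a \<Rightarrow> real"
    by (intro continuous_intros continuous_on_product_coordinates)
  have cont2: "continuous_on UNIV (\<lambda>f::'a \<Rightarrow> real. \<Sum>x\<in>S. f x * f x)"
    by (intro continuous_intros continuous_on_product_coordinates)
  have cont3: "continuous_on UNIV (\<lambda>f::'a \<Rightarrow> real. \<Sum>x\<in>S. (\<Sum>y\<in>S. M x y * f y) * f x)"
    by (intro continuous_intros continuous_on_product_coordinates)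
  have "closed {f. ip f f = 1}"
    unfolding ip_def using cont2 by (intro closed_Collect_eq) auto
  moreover have "closed {f. \<forall>j<n. ip f (\<phi> j) = 0}"
  proof -
    have "{f. \<forall>j<n. ip f (\<phi> j) = 0} = (\<Inter>j\<in>{..<n}. {f. ip f (\<phi> j) = 0})" by auto
    then show ?thesis
      unfolding ip_def using cont by (auto intro!: closed_INT closed_Collect_eq)
  qed
  ultimately have "compact X"
    unfolding X_def by (intro compact_Int_closed compact_cube)
  have normalise: "\<exists>c>0. (\<lambda>x. c * f x) \<in> X \<and> c\<^sup>2 * ip f f = 1"
    if "\<And>x. x \<notin> S \<Longrightarrow> f x = 0" "ip f f > 0" "\<And>j. j < n \<Longrightarrow> ip f (\<phi> j) = 0" for f
  proof -
    define c where "c = 1 / sqrt (ip f f)"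
    have c: "c > 0" "c\<^sup>2 * ip f f = 1"
      unfolding c_def using that(2) by (auto simp: power_divide)
    have norm: "ip (\<lambda>x. c * f x) (\<lambda>x. c * f x) = 1"
      using c(2) by (simp add: ip_def power2_eq_square sum_distrib_left algebra_simps)
    have "\<bar>c * f x\<bar> \<le> 1" if "x \<in> S" for x
    proof -
      have "(c * f x)\<^sup>2 \<le> ip (\<lambda>x. c * f x) (\<lambda>x. c * f x)"
        unfolding ip_def using member_le_sum[OF that, of "\<lambda>x. (c * f x) * (c * f x)"] S
        by (simp add: power2_eq_square)
      then show ?thesis using norm by (simp add: abs_square_le_1)
    qed
    moreover have "ip (\<lambda>x. c * f x) (\<phi> j) = 0" if "j < n" for j
      using \<open>\<And>j. j < n \<Longrightarrow> ip f (\<phi> j) = 0\<close>[OF that]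
      by (simp add: ip_def sum_distrib_left [symmetric] mult.assoc)
    ultimately show ?thesis
      using c norm that(1) unfolding X_def by (intro exI[of _ c]) (auto simp: abs_le_iff)
  qed
  have "X \<noteq> {}"
  proof -
    define r where "r = (\<lambda>x y. (if x = y then 1 else 0) - (\<Sum>j<n. \<phi> j x * \<phi> j y))"
    have R1: "(\<Sum>y\<in>S. r x y * \<phi> j y) = (if x \<in> S then 0 else - \<phi> j x)" if "j < n" for x j
      unfolding r_def by (rule orthonormal_residual(1)) (use S on that in auto)
    have R2: "(\<Sum>x\<in>S. \<Sum>y\<in>S. (r x y)\<^sup>2) = real (card S) - real n"
      unfolding r_def by (rule orthonormal_residual(2)) (use S on in auto)
    have "(\<Sum>x\<in>S. \<Sum>y\<in>S. (r x y)\<^sup>2) > 0" using R2 n by simp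
    then obtain x where x: "x \<in> S" "(\<Sum>y\<in>S. (r x y)\<^sup>2) > 0"
      by (metis (no_types, lifting) sum_nonpos not_less)
    define f where "f y = (if y \<in> S then r x y else 0)" for y
    have "ip f f > 0" using x(2) by (simp add: ip_def f_def power2_eq_square)
    moreover have "ip f (\<phi> j) = 0" if "j < n" for j
      using R1[OF that, of x] x(1) on by (simp add: ip_def f_def)
    ultimately show ?thesis using normalise[of f] by (auto simp: f_def)
  qed
  have "continuous_on X (\<lambda>f. ip (A f) f)"
  proof -
    have "ip (A f) f = (\<Sum>x\<in>S. (\<Sum>y\<in>S. M x y * f y) * f x)" for f
      unfolding ip_def A_def by (intro sum.cong) auto
    then show ?thesis using cont3 continuous_on_subset by fastforce
  qed
  then obtain f where f: "f \<in> X" and fmax: "\<And>g. g \<in> X \<Longrightarrow> ip (A g) g \<le> ip (A f) f"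
    using continuous_attains_sup[OF \<open>compact X\<close> \<open>X \<noteq> {}\<close>] by blast
  define \<mu> where "\<mu> = ip (A f) f"
  have f0: "f x = 0" if "x \<notin> S" for x
  proof -
    have "f x \<in> (if x \<in> S then {-1..1} else {0})" using f unfolding X_def by blast
    then show ?thesis using that by simp
  qed
  have f1: "ip f f = 1" and fphi: "\<And>j. j < n \<Longrightarrow> ip f (\<phi> j) = 0" using f by (auto simp: X_def)
  have ray: "ip (A g) g \<le> \<mu> * ip g g"
    if g: "\<And>x. x \<notin> S \<Longrightarrow> g x = 0" "\<And>j. j < n \<Longrightarrow> ip g (\<phi> j) = 0" for g
  proof (cases "ip g g > 0")
    case True
    then obtain c where c: "c > 0" "(\<lambda>x. c * g x) \<in> X" "c\<^sup>2 * ip g g = 1"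
      using normalise[of g] g by auto
    have "ip (A (\<lambda>x. c * g x)) (\<lambda>x. c * g x) = c\<^sup>2 * ip (A g) g"
      by (simp add: ip_def A_def power2_eq_square sum_distrib_left sum_distrib_right algebra_simps)
    with fmax[OF c(2)] have "c\<^sup>2 * ip (A g) g \<le> \<mu>" by (simp add: \<mu>_def)
    also have "\<mu> = c\<^sup>2 * (\<mu> * ip g g)" using c(3) by (simp add: algebra_simps)
    finally show ?thesis using c(1) by simp
  next
    case False
    have "g x = 0" if "x \<in> S" for x
    proof -
      have "g x * g x \<le> ip g g"
        unfolding ip_def using member_le_sum[OF that, of "\<lambda>x. g x * g x"] S by simp
      then show ?thesis using False by (metis linorder_not_less mult_eq_0_iff not_real_square_gt_zero order.trans)
    qed
    then show ?thesis by (simp add: ip_def)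
  qed
  define g where "g = (\<lambda>x. A f x - \<mu> * f x)"
  have g0: "g x = 0" if "x \<notin> S" for x using that f0 by (simp add: g_def A_def)
  have gphi: "ip g (\<phi> j) = 0" if "j < n" for j
  proof -
    have "ip g (\<phi> j) = ip (A f) (\<phi> j) - \<mu> * ip f (\<phi> j)"
      using ip_add[of "A f" "-\<mu>" f "\<phi> j"] by (simp add: g_def)
    then show ?thesis using that fphi A_sym A_phi by simp
  qed
  \<comment> \<open>The first variation vanishes, and it equals the squared norm of \<open>g\<close>.\<close>
  have "ip (A f) g - \<mu> * ip f g = 0"
  proof (rule linear_form_zero)
    fix e :: real
    let ?h = "\<lambda>x. f x + e * g x"
    have "ip (A ?h) ?h \<le> \<mu> * ip ?h ?h"
      by (rule ray) (auto simp: f0 g0 ip_add fphi gphi)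
    moreover have "ip (A ?h) ?h = ip (A f) f + 2 * e * ip (A f) g + e\<^sup>2 * ip (A g) g"
    proof -
      have "ip (A g) f = ip (A f) g" by (metis A_sym ip_comm)
      then show ?thesis
        unfolding A_add ip_add2 by (simp add: power2_eq_square algebra_simps)
    qed
    moreover have "ip ?h ?h = ip f f + 2 * e * ip f g + e\<^sup>2 * ip g g"
      unfolding ip_add ip_add2 by (simp add: ip_comm[of g f] power2_eq_square algebra_simps)
    ultimately show "2 * e * (ip (A f) g - \<mu> * ip f g) + e\<^sup>2 * (ip (A g) g - \<mu> * ip g g) \<le> 0"
      using f1 \<mu>_def by (simp add: algebra_simps)
  qed
  moreover have "ip g g = ip (A f) g - \<mu> * ip f g"
    using ip_add[of "A f" "-\<mu>" f g] by (simp add: g_def)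
  ultimately have gg: "ip g g = 0" by simp
  have "g x = 0" if "x \<in> S" for x
  proof -
    have "g x * g x \<le> 0"
      using gg member_le_sum[OF that, of "\<lambda>x. g x * g x"] S by (simp add: ip_def)
    then show ?thesis by (auto simp: mult_le_0_iff)
  qed
  then have "\<forall>x\<in>S. (\<Sum>y\<in>S. M x y * f y) = \<mu> * f x" by (simp add: g_def A_def)
  then show ?thesis using f1 fphi unfolding ip_def by blast
qed

theorem spectral_theorem:
  fixes M :: "'a \<Rightarrow> 'a \<Rightarrow> real"
  assumes S: "finite S" and sym: "\<And>x y. \<lbrakk>x \<in> S; y \<in> S\<rbrakk> \<Longrightarrow> M x y = M y x"
  obtains \<beta> :: "nat \<Rightarrow> real" and \<phi> where "eigenbasis S M {..<card S} \<beta> \<phi>"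
proof -
  have "\<exists>\<beta> \<phi>. (\<forall>j<n. \<forall>k<n. (\<Sum>x\<in>S. \<phi> j x * \<phi> k x) = (if j = k then 1 else 0)) \<and>
     (\<forall>j<n. \<forall>x\<in>S. (\<Sum>y\<in>S. M x y * \<phi> j y) = \<beta> j * \<phi> j x)" if "n \<le> card S" for n
    using that
  proof (induction n)
    case (Suc n)
    then obtain \<beta> \<phi> where IH: "\<And>j k. \<lbrakk>j < n; k < n\<rbrakk> \<Longrightarrow> (\<Sum>x\<in>S. \<phi> j x * \<phi> k x) = (if j = k then 1 else 0)"
      "\<And>j x. \<lbrakk>j < n; x \<in> S\<rbrakk> \<Longrightarrow> (\<Sum>y\<in>S. M x y * \<phi> j y) = \<beta> j * \<phi> j x"
      by (metis Suc_leD)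
    obtain f \<mu> where f: "(\<Sum>x\<in>S. f x * f x) = 1" "\<And>j. j < n \<Longrightarrow> (\<Sum>x\<in>S. f x * \<phi> j x) = 0"
      "\<And>x. x \<in> S \<Longrightarrow> (\<Sum>y\<in>S. M x y * f y) = \<mu> * f x"
      using next_eigenfunction[of S M n \<phi> \<beta>, OF S sym _ IH] Suc.prems by auto
    have f': "(\<Sum>x\<in>S. \<phi> j x * f x) = 0" if "j < n" for j
      using f(2)[OF that] by (simp add: mult.commute)
    show ?case
      by (rule exI[of _ "\<beta>(n := \<mu>)"], rule exI[of _ "\<phi>(n := f)"])
        (auto simp: less_Suc_eq IH f f')
  qed auto
  from this[of "card S"] obtain \<beta> \<phi> where *:
     "\<And>j k. \<lbrakk>j < card S; k < card S\<rbrakk> \<Longrightarrow> (\<Sum>x\<in>S. \<phi> j x * \<phi> k x) = (if j = k then 1 else 0)"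
     "\<And>j x. \<lbrakk>j < card S; x \<in> S\<rbrakk> \<Longrightarrow> (\<Sum>y\<in>S. M x y * \<phi> j y) = \<beta> j * \<phi> j x"
    by blast
  have "(\<Sum>j<card S. \<phi> j x * \<phi> j y) = (if x = y then 1 else 0)" if "x \<in> S" "y \<in> S" for x y
  proof -
    have "(\<Sum>x\<in>S. \<Sum>y\<in>S. ((if x = y then 1 else 0) - (\<Sum>j<card S. \<phi> j x * \<phi> j y))\<^sup>2) = 0"
      using orthonormal_residual(2)[OF S *(1)] by simp
    then show ?thesis
      using S that by (simp add: sum_nonneg sum_nonneg_eq_0_iff split: if_splits)
  qed
  with * have "eigenbasis S M {..<card S} \<beta> \<phi>"
    using S by unfold_locales auto
  then show thesis by (rule that)
qed

context eigenbasis
begin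

lemma expand:
  assumes "y \<in> S" shows "f y = (\<Sum>j\<in>J. (\<Sum>x\<in>S. f x * \<phi> j x) * \<phi> j y)"
proof -
  have "(\<Sum>j\<in>J. (\<Sum>x\<in>S. f x * \<phi> j x) * \<phi> j y) = (\<Sum>x\<in>S. f x * (\<Sum>j\<in>J. \<phi> j x * \<phi> j y))"
    by (simp add: sum_distrib_left sum_distrib_right mult.assoc) (rule sum.swap)
  also have "\<dots> = (\<Sum>x\<in>S. if x = y then f x else 0)"
    using assms by (intro sum.cong) (auto simp: complete)
  finally show ?thesis using assms finite_S by simp
qed

lemma parseval: "(\<Sum>x\<in>S. f x * g x) = (\<Sum>j\<in>J. (\<Sum>x\<in>S. f x * \<phi> j x) * (\<Sum>x\<in>S. g x * \<phi> j x))"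
proof -
  have "(\<Sum>x\<in>S. f x * g x) = (\<Sum>x\<in>S. \<Sum>j\<in>J. (\<Sum>z\<in>S. f z * \<phi> j z) * \<phi> j x * g x)"
    using expand[of _ f] by (intro sum.cong) (auto simp: sum_distrib_right [symmetric])
  also have "\<dots> = (\<Sum>j\<in>J. \<Sum>x\<in>S. (\<Sum>z\<in>S. f z * \<phi> j z) * \<phi> j x * g x)" by (rule sum.swap)
  finally show ?thesis by (simp add: sum_distrib_left mult.assoc mult.commute[of "g _"])
qed

lemma entry: assumes "x \<in> S" "y \<in> S" shows "M x y = (\<Sum>j\<in>J. \<beta> j * \<phi> j x * \<phi> j y)"
  using expand[OF assms(2), of "M x"] eigen[OF _ assms(1)] by simp

lemma card_index: "card J = card S"
proof -
  have "real (card J) = (\<Sum>j\<in>J. \<Sum>x\<in>S. \<phi> j x * \<phi> j x)" using orthonormal by simp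
  also have "\<dots> = (\<Sum>x\<in>S. \<Sum>j\<in>J. \<phi> j x * \<phi> j x)" by (rule sum.swap)
  also have "\<dots> = real (card S)" using complete by simp
  finally show ?thesis by simp
qed

lemma shifted: "eigenbasis S (\<lambda>x y. M x y - mat_one x y) J (\<lambda>j. \<beta> j - 1) \<phi>"
  using finite_S eigen
  by unfold_locales
    (auto simp: finite_J orthonormal complete mat_one_def left_diff_distrib sum_subtractf
      if_distrib [of "\<lambda>c. c * _"] cong: if_cong)

lemma mat_pow_spectral:
  assumes "x \<in> S" "y \<in> S"
  shows "mat_pow S M m x y = (\<Sum>j\<in>J. \<beta> j ^ m * \<phi> j x * \<phi> j y)"
  using assms
proof (induction m arbitrary: y)
  case 0 then show ?case using complete by (simp add: mat_one_def)
next
  case (Suc m)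
  have "mat_pow S M (Suc m) x y = (\<Sum>z\<in>S. (\<Sum>j\<in>J. \<beta> j ^ m * \<phi> j x * \<phi> j z) * (\<Sum>k\<in>J. \<beta> k * \<phi> k z * \<phi> k y))"
    using Suc by (auto intro!: sum.cong simp: entry)
  also have "\<dots> = (\<Sum>k\<in>J. \<beta> k * \<phi> k y * (\<Sum>z\<in>S. (\<Sum>j\<in>J. \<beta> j ^ m * \<phi> j x * \<phi> j z) * \<phi> k z))"
    by (simp only: sum_distrib_left, subst sum.swap) (simp add: mult_ac)
  also have "\<dots> = (\<Sum>k\<in>J. \<beta> k * \<phi> k y * (\<beta> k ^ m * \<phi> k x))"
  proof (intro sum.cong refl arg_cong2 [where f="(*)"])
    fix k assume k: "k \<in> J"
    have "(\<Sum>z\<in>S. (\<Sum>j\<in>J. \<beta> j ^ m * \<phi> j x * \<phi> j z) * \<phi> k z) = (\<Sum>j\<in>J. \<beta> j ^ m * \<phi> j x * (\<Sum>z\<in>S. \<phi> j z * \<phi> k z))"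
      by (simp add: sum_distrib_left sum_distrib_right mult.assoc) (rule sum.swap)
    also have "\<dots> = (\<Sum>j\<in>J. if j = k then \<beta> j ^ m * \<phi> j x else 0)"
      using k by (intro sum.cong) (auto simp: orthonormal)
    finally show "(\<Sum>z\<in>S. (\<Sum>j\<in>J. \<beta> j ^ m * \<phi> j x * \<phi> j z) * \<phi> k z) = \<beta> k ^ m * \<phi> k x"
      using k finite_J by simp
  qed
  finally show ?case by (simp add: mult_ac)
qed

lemma mat_exp_spectral:
  assumes "x \<in> S" "y \<in> S"
  shows "mat_exp S M t x y = (\<Sum>j\<in>J. exp (t * \<beta> j) * \<phi> j x * \<phi> j y)"
    and "(\<lambda>m. t ^ m / fact m * mat_pow S M m x y) sums mat_exp S M t x y"
proof -
  have "(\<lambda>m. \<Sum>j\<in>J. (t * \<beta> j) ^ m /\<^sub>R fact m * (\<phi> j x * \<phi> j y)) sums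
      (\<Sum>j\<in>J. exp (t * \<beta> j) * (\<phi> j x * \<phi> j y))"
    by (intro sums_sum sums_mult2 exp_converges)
  moreover have "(\<lambda>m. \<Sum>j\<in>J. (t * \<beta> j) ^ m /\<^sub>R fact m * (\<phi> j x * \<phi> j y))
      = (\<lambda>m. t ^ m / fact m * mat_pow S M m x y)"
    using assms by (auto simp: mat_pow_spectral sum_distrib_left power_mult_distrib field_simps intro!: sum.cong)
  ultimately have *: "(\<lambda>m. t ^ m / fact m * mat_pow S M m x y) sums
      (\<Sum>j\<in>J. exp (t * \<beta> j) * \<phi> j x * \<phi> j y)" by (simp add: mult.assoc)
  from sums_unique[OF this] show 1: "mat_exp S M t x y = (\<Sum>j\<in>J. exp (t * \<beta> j) * \<phi> j x * \<phi> j y)"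
    by (simp add: mat_exp_def)
  show "(\<lambda>m. t ^ m / fact m * mat_pow S M m x y) sums mat_exp S M t x y" using * 1 by simp
qed

text \<open>In the expansion of an eigenfunction only components with the same eigenvalue occur.\<close>

lemma functional_calculus:
  assumes "\<And>x. x \<in> S \<Longrightarrow> (\<Sum>y\<in>S. M x y * \<psi> y) = b * \<psi> x"
    and "x \<in> S"
  shows "(\<Sum>y\<in>S. (\<Sum>j\<in>J. h (\<beta> j) * \<phi> j x * \<phi> j y) * \<psi> y) = h b * \<psi> x"
proof -
  define c where "c j = (\<Sum>x\<in>S. \<psi> x * \<phi> j x)" for j
  have c: "h (\<beta> j) * c j = h b * c j" if j: "j \<in> J" for j
  proof -
    have "b * c j = (\<Sum>x\<in>S. (\<Sum>y\<in>S. M x y * \<psi> y) * \<phi> j x)"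
      using assms(1) by (simp add: c_def sum_distrib_left mult.assoc)
    also have "\<dots> = (\<Sum>y\<in>S. \<Sum>x\<in>S. M x y * \<psi> y * \<phi> j x)"
      by (simp add: sum_distrib_right) (rule sum.swap)
    also have "\<dots> = (\<Sum>y\<in>S. \<psi> y * (\<Sum>x\<in>S. M y x * \<phi> j x))"
      unfolding sum_distrib_left by (intro sum.cong refl) (auto simp: entry mult_ac)
    also have "\<dots> = \<beta> j * c j"
      using j eigen by (simp add: c_def sum_distrib_left mult_ac)
    finally show ?thesis by auto
  qed
  have "(\<Sum>y\<in>S. (\<Sum>j\<in>J. h (\<beta> j) * \<phi> j x * \<phi> j y) * \<psi> y) = (\<Sum>j\<in>J. h (\<beta> j) * \<phi> j x * c j)"
    unfolding c_def by (simp add: sum_distrib_left sum_distrib_right) (subst sum.swap, simp add: mult_ac)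
  also have "\<dots> = (\<Sum>j\<in>J. h b * (c j * \<phi> j x))"
    using c by (intro sum.cong) (auto simp: mult_ac)
  also have "\<dots> = h b * \<psi> x" using expand[OF assms(2), of \<psi>] by (simp add: c_def sum_distrib_left)
  finally show ?thesis .
qed

text \<open>Parseval's identity in \<open>y\<close>, then normalisation of the eigenfunctions in \<open>x\<close>.\<close>

lemma hilbert_schmidt:
  "(\<Sum>x\<in>S. \<Sum>y\<in>S. (\<Sum>j\<in>J. h j * \<phi> j x * \<phi> j y)\<^sup>2) = (\<Sum>j\<in>J. (h j)\<^sup>2)"
proof -
  have "(\<Sum>y\<in>S. (\<Sum>j\<in>J. h j * \<phi> j x * \<phi> j y)\<^sup>2) = (\<Sum>j\<in>J. (h j * \<phi> j x)\<^sup>2)" for x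
  proof -
    have c: "(\<Sum>y\<in>S. (\<Sum>j\<in>J. h j * \<phi> j x * \<phi> j y) * \<phi> k y) = h k * \<phi> k x" if k: "k \<in> J" for k
    proof -
      have "(\<Sum>y\<in>S. (\<Sum>j\<in>J. h j * \<phi> j x * \<phi> j y) * \<phi> k y) = (\<Sum>j\<in>J. h j * \<phi> j x * (\<Sum>y\<in>S. \<phi> j y * \<phi> k y))"
        by (simp add: sum_distrib_left sum_distrib_right mult.assoc) (rule sum.swap)
      also have "\<dots> = (\<Sum>j\<in>J. if j = k then h j * \<phi> j x else 0)"
        using k by (intro sum.cong) (auto simp: orthonormal)
      finally show ?thesis using k finite_J by simp
    qed
    show ?thesis using parseval[of "\<lambda>y. \<Sum>j\<in>J. h j * \<phi> j x * \<phi> j y" "\<lambda>y. \<Sum>j\<in>J. h j * \<phi> j x * \<phi> j y"]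
      by (simp add: c power2_eq_square)
  qed
  then have "(\<Sum>x\<in>S. \<Sum>y\<in>S. (\<Sum>j\<in>J. h j * \<phi> j x * \<phi> j y)\<^sup>2) = (\<Sum>j\<in>J. \<Sum>x\<in>S. (h j * \<phi> j x)\<^sup>2)"
    by (simp, subst sum.swap) simp
  also have "\<dots> = (\<Sum>j\<in>J. (h j)\<^sup>2)"
    using orthonormal
    by (intro sum.cong) (simp_all add: power_mult_distrib sum_distrib_left[symmetric] power2_eq_square [of "\<phi> _ _"])
  finally show ?thesis .
qed

end

section \<open>Random walks and functions of their transition matrix\<close>

locale fin_walk = group G for G :: "('a, 'b) monoid_scheme" (structure) +
  fixes Q :: "'a pmf"
  assumes fin: "finite (carrier G)" and supp: "set_pmf Q \<subseteq> carrier G"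
begin

lemma card_pos: "0 < card (carrier G)"
  using fin by (auto simp: card_gt_0_iff)

lemma sum_pmf: "(\<Sum>g\<in>carrier G. pmf Q g) = 1"
  by (rule sum_pmf_eq_1) (use fin supp in auto)

lemma sum_translate:
  assumes "x \<in> carrier G" shows "(\<Sum>y\<in>carrier G. f (x \<otimes> y)) = (\<Sum>y\<in>carrier G. f y)"
  using assms by (intro sum.reindex_bij_witness[of _ "\<lambda>y. inv x \<otimes> y" "\<lambda>y. x \<otimes> y"])
    (auto simp: m_assoc[symmetric])

lemma sum_right_translate:
  assumes "x \<in> carrier G" shows "(\<Sum>y\<in>carrier G. f (y \<otimes> x)) = (\<Sum>y\<in>carrier G. f y)"
  using assms by (intro sum.reindex_bij_witness[of _ "\<lambda>y. y \<otimes> inv x" "\<lambda>y. y \<otimes> x"])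
    (auto simp: m_assoc)

lemma transition_apply:
  assumes "x \<in> carrier G"
  shows "(\<Sum>y\<in>carrier G. transition G Q x y * f y) = (\<Sum>g\<in>carrier G. pmf Q g * f (x \<otimes> g))"
  unfolding transition_def
  by (subst sum_translate[OF assms, symmetric]) (use assms in \<open>auto simp: m_assoc[symmetric] intro!: sum.cong\<close>)

lemma transition_translate:
  "\<lbrakk>a \<in> carrier G; x \<in> carrier G; y \<in> carrier G\<rbrakk> \<Longrightarrow> transition G Q (a \<otimes> x) (a \<otimes> y) = transition G Q x y"
  unfolding transition_def by (simp add: inv_mult_group m_assoc) (simp add: m_assoc[symmetric])

lemma discrete_kernel_nonneg: "0 \<le> discrete_kernel G Q m x y"
  unfolding discrete_kernel_def
  by (induction m arbitrary: y) (auto simp: mat_one_def transition_def intro!: sum_nonneg mult_nonneg_nonneg)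

lemma discrete_kernel_translate:
  assumes "a \<in> carrier G" "x \<in> carrier G" "y \<in> carrier G"
  shows "discrete_kernel G Q m (a \<otimes> x) (a \<otimes> y) = discrete_kernel G Q m x y"
  using assms(3) unfolding discrete_kernel_def
proof (induction m arbitrary: y)
  case 0 then show ?case using assms by (simp add: mat_one_def)
next
  case (Suc m)
  then show ?case using assms
    by (simp, subst sum_translate[OF assms(1), symmetric]) (auto intro!: sum.cong simp: transition_translate)
qed

lemma uniform_prob:
  "F \<subseteq> carrier G \<Longrightarrow> measure_pmf.prob (pmf_of_set (carrier G)) F = card F / card (carrier G)"
  using fin by (subst measure_pmf_of_set) (auto simp: Int_absorb1)

lemma tv_ge:
  assumes "F \<subseteq> carrier G"
  shows "(\<Sum>y\<in>F. \<mu> y) - card F / card (carrier G) \<le> tv_to_uniform G \<mu>"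
  unfolding tv_to_uniform_def using fin assms
  by (intro Max_ge) (auto simp: uniform_prob[symmetric])

lemma tv_le:
  assumes "\<And>F. F \<subseteq> carrier G \<Longrightarrow> (\<Sum>y\<in>F. \<mu> y) - card F / card (carrier G) \<le> c"
  shows "tv_to_uniform G \<mu> \<le> c"
  unfolding tv_to_uniform_def using fin assms
  by (intro Max.boundedI) (auto simp: uniform_prob)

lemma tv_nonneg: "0 \<le> tv_to_uniform G \<mu>"
  using tv_ge[of "{}" \<mu>] by simp

end

locale sym_walk = fin_walk +
  assumes sym: "g \<in> carrier G \<Longrightarrow> pmf Q (inv g) = pmf Q g"
begin

abbreviation "eigenfunction f b \<equiv>
  (\<forall>x\<in>carrier G. (\<Sum>y\<in>carrier G. transition G Q x y * f y) = b * f x)"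

lemma transition_sym: "\<lbrakk>x \<in> carrier G; y \<in> carrier G\<rbrakk> \<Longrightarrow> transition G Q x y = transition G Q y x"
  unfolding transition_def using sym[of "inv x \<otimes> y"] by (simp add: inv_mult_group)

lemma eigenfunction_const: "eigenfunction (\<lambda>_. c) 1"
  using transition_apply[of _ "\<lambda>_. c"] sum_pmf by (simp add: sum_distrib_right[symmetric])

lemma sum_transition_apply: "(\<Sum>x\<in>carrier G. \<Sum>y\<in>carrier G. transition G Q x y * f y) = (\<Sum>y\<in>carrier G. f y)"
proof -
  have "(\<Sum>x\<in>carrier G. \<Sum>y\<in>carrier G. transition G Q x y * f y) = (\<Sum>y\<in>carrier G. (\<Sum>x\<in>carrier G. transition G Q y x * 1) * f y)"
    by (subst sum.swap) (auto intro!: sum.cong simp: sum_distrib_right transition_sym)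
  also have "\<dots> = (\<Sum>y\<in>carrier G. f y)"
    using eigenfunction_const[of 1] by (intro sum.cong) auto
  finally show ?thesis .
qed

lemma eigenfunction_sum_zero:
  assumes "eigenfunction f b" "b \<noteq> 1" shows "(\<Sum>x\<in>carrier G. f x) = 0"
proof -
  have "(\<Sum>y\<in>carrier G. f y) = b * (\<Sum>x\<in>carrier G. f x)"
    using assms(1) by (subst sum_transition_apply[symmetric]) (simp add: sum_distrib_left)
  then show ?thesis using assms(2) by simp
qed

text \<open>Evaluate the eigenvalue equation at a point where \<open>\<bar>f\<bar>\<close> is maximal. Separating the holding
  probability \<open>pmf Q \<one>\<close> from the sum keeps the eigenvalues away from \<open>-1\<close>.\<close>

lemma eigenvalue_bounds:
  assumes f: "eigenfunction f b" and nz: "x0 \<in> carrier G" "f x0 \<noteq> 0"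
  shows "b \<le> 1" and "2 * pmf Q \<one> - 1 \<le> b"
proof -
  have "Max ((\<lambda>x. \<bar>f x\<bar>) ` carrier G) \<in> (\<lambda>x. \<bar>f x\<bar>) ` carrier G"
    using fin nz by (intro Max_in) auto
  then obtain x where x: "x \<in> carrier G" and "Max ((\<lambda>x. \<bar>f x\<bar>) ` carrier G) = \<bar>f x\<bar>" by auto
  then have max: "\<bar>f y\<bar> \<le> \<bar>f x\<bar>" if "y \<in> carrier G" for y
    using fin that Max_ge[of "(\<lambda>x. \<bar>f x\<bar>) ` carrier G" "\<bar>f y\<bar>"] by auto
  then have pos: "\<bar>f x\<bar> > 0" using max[OF nz(1)] nz by auto
  have eq: "(\<Sum>g\<in>carrier G. pmf Q g * f (x \<otimes> g)) = b * f x"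
    using f x by (simp add: transition_apply)
  then have "(b - pmf Q \<one>) * f x = (\<Sum>g\<in>carrier G - {\<one>}. pmf Q g * f (x \<otimes> g))"
    using fin x by (subst (asm) sum.remove[of _ \<one>]) (auto simp: algebra_simps)
  then have "\<bar>b - pmf Q \<one>\<bar> * \<bar>f x\<bar> \<le> (\<Sum>g\<in>carrier G - {\<one>}. \<bar>pmf Q g * f (x \<otimes> g)\<bar>)"
    by (metis abs_mult sum_abs)
  also have "\<dots> \<le> (\<Sum>g\<in>carrier G - {\<one>}. pmf Q g * \<bar>f x\<bar>)"
    using x by (intro sum_mono) (auto simp: abs_mult intro!: mult_left_mono max)
  also have "\<dots> = (1 - pmf Q \<one>) * \<bar>f x\<bar>"
    using sum_pmf fin sum.remove[of "carrier G" \<one> "pmf Q"] by (simp add: sum_distrib_right[symmetric])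
  finally have "\<bar>b - pmf Q \<one>\<bar> \<le> 1 - pmf Q \<one>" using pos by simp
  then show "b \<le> 1" "2 * pmf Q \<one> - 1 \<le> b" by linarith+
qed

lemma eigenfunction_translate:
  assumes f: "eigenfunction f b" and a: "a \<in> carrier G"
  shows "eigenfunction (\<lambda>x. f (a \<otimes> x)) b"
  using f a by (auto simp: transition_apply m_assoc[symmetric])

lemma eigenfunction_scale:
  assumes f: "eigenfunction f b" shows "eigenfunction (\<lambda>x. c * f x) b"
  using f by (auto simp: sum_distrib_left[symmetric] mult.left_commute)

text \<open>Left translations commute with the walk, so the maximum of an eigenfunction can be moved to
  the starting point.\<close>

lemma eigenfunction_peak:
  assumes f: "eigenfunction f b" and nz: "x0 \<in> carrier G" "f x0 \<noteq> 0"
  obtains \<psi> where "eigenfunction \<psi> b" "\<psi> \<one> = 1" "\<And>x. x \<in> carrier G \<Longrightarrow> \<bar>\<psi> x\<bar> \<le> 1"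
proof -
  have "Max ((\<lambda>x. \<bar>f x\<bar>) ` carrier G) \<in> (\<lambda>x. \<bar>f x\<bar>) ` carrier G"
    using fin nz by (intro Max_in) auto
  then obtain x where x: "x \<in> carrier G" and "Max ((\<lambda>x. \<bar>f x\<bar>) ` carrier G) = \<bar>f x\<bar>" by auto
  then have max: "\<bar>f y\<bar> \<le> \<bar>f x\<bar>" if "y \<in> carrier G" for y
    using fin that Max_ge[of "(\<lambda>x. \<bar>f x\<bar>) ` carrier G" "\<bar>f y\<bar>"] by auto
  then have pos: "f x \<noteq> 0" using max[OF nz(1)] nz by auto
  show thesis
  proof (rule that)
    show "eigenfunction (\<lambda>y. (1 / f x) * f (x \<otimes> y)) b"
      by (rule eigenfunction_scale[OF eigenfunction_translate[OF f x]])
  qed (use x max pos in \<open>auto simp: divide_le_eq_1 abs_divide\<close>)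
qed

lemma discrete_kernel_eigenfunction:
  assumes "eigenfunction f b" "x \<in> carrier G"
  shows "(\<Sum>y\<in>carrier G. discrete_kernel G Q m x y * f y) = b ^ m * f x"
proof (induction m)
  case 0
  then show ?case using assms fin
    by (simp add: discrete_kernel_def mat_one_def if_distrib [of "\<lambda>c. c * _"] cong: if_cong)
next
  case (Suc m)
  have "(\<Sum>y\<in>carrier G. discrete_kernel G Q (Suc m) x y * f y)
      = (\<Sum>z\<in>carrier G. discrete_kernel G Q m x z * (\<Sum>y\<in>carrier G. transition G Q z y * f y))"
    unfolding discrete_kernel_def by (simp add: sum_sum_mult)
  also have "\<dots> = b * (\<Sum>z\<in>carrier G. discrete_kernel G Q m x z * f z)"
    using assms by (simp add: sum_distrib_left mult.left_commute)
  finally show ?case using Suc by simp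
qed

lemma obtain_eigenbasis:
  obtains \<beta> \<phi> where "eigenbasis (carrier G) (transition G Q) {..<card (carrier G)} \<beta> (\<phi> :: nat \<Rightarrow> 'a \<Rightarrow> real)"
  by (rule spectral_theorem[of "carrier G" "transition G Q"]) (use fin transition_sym that in blast)+

lemma heat_kernel_spectral:
  assumes E: "eigenbasis (carrier G) (transition G Q) J \<beta> \<phi>" and xy: "x \<in> carrier G" "y \<in> carrier G"
  shows "heat_kernel G Q t x y = (\<Sum>j\<in>J. exp (t * (\<beta> j - 1)) * \<phi> j x * \<phi> j y)"
  unfolding heat_kernel_def by (rule eigenbasis.mat_exp_spectral(1)[OF eigenbasis.shifted[OF E] xy])

lemma heat_kernel_eigenfunction:
  assumes "eigenfunction f b" "x \<in> carrier G"
  shows "(\<Sum>y\<in>carrier G. heat_kernel G Q t x y * f y) = exp (t * (b - 1)) * f x"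
proof -
  obtain \<beta> and \<phi> :: "nat \<Rightarrow> 'a \<Rightarrow> real" where E: "eigenbasis (carrier G) (transition G Q) {..<card (carrier G)} \<beta> \<phi>"
    by (rule obtain_eigenbasis)
  show ?thesis
    using eigenbasis.functional_calculus[OF E, of f b x "\<lambda>b. exp (t * (b - 1))"] assms
    by (simp add: heat_kernel_spectral[OF E])
qed

text \<open>Since \<open>exp t * H\<^sub>t\<close> is a series in the powers of the transition matrix with coefficients
  \<open>t ^ m / fact m\<close>, positivity and translation invariance pass from these powers to \<open>H\<^sub>t\<close>.\<close>

lemma heat_kernel_poisson:
  assumes "x \<in> carrier G" "y \<in> carrier G"
  shows "(\<lambda>m. t ^ m / fact m * discrete_kernel G Q m x y) sums (exp t * heat_kernel G Q t x y)"
proof -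
  obtain \<beta> and \<phi> :: "nat \<Rightarrow> 'a \<Rightarrow> real" where E: "eigenbasis (carrier G) (transition G Q) {..<card (carrier G)} \<beta> \<phi>"
    by (rule obtain_eigenbasis)
  have "exp t * heat_kernel G Q t x y = mat_exp (carrier G) (transition G Q) t x y"
    using assms by (simp add: heat_kernel_spectral[OF E] eigenbasis.mat_exp_spectral[OF E]
      sum_distrib_left right_diff_distrib exp_diff exp_minus field_simps)
  then show ?thesis
    using eigenbasis.mat_exp_spectral(2)[OF E assms, of t] by (simp add: discrete_kernel_def)
qed

lemma continuous_heat_kernel:
  assumes "x \<in> carrier G" "y \<in> carrier G"
  shows "continuous_on UNIV (\<lambda>t. heat_kernel G Q t x y)"
proof -
  obtain \<beta> and \<phi> :: "nat \<Rightarrow> 'a \<Rightarrow> real" where E: "eigenbasis (carrier G) (transition G Q) {..<card (carrier G)} \<beta> \<phi>"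
    by (rule obtain_eigenbasis)
  show ?thesis using assms by (simp add: heat_kernel_spectral[OF E]) (intro continuous_intros)
qed

lemma heat_kernel_nonneg:
  assumes "x \<in> carrier G" "y \<in> carrier G" "0 \<le> t" shows "0 \<le> heat_kernel G Q t x y"
proof -
  have "0 \<le> exp t * heat_kernel G Q t x y"
    using assms(3) by (intro sums_le[OF _ sums_zero heat_kernel_poisson[OF assms(1,2)]])
       (auto intro!: mult_nonneg_nonneg divide_nonneg_nonneg discrete_kernel_nonneg)
  then show ?thesis by (simp add: zero_le_mult_iff)
qed

lemma heat_kernel_translate:
  assumes "a \<in> carrier G" "x \<in> carrier G" "y \<in> carrier G"
  shows "heat_kernel G Q t (a \<otimes> x) (a \<otimes> y) = heat_kernel G Q t x y"
proof -
  have "exp t * heat_kernel G Q t (a \<otimes> x) (a \<otimes> y) = exp t * heat_kernel G Q t x y"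
    using heat_kernel_poisson[of "a \<otimes> x" "a \<otimes> y" t] heat_kernel_poisson[OF assms(2,3), of t] assms
    by (auto simp: discrete_kernel_translate dest: sums_unique2)
  then show ?thesis by simp
qed

end

text \<open>The powers of the transition matrix and the heat kernel act on every eigenfunction through a
  function \<open>h\<close> of its eigenvalue, namely \<open>b ^ m\<close> and \<open>exp (t * (b - 1))\<close>. All bounds on the total
  variation are proved for such a kernel, which treats discrete and continuous time at once.\<close>

locale walk_kernel = sym_walk +
  fixes h :: "real \<Rightarrow> real" and P :: "'a \<Rightarrow> 'a \<Rightarrow> real"
  assumes kernel_eigenfunction: "\<lbrakk>eigenfunction f b; x \<in> carrier G\<rbrakk> \<Longrightarrow> (\<Sum>y\<in>carrier G. P x y * f y) = h b * f x"
    and kernel_nonneg: "\<lbrakk>x \<in> carrier G; y \<in> carrier G\<rbrakk> \<Longrightarrow> 0 \<le> P x y"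
    and kernel_translate: "\<lbrakk>a \<in> carrier G; x \<in> carrier G; y \<in> carrier G\<rbrakk> \<Longrightarrow> P (a \<otimes> x) (a \<otimes> y) = P x y"
    and h1: "h 1 = 1"
begin

lemma kernel_row_sum: "x \<in> carrier G \<Longrightarrow> (\<Sum>y\<in>carrier G. P x y) = 1"
  using kernel_eigenfunction[OF eigenfunction_const[of 1]] h1 by simp

text \<open>By Cauchy-Schwarz the total variation is at most the distance of \<open>P \<one>\<close> to uniformity in
  \<open>L\<^sup>2\<close>. By translation invariance this distance is the same from every starting point, so that it
  can be read off from the Hilbert-Schmidt norm of \<open>P\<close>.\<close>

lemma tv_square_le:
  assumes "eigenbasis (carrier G) (transition G Q) J \<beta> \<phi>"
  shows "(tv_to_uniform G (P \<one>))\<^sup>2 \<le> (\<Sum>j\<in>J. (h (\<beta> j))\<^sup>2) - 1"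
proof -
  interpret E: eigenbasis "carrier G" "transition G Q" J \<beta> \<phi> by fact
  let ?n = "real (card (carrier G))"
  have P_eq: "P x y = (\<Sum>j\<in>J. h (\<beta> j) * \<phi> j x * \<phi> j y)" if "x \<in> carrier G" "y \<in> carrier G" for x y
    unfolding E.expand[OF that(2), of "P x"]
    using E.eigen that by (intro sum.cong refl) (simp add: kernel_eigenfunction)
  have row: "(\<Sum>y\<in>carrier G. (P x y)\<^sup>2) = (\<Sum>y\<in>carrier G. (P \<one> y)\<^sup>2)" if "x \<in> carrier G" for x
  proof -
    have "P x (x \<otimes> y) = P \<one> y" if "y \<in> carrier G" for y
      using kernel_translate[OF \<open>x \<in> carrier G\<close> one_closed that] \<open>x \<in> carrier G\<close> by simp
    then show ?thesis by (subst sum_translate[OF that, symmetric]) simp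
  qed
  have "(\<Sum>j\<in>J. (h (\<beta> j))\<^sup>2) = (\<Sum>x\<in>carrier G. \<Sum>y\<in>carrier G. (P x y)\<^sup>2)"
    by (subst E.hilbert_schmidt[symmetric]) (simp add: P_eq)
  then have hs: "(\<Sum>j\<in>J. (h (\<beta> j))\<^sup>2) = ?n * (\<Sum>y\<in>carrier G. (P \<one> y)\<^sup>2)"
    by (simp only: sum.cong[OF refl row] sum_constant)
  have dev: "?n * (\<Sum>y\<in>carrier G. (P \<one> y - 1 / ?n)\<^sup>2) = (\<Sum>j\<in>J. (h (\<beta> j))\<^sup>2) - 1"
  proof -
    have "(\<Sum>y\<in>carrier G. (P \<one> y - 1 / ?n)\<^sup>2)
        = (\<Sum>y\<in>carrier G. (P \<one> y)\<^sup>2) - 2 / ?n * (\<Sum>y\<in>carrier G. P \<one> y) + ?n * (1 / ?n)\<^sup>2"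
      by (simp add: power2_diff sum.distrib sum_subtractf sum_distrib_left sum_divide_distrib mult_ac)
    then show ?thesis
      unfolding hs kernel_row_sum[OF one_closed] using card_pos
      by (simp only:) (simp add: field_simps power2_eq_square)
  qed
  have "tv_to_uniform G (P \<one>) \<le> sqrt ((\<Sum>j\<in>J. (h (\<beta> j))\<^sup>2) - 1)"
  proof (rule tv_le)
    fix F assume F: "F \<subseteq> carrier G"
    have "(\<Sum>y\<in>F. P \<one> y) - card F / card (carrier G) = (\<Sum>y\<in>F. 1 * (P \<one> y - 1 / ?n))"
      by (simp add: sum_subtractf)
    also have "\<dots> \<le> sqrt ((\<Sum>y\<in>F. 1\<^sup>2) * (\<Sum>y\<in>F. (P \<one> y - 1 / ?n)\<^sup>2))"
      by (intro real_le_rsqrt Cauchy_Schwarz_ineq_sum)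
    also have "\<dots> \<le> sqrt (?n * (\<Sum>y\<in>carrier G. (P \<one> y - 1 / ?n)\<^sup>2))"
      using F fin by (intro real_sqrt_le_mono mult_mono sum_mono2 sum_nonneg) (auto intro: card_mono)
    finally show "(\<Sum>y\<in>F. P \<one> y) - card F / card (carrier G) \<le> sqrt ((\<Sum>j\<in>J. (h (\<beta> j))\<^sup>2) - 1)"
      by (simp only: dev)
  qed
  then have "(tv_to_uniform G (P \<one>))\<^sup>2 \<le> (sqrt ((\<Sum>j\<in>J. (h (\<beta> j))\<^sup>2) - 1))\<^sup>2"
    by (intro power_mono tv_nonneg)
  also have "(\<Sum>j\<in>J. (h (\<beta> j))\<^sup>2) - 1 \<ge> 0"
    by (subst dev[symmetric]) (intro mult_nonneg_nonneg sum_nonneg, auto)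
  then have "(sqrt ((\<Sum>j\<in>J. (h (\<beta> j))\<^sup>2) - 1))\<^sup>2 = (\<Sum>j\<in>J. (h (\<beta> j))\<^sup>2) - 1" by simp
  finally show ?thesis .
qed

text \<open>The mean of \<open>f\<close> is \<open>h b\<close> under \<open>P \<one>\<close> and zero under the uniform distribution.\<close>

lemma tv_ge_eigenvalue:
  assumes f: "eigenfunction f b" "b \<noteq> 1" "f \<one> = 1" "\<And>x. x \<in> carrier G \<Longrightarrow> \<bar>f x\<bar> \<le> 1"
  shows "h b / 2 \<le> tv_to_uniform G (P \<one>)"
proof -
  define \<nu> where "\<nu> y = P \<one> y - 1 / card (carrier G)" for y
  define F where "F = {y \<in> carrier G. \<nu> y \<ge> 0}"
  have \<nu>0: "(\<Sum>y\<in>carrier G. \<nu> y) = 0"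
    using kernel_row_sum[OF one_closed] card_pos by (simp add: \<nu>_def sum_subtractf)
  have F: "F \<subseteq> carrier G" "finite F" "carrier G - F = {y \<in> carrier G. \<nu> y < 0}"
    using fin by (auto simp: F_def)
  have tv: "(\<Sum>y\<in>F. \<nu> y) \<le> tv_to_uniform G (P \<one>)"
    using tv_ge[OF F(1), of "P \<one>"] by (simp add: \<nu>_def sum_subtractf)
  have "h b = (\<Sum>y\<in>carrier G. \<nu> y * f y)"
    using kernel_eigenfunction[OF f(1) one_closed] eigenfunction_sum_zero[OF f(1,2)] f(3)
    by (simp add: \<nu>_def left_diff_distrib sum_subtractf sum_divide_distrib[symmetric])
  also have "\<dots> \<le> (\<Sum>y\<in>carrier G. \<bar>\<nu> y\<bar>)"
  proof (intro sum_mono)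
    fix y assume "y \<in> carrier G"
    then have "\<bar>\<nu> y\<bar> * \<bar>f y\<bar> \<le> \<bar>\<nu> y\<bar> * 1" using f(4) by (intro mult_left_mono) auto
    then show "\<nu> y * f y \<le> \<bar>\<nu> y\<bar>" by (metis abs_ge_self abs_mult mult.right_neutral order_trans)
  qed
  also have "\<dots> = (\<Sum>y\<in>F. \<nu> y) - (\<Sum>y\<in>carrier G - F. \<nu> y)"
    using F by (subst sum.subset_diff[OF F(1) fin]) (auto simp: F_def sum_negf[symmetric] intro!: sum.cong)
  also have "\<dots> = 2 * (\<Sum>y\<in>F. \<nu> y)"
    using \<nu>0 by (subst (asm) sum.subset_diff[OF F(1) fin]) simp
  finally show ?thesis using tv by simp
qed

text \<open>Let \<open>X\<close> be the sum of the \<open>f i\<close> and \<open>M\<close> its mean under \<open>P \<one>\<close>; under the uniform distribution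
  \<open>X\<close> has mean zero. Both variances are at most \<open>card B\<close>: the \<open>f i\<close> are orthogonal under the uniform
  distribution, and under \<open>P \<one>\<close> the inequality between \<open>h (b2 i k)\<close> and \<open>h (b i) * h (b k)\<close> says that
  distinct \<open>f i\<close> are not positively correlated. By Chebyshev's inequality the event that \<open>X\<close> is at
  least \<open>M / 2\<close> then distinguishes the two distributions.\<close>

lemma tv_ge_chebyshev:
  assumes B: "finite B"
    and f: "\<And>i. i \<in> B \<Longrightarrow> eigenfunction (f i) (b i)" "\<And>i. i \<in> B \<Longrightarrow> f i \<one> = 1"
      "\<And>i x. \<lbrakk>i \<in> B; x \<in> carrier G\<rbrakk> \<Longrightarrow> \<bar>f i x\<bar> \<le> 1"
    and ff: "\<And>i k. \<lbrakk>i \<in> B; k \<in> B; i \<noteq> k\<rbrakk> \<Longrightarrow> eigenfunction (\<lambda>x. f i x * f k x) (b2 i k)"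
      "\<And>i k. \<lbrakk>i \<in> B; k \<in> B; i \<noteq> k\<rbrakk> \<Longrightarrow> b2 i k \<noteq> 1"
      "\<And>i k. \<lbrakk>i \<in> B; k \<in> B; i \<noteq> k\<rbrakk> \<Longrightarrow> h (b2 i k) \<le> h (b i) * h (b k)"
    and pos: "(\<Sum>i\<in>B. h (b i)) > 0"
  shows "1 - 8 * card B / (\<Sum>i\<in>B. h (b i))\<^sup>2 \<le> tv_to_uniform G (P \<one>)"
proof -
  let ?S = "carrier G" and ?n = "real (card (carrier G))"
  define M where "M = (\<Sum>i\<in>B. h (b i))"
  define X where "X y = (\<Sum>i\<in>B. f i y)" for y
  have X2: "(X y)\<^sup>2 = (\<Sum>i\<in>B. \<Sum>k\<in>B. f i y * f k y)" for y
    by (simp add: X_def power2_eq_square sum_product)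
  have EX: "(\<Sum>y\<in>?S. P \<one> y * X y) = M"
  proof -
    have "(\<Sum>y\<in>?S. P \<one> y * X y) = (\<Sum>i\<in>B. \<Sum>y\<in>?S. P \<one> y * f i y)"
      unfolding X_def sum_distrib_left by (rule sum.swap)
    also have "\<dots> = M" unfolding M_def
      using kernel_eigenfunction[OF f(1) one_closed] f(2) by (intro sum.cong) auto
    finally show ?thesis .
  qed
  have sq: "(f i x)\<^sup>2 \<le> 1" if "i \<in> B" "x \<in> ?S" for i x
    using f(3)[OF that] by (simp add: abs_square_le_1)
  have EX2: "(\<Sum>y\<in>?S. P \<one> y * (X y)\<^sup>2) \<le> M\<^sup>2 + card B"
  proof -
    have "(\<Sum>y\<in>?S. P \<one> y * (X y)\<^sup>2) = (\<Sum>y\<in>?S. \<Sum>i\<in>B. \<Sum>k\<in>B. P \<one> y * (f i y * f k y))"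
      by (simp add: X2 sum_distrib_left)
    also have "\<dots> = (\<Sum>i\<in>B. \<Sum>k\<in>B. \<Sum>y\<in>?S. P \<one> y * (f i y * f k y))"
      by (subst sum.swap) (rule sum.cong[OF refl sum.swap])
    also have "\<dots> \<le> (\<Sum>i\<in>B. \<Sum>k\<in>B. h (b i) * h (b k) + (if i = k then 1 else 0))"
    proof (intro sum_mono)
      fix i k assume ik: "i \<in> B" "k \<in> B"
      show "(\<Sum>y\<in>?S. P \<one> y * (f i y * f k y)) \<le> h (b i) * h (b k) + (if i = k then 1 else 0)"
      proof (cases "i = k")
        case True
        have "(\<Sum>y\<in>?S. P \<one> y * (f i y * f i y)) \<le> (\<Sum>y\<in>?S. P \<one> y * 1)"
          using ik sq kernel_nonneg[OF one_closed] by (intro sum_mono mult_left_mono) (auto simp: power2_eq_square)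
        moreover have "h (b i) * h (b i) \<ge> 0" by simp
        ultimately show ?thesis using True kernel_row_sum[OF one_closed] by (smt (verit) mult.right_neutral sum.cong)
      next
        case False
        then show ?thesis using kernel_eigenfunction[OF ff(1)[OF ik False] one_closed] ff(3)[OF ik False] f(2) ik
          by simp
      qed
    qed
    also have "\<dots> = M\<^sup>2 + card B"
      using B by (simp add: sum.distrib M_def power2_eq_square sum_product)
    finally show ?thesis .
  qed
  have var: "(\<Sum>y\<in>?S. P \<one> y * (X y - M)\<^sup>2) \<le> card B"
  proof -
    have "(\<Sum>y\<in>?S. P \<one> y * (X y - M)\<^sup>2)
        = (\<Sum>y\<in>?S. P \<one> y * (X y)\<^sup>2) - 2 * M * (\<Sum>y\<in>?S. P \<one> y * X y) + M\<^sup>2 * (\<Sum>y\<in>?S. P \<one> y)"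
      by (simp add: power2_diff algebra_simps sum.distrib sum_subtractf sum_distrib_left)
    then show ?thesis using EX EX2 kernel_row_sum[OF one_closed] by (simp add: power2_eq_square)
  qed
  have uvar: "(\<Sum>y\<in>?S. (X y)\<^sup>2) \<le> card B * ?n"
  proof -
    have "(\<Sum>y\<in>?S. (X y)\<^sup>2) = (\<Sum>i\<in>B. \<Sum>k\<in>B. \<Sum>y\<in>?S. f i y * f k y)"
      unfolding X2 by (subst sum.swap) (rule sum.cong[OF refl sum.swap])
    also have "\<dots> \<le> (\<Sum>i\<in>B. \<Sum>k\<in>B. if i = k then ?n else 0)"
    proof (intro sum_mono)
      fix i k assume ik: "i \<in> B" "k \<in> B"
      show "(\<Sum>y\<in>?S. f i y * f k y) \<le> (if i = k then ?n else 0)"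
      proof (cases "i = k")
        case True
        have "(\<Sum>y\<in>?S. f i y * f i y) \<le> (\<Sum>y\<in>?S. 1)"
          using ik sq by (intro sum_mono) (auto simp: power2_eq_square)
        then show ?thesis using True by simp
      next
        case False
        then show ?thesis using eigenfunction_sum_zero[OF ff(1)[OF ik False] ff(2)[OF ik False]] by simp
      qed
    qed
    also have "\<dots> = card B * ?n" using B by simp
    finally show ?thesis .
  qed
  define F where "F = {y \<in> ?S. X y \<ge> M / 2}"
  have F: "F \<subseteq> ?S" by (auto simp: F_def)
  have M: "M > 0" using pos by (simp add: M_def)
  have "(\<Sum>y\<in>?S - F. P \<one> y * (M / 2)\<^sup>2) \<le> (\<Sum>y\<in>?S - F. P \<one> y * (X y - M)\<^sup>2)"
  proof (intro sum_mono mult_left_mono)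
    fix y assume "y \<in> ?S - F"
    then have "M / 2 \<le> M - X y" by (auto simp: F_def)
    then have "(M / 2)\<^sup>2 \<le> (M - X y)\<^sup>2" using M by (intro power_mono) auto
    then show "(M / 2)\<^sup>2 \<le> (X y - M)\<^sup>2" by (simp add: power2_commute)
  qed (auto intro: kernel_nonneg)
  also have "\<dots> \<le> (\<Sum>y\<in>?S. P \<one> y * (X y - M)\<^sup>2)"
    using fin by (intro sum_mono2) (auto intro!: mult_nonneg_nonneg kernel_nonneg)
  also note var
  finally have "(\<Sum>y\<in>?S - F. P \<one> y) * (M / 2)\<^sup>2 \<le> card B" by (simp add: sum_distrib_right)
  then have 1: "(\<Sum>y\<in>?S - F. P \<one> y) \<le> 4 * card B / M\<^sup>2"
    using M by (simp add: field_simps power2_eq_square)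
  have "(\<Sum>y\<in>F. (M / 2)\<^sup>2) \<le> (\<Sum>y\<in>F. (X y)\<^sup>2)"
    using M by (intro sum_mono power_mono) (auto simp: F_def)
  also have "\<dots> \<le> (\<Sum>y\<in>?S. (X y)\<^sup>2)" using fin F by (intro sum_mono2) auto
  also note uvar
  finally have "card F * (M / 2)\<^sup>2 \<le> card B * ?n" by simp
  then have 2: "card F / ?n \<le> 4 * card B / M\<^sup>2"
    using M card_pos by (simp add: field_simps power2_eq_square)
  have "(\<Sum>y\<in>F. P \<one> y) = 1 - (\<Sum>y\<in>?S - F. P \<one> y)"
    using kernel_row_sum[OF one_closed] by (simp add: sum.subset_diff[OF F fin])
  then have "1 - 4 * card B / M\<^sup>2 - 4 * card B / M\<^sup>2 \<le> (\<Sum>y\<in>F. P \<one> y) - card F / ?n"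
    using 1 2 by simp
  also have "\<dots> \<le> tv_to_uniform G (P \<one>)" by (rule tv_ge[OF F])
  finally show ?thesis by (simp add: M_def)
qed

end

lemma (in sym_walk) discrete_walk_kernel: "walk_kernel G Q (\<lambda>b. b ^ m) (discrete_kernel G Q m)"
  by unfold_locales
    (auto simp: discrete_kernel_eigenfunction discrete_kernel_nonneg discrete_kernel_translate)

lemma (in sym_walk) heat_walk_kernel: "0 \<le> t \<Longrightarrow> walk_kernel G Q (\<lambda>b. exp (t * (b - 1))) (heat_kernel G Q t)"
  by unfold_locales
    (auto simp: heat_kernel_eigenfunction heat_kernel_nonneg heat_kernel_translate)

section \<open>Spectral gap and heat trace under moderate growth\<close>

context sym_walk
begin

definition energy :: "('a \<Rightarrow> real) \<Rightarrow> real" where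
  "energy f = (\<Sum>x\<in>carrier G. \<Sum>s\<in>carrier G. pmf Q s * (f x - f (x \<otimes> s))\<^sup>2) / 2"

lemma energy_eq:
  "energy f = (\<Sum>x\<in>carrier G. (f x)\<^sup>2) - (\<Sum>x\<in>carrier G. f x * (\<Sum>y\<in>carrier G. transition G Q x y * f y))"
proof -
  let ?S = "carrier G"
  have 1: "(\<Sum>s\<in>?S. pmf Q s * (f x - f (x \<otimes> s))\<^sup>2) = (f x)\<^sup>2
      - 2 * (f x * (\<Sum>y\<in>?S. transition G Q x y * f y)) + (\<Sum>y\<in>?S. transition G Q x y * (f y)\<^sup>2)"
    if x: "x \<in> ?S" for x
  proof -
    have "(\<Sum>s\<in>?S. pmf Q s * (f x - f (x \<otimes> s))\<^sup>2) = (f x)\<^sup>2 * (\<Sum>s\<in>?S. pmf Q s)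
        - 2 * (f x * (\<Sum>s\<in>?S. pmf Q s * f (x \<otimes> s))) + (\<Sum>s\<in>?S. pmf Q s * (f (x \<otimes> s))\<^sup>2)"
      by (simp add: power2_diff sum.distrib sum_subtractf sum_distrib_left sum_distrib_right algebra_simps)
    then show ?thesis using x by (simp add: transition_apply sum_pmf)
  qed
  have "2 * energy f = (\<Sum>x\<in>?S. (f x)\<^sup>2 - 2 * (f x * (\<Sum>y\<in>?S. transition G Q x y * f y))
      + (\<Sum>y\<in>?S. transition G Q x y * (f y)\<^sup>2))"
    by (simp add: energy_def 1)
  also have "\<dots> = 2 * (\<Sum>x\<in>?S. (f x)\<^sup>2) - 2 * (\<Sum>x\<in>?S. f x * (\<Sum>y\<in>?S. transition G Q x y * f y))"
    using sum_transition_apply[of "\<lambda>y. (f y)\<^sup>2"]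
    by (simp add: sum.distrib sum_subtractf sum_distrib_left)
  finally show ?thesis by simp
qed

lemma energy_eigenfunction: "eigenfunction f b \<Longrightarrow> energy f = (1 - b) * (\<Sum>x\<in>carrier G. (f x)\<^sup>2)"
  unfolding energy_eq
  by (simp add: left_diff_distrib right_diff_distrib sum_subtractf power2_eq_square sum_distrib_left mult.left_commute)

lemma energy_spectral:
  assumes "eigenbasis (carrier G) (transition G Q) J \<beta> \<phi>"
  shows "energy f = (\<Sum>j\<in>J. (1 - \<beta> j) * (\<Sum>x\<in>carrier G. f x * \<phi> j x)\<^sup>2)"
proof -
  interpret E: eigenbasis "carrier G" "transition G Q" J \<beta> \<phi> by fact
  have "(\<Sum>x\<in>carrier G. (\<Sum>y\<in>carrier G. transition G Q x y * f y) * \<phi> j x) = \<beta> j * (\<Sum>x\<in>carrier G. f x * \<phi> j x)"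
    if j: "j \<in> J" for j
  proof -
    have "(\<Sum>x\<in>carrier G. (\<Sum>y\<in>carrier G. transition G Q x y * f y) * \<phi> j x)
        = (\<Sum>y\<in>carrier G. f y * (\<Sum>x\<in>carrier G. transition G Q y x * \<phi> j x))"
      by (simp add: sum_distrib_left sum_distrib_right)
        (subst sum.swap, auto intro!: sum.cong simp: transition_sym mult_ac)
    also have "\<dots> = \<beta> j * (\<Sum>x\<in>carrier G. f x * \<phi> j x)"
      unfolding sum_distrib_left[of "\<beta> j"] by (intro sum.cong refl) (simp add: E.eigen[OF j])
    finally show ?thesis .
  qed
  then have "(\<Sum>x\<in>carrier G. f x * (\<Sum>y\<in>carrier G. transition G Q x y * f y))
      = (\<Sum>j\<in>J. \<beta> j * (\<Sum>x\<in>carrier G. f x * \<phi> j x)\<^sup>2)"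
    using E.parseval[of f "\<lambda>x. \<Sum>y\<in>carrier G. transition G Q x y * f y"]
    by (simp add: power2_eq_square mult_ac)
  then show ?thesis
    unfolding energy_eq using E.parseval[of f f]
    by (simp add: power2_eq_square left_diff_distrib sum_subtractf)
qed

lemma sum_pairs_square:
  "(\<Sum>x\<in>carrier G. \<Sum>y\<in>carrier G. (f x - f y)\<^sup>2)
    = 2 * card (carrier G) * (\<Sum>x\<in>carrier G. (f x)\<^sup>2) - 2 * (\<Sum>x\<in>carrier G. f x)\<^sup>2" for f :: "'a \<Rightarrow> real"
proof -
  have "(\<Sum>x\<in>carrier G. \<Sum>y\<in>carrier G. f x * f y) = (\<Sum>x\<in>carrier G. f x)\<^sup>2"
    by (simp add: power2_eq_square sum_product)
  then show ?thesis
    by (simp add: power2_diff sum.distrib sum_subtractf sum_distrib_left[symmetric] mult.assoc)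
qed

end

lemma (in group) set_power_closed: "E \<subseteq> carrier G \<Longrightarrow> set_power G E m \<subseteq> carrier G"
  by (induction m) (auto simp: set_mult_closed)

lemma (in group) set_power_add:
  assumes E: "E \<subseteq> carrier G" and "x \<in> set_power G E a" "y \<in> set_power G E b"
  shows "x \<otimes> y \<in> set_power G E (a + b)"
  using assms(3)
proof (induction b arbitrary: y)
  case 0
  have "x \<in> carrier G" using set_power_closed[OF E] assms(2) by blast
  then show ?case using 0 assms(2) by simp
next
  case (Suc b)
  then obtain u s where us: "u \<in> set_power G E b" "s \<in> E" "y = u \<otimes> s" by (auto simp: set_mult_def)
  then have "x \<otimes> y = (x \<otimes> u) \<otimes> s"
    using set_power_closed[OF E] assms(2) E by (subst m_assoc) auto
  then show ?case using Suc.IH[OF us(1)] us(2) by (auto simp: set_mult_def)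
qed

lemma (in group) set_power_one: "E \<subseteq> carrier G \<Longrightarrow> set_power G E 1 = E"
  by (auto simp: set_mult_def subset_iff)

lemma (in group) set_power_inv:
  assumes E: "E \<subseteq> carrier G" and inv: "\<And>s. s \<in> E \<Longrightarrow> inv s \<in> E" and "x \<in> set_power G E m"
  shows "inv x \<in> set_power G E m"
  using assms(3)
proof (induction m arbitrary: x)
  case (Suc m)
  then obtain u s where us: "u \<in> set_power G E m" "s \<in> E" "x = u \<otimes> s" by (auto simp: set_mult_def)
  have "u \<in> carrier G" "s \<in> carrier G" using us set_power_closed[OF E] E by blast+
  then have "inv x = inv s \<otimes> inv u" using us by (simp add: inv_mult_group)
  moreover have "inv s \<in> set_power G E 1" using inv us(2) set_power_one[OF E] by simp
  ultimately show ?case using set_power_add[OF E _ Suc.IH[OF us(1)], of "inv s" 1] by simp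
qed auto

text \<open>The following constants bound, in turn, \<open>\<rho>\<^sup>2\<close> times the spectral gap, the number of eigenvalues at
  the scale \<open>\<eta> / (8 \<rho>\<^sup>2)\<close> of the gap, and the heat trace beyond time \<open>8 \<rho>\<^sup>2 / \<eta>\<close> relative to its exponential
  decay.\<close>

definition gap_const :: "real \<Rightarrow> nat \<Rightarrow> real" where
  "gap_const A D = 512 + 64 * (A * 32 ^ D)\<^sup>2"

definition count_const :: "real \<Rightarrow> real \<Rightarrow> nat \<Rightarrow> real" where
  "count_const \<eta> A D = (4 * A + A / \<eta>) * 2 ^ D"

definition heat_const :: "real \<Rightarrow> real \<Rightarrow> nat \<Rightarrow> real" where
  "heat_const \<eta> A D = count_const \<eta> A D * (\<Sum>k. real (k + 1) ^ D * exp (- real k)) * exp (8 * gap_const A D / \<eta>)"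

locale growth_walk = sym_walk +
  fixes \<eta> A :: real and D \<rho> :: nat
  assumes \<eta>: "0 < \<eta>" "\<And>s. s \<in> set_pmf Q \<Longrightarrow> \<eta> \<le> pmf Q s"
    and \<rho>: "1 \<le> \<rho>" "set_power G (set_pmf Q) \<rho> = carrier G"
      "\<And>m. \<lbrakk>1 \<le> m; set_power G (set_pmf Q) m = carrier G\<rbrakk> \<Longrightarrow> \<rho> \<le> m"
    and A: "0 < A"
    and growth: "\<And>m. \<lbrakk>1 \<le> m; m \<le> \<rho>\<rbrakk> \<Longrightarrow>
      card (carrier G) * (m / \<rho>) ^ D \<le> A * card (set_power G (set_pmf Q) m)"
begin

abbreviation "E \<equiv> set_pmf Q"
abbreviation "V m \<equiv> card (set_power G E m)"

lemma E_inv: "s \<in> E \<Longrightarrow> inv s \<in> E"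
  using sym supp by (metis set_pmf_iff subset_iff)

lemma mem_power_1: "s \<in> E \<Longrightarrow> s \<in> set_power G E 1"
  using set_power_one[OF supp] by blast

lemma E_ne: "E \<noteq> {}" by (rule set_pmf_not_empty)

lemma Epow: "set_power G E m \<subseteq> carrier G" "finite (set_power G E m)"
  using set_power_closed[OF supp] fin by (auto intro: finite_subset)

lemma \<eta>_le_1: "\<eta> \<le> 1"
  using E_ne \<eta>(2) pmf_le_1 by (meson equals0I order_trans)

lemma E_nonempty_power: "set_power G E m \<noteq> {}"
proof (induction m)
  case (Suc m)
  then show ?case using E_ne by (auto simp: set_mult_def)
qed simp

lemma V_pos: "0 < V m" using E_nonempty_power Epow by (simp add: card_gt_0_iff)

lemma card_E_le: "card E \<le> 1 / \<eta>"
proof -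
  have "card E * \<eta> = (\<Sum>s\<in>E. \<eta>)" by simp
  also have "\<dots> \<le> (\<Sum>s\<in>E. pmf Q s)" using \<eta> by (intro sum_mono)
  also have "\<dots> \<le> (\<Sum>s\<in>carrier G. pmf Q s)" using fin supp by (intro sum_mono2) auto
  finally show ?thesis using \<eta>(1) by (simp add: sum_pmf field_simps)
qed

lemma step_variation:
  assumes s: "s \<in> E"
  shows "(\<Sum>x\<in>carrier G. (f x - f (x \<otimes> s))\<^sup>2) \<le> 2 * energy f / \<eta>"
proof -
  have "\<eta> * (\<Sum>x\<in>carrier G. (f x - f (x \<otimes> s))\<^sup>2) \<le> (\<Sum>x\<in>carrier G. pmf Q s * (f x - f (x \<otimes> s))\<^sup>2)"
    using \<eta>(2)[OF s] by (simp add: sum_distrib_left[symmetric] mult_right_mono sum_nonneg)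
  also have "\<dots> \<le> (\<Sum>x\<in>carrier G. \<Sum>s\<in>carrier G. pmf Q s * (f x - f (x \<otimes> s))\<^sup>2)"
    using s supp fin
    by (intro sum_mono member_le_sum[of s _ "\<lambda>s. pmf Q s * (f _ - f (_ \<otimes> s))\<^sup>2"]) auto
  finally show ?thesis using \<eta>(1) by (simp add: energy_def field_simps)
qed

text \<open>Write \<open>g\<close> as a product of \<open>m\<close> generators and apply the triangle inequality in \<open>L\<^sup>2\<close> along the
  path from \<open>x\<close> to \<open>x \<otimes> g\<close>; right translations preserve the norm, so every step costs the same.\<close>

lemma path_variation:
  assumes "g \<in> set_power G E m"
  shows "(\<Sum>x\<in>carrier G. (f x - f (x \<otimes> g))\<^sup>2) \<le> real m ^ 2 * (2 * energy f / \<eta>)"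
proof -
  let ?L = "\<lambda>u. L2_set u (carrier G)"
  have "?L (\<lambda>x. f x - f (x \<otimes> g)) \<le> m * sqrt (2 * energy f / \<eta>)"
    using assms
  proof (induction m arbitrary: g)
    case 0
    then show ?case by (simp add: L2_set_def)
  next
    case (Suc m)
    then obtain u s where us: "u \<in> set_power G E m" "s \<in> E" "g = u \<otimes> s" by (auto simp: set_mult_def)
    then have uc: "u \<in> carrier G" "s \<in> carrier G" using Epow supp by auto
    have "?L (\<lambda>x. f x - f (x \<otimes> g)) = ?L (\<lambda>x. (f x - f (x \<otimes> u)) + (f (x \<otimes> u) - f (x \<otimes> u \<otimes> s)))"
      by (rule L2_set_cong) (use us uc in \<open>auto simp: m_assoc\<close>)
    also have "\<dots> \<le> ?L (\<lambda>x. f x - f (x \<otimes> u)) + ?L (\<lambda>x. f (x \<otimes> u) - f (x \<otimes> u \<otimes> s))"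
      by (rule L2_set_triangle_ineq)
    also have "?L (\<lambda>x. f (x \<otimes> u) - f (x \<otimes> u \<otimes> s)) = ?L (\<lambda>x. f x - f (x \<otimes> s))"
      unfolding L2_set_def using sum_right_translate[OF uc(1), of "\<lambda>x. (f x - f (x \<otimes> s))\<^sup>2"] by simp
    also have "\<dots> \<le> sqrt (2 * energy f / \<eta>)"
      unfolding L2_set_def using step_variation[OF us(2)] by (rule real_sqrt_le_mono)
    also have "?L (\<lambda>x. f x - f (x \<otimes> u)) \<le> m * sqrt (2 * energy f / \<eta>)" by (rule Suc.IH[OF us(1)])
    finally show ?case by (simp add: algebra_simps)
  qed
  then have "(?L (\<lambda>x. f x - f (x \<otimes> g)))\<^sup>2 \<le> (m * sqrt (2 * energy f / \<eta>))\<^sup>2"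
    by (intro power_mono L2_set_nonneg)
  moreover have "energy f \<ge> 0" by (auto simp: energy_def intro!: sum_nonneg)
  ultimately show ?thesis using \<eta>(1) by (simp add: L2_set_def sum_nonneg power_mult_distrib)
qed

text \<open>Every group element is a product of \<open>\<rho>\<close> generators. Averaging the variation over all of them
  gives twice the variance of \<open>f\<close>, which is thus at most \<open>\<rho>\<^sup>2 / \<eta>\<close> times the energy.\<close>

lemma gap_lower:
  assumes f: "eigenfunction f b" "b \<noteq> 1" and nz: "x0 \<in> carrier G" "f x0 \<noteq> 0"
  shows "\<eta> / \<rho>\<^sup>2 \<le> 1 - b"
proof -
  let ?n = "real (card (carrier G))" and ?N = "\<Sum>x\<in>carrier G. (f x)\<^sup>2"
  have N: "?N > 0" using nz fin by (intro sum_pos2[of _ x0]) auto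
  have "2 * ?n * ?N = (\<Sum>x\<in>carrier G. \<Sum>y\<in>carrier G. (f x - f y)\<^sup>2)"
    using eigenfunction_sum_zero[OF f] by (simp add: sum_pairs_square)
  also have "\<dots> = (\<Sum>x\<in>carrier G. \<Sum>g\<in>carrier G. (f x - f (x \<otimes> g))\<^sup>2)"
    by (intro sum.cong refl sum_translate[symmetric])
  also have "\<dots> = (\<Sum>g\<in>carrier G. \<Sum>x\<in>carrier G. (f x - f (x \<otimes> g))\<^sup>2)" by (rule sum.swap)
  also have "\<dots> \<le> (\<Sum>g\<in>carrier G. real \<rho> ^ 2 * (2 * energy f / \<eta>))"
    using \<rho>(2) by (intro sum_mono path_variation) auto
  finally have "?n * ?N * 2 \<le> ?n * ?N * (2 * (\<rho>\<^sup>2 * (1 - b) / \<eta>))"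
    by (simp add: energy_eigenfunction[OF f(1)] algebra_simps)
  moreover have "0 < ?n * ?N" using N card_pos by simp
  ultimately have "2 \<le> 2 * (\<rho>\<^sup>2 * (1 - b) / \<eta>)" by (simp only: mult_le_cancel_left_pos)
  then have "1 \<le> \<rho>\<^sup>2 * (1 - b) / \<eta>" by simp
  then show ?thesis using \<eta>(1) \<rho>(1) by (simp add: field_simps)
qed

lemma eigenfunction_1_const:
  assumes f: "eigenfunction f 1" and x: "x \<in> carrier G"
  shows "f x = f \<one>"
proof -
  have "inv x \<in> set_power G E \<rho>" using x \<rho>(2) by simp
  from path_variation[OF this, of f]
  have "(\<Sum>y\<in>carrier G. (f y - f (y \<otimes> inv x))\<^sup>2) \<le> 0"
    by (simp add: energy_eigenfunction[OF f])
  then have "\<forall>y\<in>carrier G. f y = f (y \<otimes> inv x)"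
    using fin sum_nonneg_eq_0_iff[of "carrier G" "\<lambda>y. (f y - f (y \<otimes> inv x))\<^sup>2"]
      sum_nonneg[of "carrier G" "\<lambda>y. (f y - f (y \<otimes> inv x))\<^sup>2"] by auto
  then show ?thesis using x by auto
qed

end

lemma summable_poly_exp: "summable (\<lambda>k. real (k + 1) ^ D * exp (- real k))"
proof -
  have "(\<lambda>k. real (k + 1) ^ D * exp (- real k)) \<in> O(\<lambda>k. (exp (- 1 / 2) :: real) ^ k)"
    unfolding exp_of_nat_mult[symmetric] by real_asymp
  moreover have "summable (\<lambda>k. norm ((exp (- 1 / 2) :: real) ^ k))"
    by (simp add: power_abs[symmetric] norm_power)
  ultimately show ?thesis by (rule summable_comparison_test_bigo[rotated])
qed

locale growth_walk_basis = growth_walk +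
  fixes J :: "'j set" and \<beta> :: "'j \<Rightarrow> real" and \<phi> :: "'j \<Rightarrow> 'a \<Rightarrow> real"
  assumes basis: "eigenbasis (carrier G) (transition G Q) J \<beta> \<phi>"
begin

sublocale E: eigenbasis "carrier G" "transition G Q" J \<beta> \<phi> by (rule basis)

lemma basis_eigenfunction: "j \<in> J \<Longrightarrow> eigenfunction (\<phi> j) (\<beta> j)"
  using E.eigen by simp

lemma basis_nonzero: assumes "j \<in> J" obtains x where "x \<in> carrier G" "\<phi> j x \<noteq> 0"
proof (rule ccontr)
  assume "\<not> thesis"
  then have "\<forall>x\<in>carrier G. \<phi> j x = 0" using that by auto
  then have "(\<Sum>x\<in>carrier G. \<phi> j x * \<phi> j x) = 0" by simp
  then show False using E.orthonormal[OF assms assms] by simp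
qed

lemma \<beta>_le_1: "j \<in> J \<Longrightarrow> \<beta> j \<le> 1"
  by (meson basis_nonzero basis_eigenfunction eigenvalue_bounds(1))

lemma \<beta>_ge: "j \<in> J \<Longrightarrow> 2 * pmf Q \<one> - 1 \<le> \<beta> j"
  by (meson basis_nonzero basis_eigenfunction eigenvalue_bounds(2))

lemma simple_top_eigenvalue:
  obtains j0 where "j0 \<in> J" "\<beta> j0 = 1" "\<And>j. \<lbrakk>j \<in> J; \<beta> j = 1\<rbrakk> \<Longrightarrow> j = j0"
proof -
  have "\<exists>j0\<in>J. \<beta> j0 = 1"
  proof (rule ccontr)
    assume "\<not> ?thesis"
    then have "(\<Sum>x\<in>carrier G. \<phi> j x) = 0" if "j \<in> J" for j
      using that by (intro eigenfunction_sum_zero[OF basis_eigenfunction[OF that]]) auto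
    then have "(1::real) = 0" using E.expand[OF one_closed, of "\<lambda>_. 1"] by simp
    then show False by simp
  qed
  then obtain j0 where j0: "j0 \<in> J" "\<beta> j0 = 1" by auto
  have "j = j0" if j: "j \<in> J" "\<beta> j = 1" for j
  proof (rule ccontr)
    assume ne: "j \<noteq> j0"
    have const: "\<phi> i x = \<phi> i \<one>" if "i \<in> J" "\<beta> i = 1" "x \<in> carrier G" for i x
      using eigenfunction_1_const[of "\<phi> i" x] basis_eigenfunction[of i] that by simp
    have nz: "\<phi> i \<one> \<noteq> 0" if "i \<in> J" "\<beta> i = 1" for i
      using basis_nonzero[OF that(1)] const[OF that] by metis
    have "(\<Sum>x\<in>carrier G. \<phi> j x * \<phi> j0 x) = (\<Sum>x\<in>carrier G. \<phi> j \<one> * \<phi> j0 \<one>)"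
      using const j j0 by (intro sum.cong) metis+
    then show False using E.orthonormal[OF j(1) j0(1)] ne nz[OF j] nz[OF j0] card_pos by simp
  qed
  then show thesis using that j0 by blast
qed

text \<open>Let \<open>avg f x\<close> be the mean of \<open>f\<close> over \<open>x E\<^sup>m\<close>. By the path estimate, averaging moves an
  eigenfunction with \<open>1 - \<beta> j \<le> \<eta> / (8 m\<^sup>2)\<close> by at most half its norm, so that at least half of the norm
  survives. On the other hand, the squared norms of all \<open>avg (\<phi> j)\<close> add up to the squared
  Hilbert-Schmidt norm of the averaging operator, which is \<open>card (carrier G) / V m\<close>.\<close>

lemma eigenvalue_count:
  "card {j \<in> J. 1 - \<beta> j \<le> \<eta> / (8 * (real m)\<^sup>2)} \<le> 4 * card (carrier G) / V m" if m: "1 \<le> m"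
proof -
  let ?S = "carrier G" and ?B = "set_power G E m"
  define avg where "avg f x = (\<Sum>g\<in>?B. f (x \<otimes> g)) / V m" for f :: "'a \<Rightarrow> real" and x
  have Vp: "real (V m) > 0" using V_pos by simp
  have big: "1 / 4 \<le> (\<Sum>x\<in>?S. (avg (\<phi> j) x)\<^sup>2)" if j: "j \<in> J" and small: "1 - \<beta> j \<le> \<eta> / (8 * (real m)\<^sup>2)" for j
  proof -
    let ?f = "\<phi> j"
    have unit: "(\<Sum>x\<in>?S. (?f x)\<^sup>2) = 1" using E.orthonormal[OF j j] by (simp add: power2_eq_square)
    have "real m ^ 2 * (2 * energy ?f / \<eta>) \<le> 1 / 4"
      using small m \<eta>(1) unit by (simp add: energy_eigenfunction[OF basis_eigenfunction[OF j]] field_simps)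
    then have pv: "(\<Sum>x\<in>?S. (?f x - ?f (x \<otimes> g))\<^sup>2) \<le> 1 / 4" if "g \<in> ?B" for g
      using path_variation[OF that, of ?f] by linarith
    have "(\<Sum>x\<in>?S. (?f x - avg ?f x)\<^sup>2) \<le> (\<Sum>x\<in>?S. (\<Sum>g\<in>?B. (?f x - ?f (x \<otimes> g))\<^sup>2) / V m)"
    proof (intro sum_mono)
      fix x
      have "?f x - avg ?f x = (\<Sum>g\<in>?B. ?f x - ?f (x \<otimes> g)) / V m"
        using Vp by (simp add: avg_def sum_subtractf diff_divide_distrib)
      also have "(\<dots>)\<^sup>2 \<le> (V m * (\<Sum>g\<in>?B. (?f x - ?f (x \<otimes> g))\<^sup>2)) / (V m)\<^sup>2"
        using Cauchy_Schwarz_ineq_sum[of "\<lambda>_. 1" "\<lambda>g. ?f x - ?f (x \<otimes> g)" ?B]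
        by (auto simp: power_divide intro!: divide_right_mono)
      finally show "(?f x - avg ?f x)\<^sup>2 \<le> (\<Sum>g\<in>?B. (?f x - ?f (x \<otimes> g))\<^sup>2) / V m"
        using Vp by (simp add: power2_eq_square)
    qed
    also have "\<dots> = (\<Sum>g\<in>?B. \<Sum>x\<in>?S. (?f x - ?f (x \<otimes> g))\<^sup>2) / V m"
      unfolding sum_divide_distrib[symmetric] by (subst sum.swap) simp
    also have "\<dots> \<le> (\<Sum>g\<in>?B. 1 / 4) / V m"
      by (intro divide_right_mono sum_mono pv) auto
    also have "\<dots> = 1 / 4" using Vp by simp
    finally have d: "(\<Sum>x\<in>?S. (?f x - avg ?f x)\<^sup>2) \<le> 1 / 4" .
    have "(\<Sum>x\<in>?S. (?f x)\<^sup>2) \<le> (\<Sum>x\<in>?S. 2 * (?f x - avg ?f x)\<^sup>2 + 2 * (avg ?f x)\<^sup>2)"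
    proof (intro sum_mono)
      fix x
      have "0 \<le> (?f x - avg ?f x - avg ?f x)\<^sup>2" by simp
      then show "(?f x)\<^sup>2 \<le> 2 * (?f x - avg ?f x)\<^sup>2 + 2 * (avg ?f x)\<^sup>2"
        by (simp add: power2_eq_square algebra_simps)
    qed
    then show ?thesis using unit d by (simp add: sum.distrib sum_distrib_left[symmetric])
  qed
  have "card {j \<in> J. 1 - \<beta> j \<le> \<eta> / (8 * (real m)\<^sup>2)} * (1 / 4)
     = (\<Sum>j\<in>{j \<in> J. 1 - \<beta> j \<le> \<eta> / (8 * (real m)\<^sup>2)}. 1 / 4)" by simp
  also have "\<dots> \<le> (\<Sum>j\<in>{j \<in> J. 1 - \<beta> j \<le> \<eta> / (8 * (real m)\<^sup>2)}. \<Sum>x\<in>?S. (avg (\<phi> j) x)\<^sup>2)"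
    using big by (intro sum_mono) auto
  also have "\<dots> \<le> (\<Sum>j\<in>J. \<Sum>x\<in>?S. (avg (\<phi> j) x)\<^sup>2)"
    using E.finite_J by (intro sum_mono2) (auto intro!: sum_nonneg)
  also have "\<dots> = (\<Sum>x\<in>?S. \<Sum>j\<in>J. (avg (\<phi> j) x)\<^sup>2)" by (rule sum.swap)
  also have "\<dots> = (\<Sum>x\<in>?S. 1 / V m)"
  proof (intro sum.cong refl)
    fix x assume x: "x \<in> ?S"
    define k where "k y = (if inv x \<otimes> y \<in> ?B then 1 / V m else 0 :: real)" for y
    have "avg f x = (\<Sum>y\<in>?S. k y * f y)" for f
    proof -
      have "(\<Sum>y\<in>?S. k y * f y) = (\<Sum>g\<in>?S. k (x \<otimes> g) * f (x \<otimes> g))"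
        by (rule sum_translate[OF x, symmetric])
      also have "\<dots> = (\<Sum>g\<in>?S. if g \<in> ?B then f (x \<otimes> g) / V m else 0)"
        using x by (intro sum.cong) (auto simp: k_def m_assoc[symmetric])
      also have "\<dots> = (\<Sum>g\<in>?B. f (x \<otimes> g) / V m)"
        using fin Epow by (simp add: sum.inter_restrict[symmetric] Int_absorb1)
      finally show ?thesis by (simp add: avg_def sum_divide_distrib)
    qed
    then have "(\<Sum>j\<in>J. (avg (\<phi> j) x)\<^sup>2) = (\<Sum>y\<in>?S. k y * k y)"
      using E.parseval[of k k] by (simp add: power2_eq_square)
    also have "\<dots> = (\<Sum>g\<in>?S. k (x \<otimes> g) * k (x \<otimes> g))"
      by (rule sum_translate[OF x, symmetric])
    also have "\<dots> = (\<Sum>g\<in>?S. if g \<in> ?B then 1 / (V m)\<^sup>2 else 0)"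
      using x by (intro sum.cong) (auto simp: k_def m_assoc[symmetric] power2_eq_square)
    also have "\<dots> = (\<Sum>g\<in>?B. 1 / (V m)\<^sup>2)"
      using fin Epow by (simp add: sum.inter_restrict[symmetric] Int_absorb1)
    finally show "(\<Sum>j\<in>J. (avg (\<phi> j) x)\<^sup>2) = 1 / V m"
      using Vp by (simp add: power2_eq_square)
  qed
  finally show ?thesis by (simp add: mult.commute)
qed


lemma count_const_pos: "0 < count_const \<eta> A D" using A \<eta>(1) by (simp add: count_const_def add_pos_pos)

lemma card_carrier_le: "card (carrier G) \<le> A / \<eta> * real \<rho> ^ D"
proof -
  have "card (carrier G) * (1 / \<rho>) ^ D \<le> A * card E"
    using growth[of 1] \<rho>(1) set_power_one[OF supp] by simp
  also have "\<dots> \<le> A * (1 / \<eta>)" using A card_E_le by (intro mult_left_mono) auto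
  finally show ?thesis using \<rho>(1) by (simp add: field_simps)
qed

text \<open>For \<open>k + 1 \<le> \<rho>\<close>, apply the count at the scale \<open>m = \<rho> div (k + 1)\<close> and bound \<open>V m\<close> from below by
  moderate growth. For larger \<open>k\<close>, all eigenvalues are counted; their number is the order of the group,
  which moderate growth at \<open>m = 1\<close> bounds by a multiple of \<open>\<rho> ^ D\<close>.\<close>

lemma low_eigenvalue_count:
  "card {j \<in> J. 1 - \<beta> j \<le> (k + 1) * (\<eta> / (8 * (real \<rho>)\<^sup>2))} \<le> count_const \<eta> A D * real (k + 1) ^ D"
proof (cases "k + 1 \<le> \<rho>")
  case True
  define m where "m = \<rho> div (k + 1)"
  have m: "1 \<le> m" "m \<le> \<rho>" "m * (k + 1) \<le> \<rho>"
    unfolding m_def using True div_mult_mod_eq[of \<rho> "k + 1"]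
    by (simp_all only: Suc_le_eq One_nat_def div_greater_zero_iff) (auto simp: div_le_dividend)
  have "\<rho> = m * (k + 1) + \<rho> mod (k + 1)" unfolding m_def by (rule div_mult_mod_eq[symmetric])
  moreover have "\<rho> mod (k + 1) < k + 1" by simp
  ultimately have "\<rho> < m * (k + 1) + (k + 1)" by linarith
  also have "\<dots> \<le> m * (k + 1) + m * (k + 1)" using mult_le_mono1[OF m(1), of "k + 1"] by simp
  finally have "\<rho> \<le> 2 * m * (k + 1)" by simp
  then have \<rho>m: "real \<rho> \<le> 2 * real m * real (k + 1)" by (metis of_nat_le_iff of_nat_mult of_nat_numeral)
  have sub: "(k + 1) * (\<eta> / (8 * (real \<rho>)\<^sup>2)) \<le> \<eta> / (8 * (real m)\<^sup>2)"
  proof -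
    have "(real m)\<^sup>2 * real (k + 1) \<le> (real m)\<^sup>2 * (real (k + 1))\<^sup>2"
      by (intro mult_left_mono) (auto simp: power2_eq_square)
    also have "\<dots> = (real (m * (k + 1)))\<^sup>2" by (simp only: power_mult_distrib of_nat_mult)
    also have "\<dots> \<le> (real \<rho>)\<^sup>2" using m(3) by (intro power_mono) (simp_all only: of_nat_le_iff of_nat_0_le_iff)
    finally have *: "(real m)\<^sup>2 * real (k + 1) \<le> (real \<rho>)\<^sup>2" .
    have "\<eta> * ((real m)\<^sup>2 * real (k + 1)) \<le> \<eta> * (real \<rho>)\<^sup>2" using * \<eta>(1) by (intro mult_left_mono) auto
    then show ?thesis using m(1) \<rho>(1) by (simp add: field_simps)
  qed
  have "card {j \<in> J. 1 - \<beta> j \<le> (k + 1) * (\<eta> / (8 * (real \<rho>)\<^sup>2))} \<le> card {j \<in> J. 1 - \<beta> j \<le> \<eta> / (8 * (real m)\<^sup>2)}"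
    using sub E.finite_J by (intro card_mono) auto
  also have "real \<dots> \<le> 4 * card (carrier G) / V m" by (rule eigenvalue_count[OF m(1)])
  also have "\<dots> \<le> 4 * A * (2 * real (k + 1)) ^ D"
  proof -
    have "real (card (carrier G)) \<le> A * V m * (real \<rho> / m) ^ D"
      using growth[OF m(1,2)] m(1) \<rho>(1) by (simp add: power_divide field_simps)
    also have "\<dots> \<le> A * V m * (2 * real (k + 1)) ^ D"
      using A m(1) \<rho>m by (intro mult_left_mono power_mono) (auto simp: field_simps)
    finally show ?thesis using V_pos[of m] by (simp add: field_simps)
  qed
  also have "\<dots> = 4 * A * (2 ^ D * real (k + 1) ^ D)" by (simp only: power_mult_distrib)
  also have "\<dots> \<le> (4 * A + A / \<eta>) * (2 ^ D * real (k + 1) ^ D)"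
    using A \<eta>(1) by (intro mult_right_mono) auto
  also have "\<dots> = count_const \<eta> A D * real (k + 1) ^ D" by (simp add: count_const_def)
  finally show ?thesis by (simp add: add.commute)
next
  case False
  have "card {j \<in> J. 1 - \<beta> j \<le> (k + 1) * (\<eta> / (8 * (real \<rho>)\<^sup>2))} \<le> card J"
    using E.finite_J by (intro card_mono) auto
  also have "real (card J) \<le> A / \<eta> * real \<rho> ^ D" using card_carrier_le E.card_index by simp
  also have "\<dots> \<le> A / \<eta> * real (k + 1) ^ D"
    using False A \<eta>(1) by (intro mult_left_mono power_mono) auto
  also have "\<dots> \<le> count_const \<eta> A D * real (k + 1) ^ D"
  proof (intro mult_right_mono)
    have "(4 * A + A / \<eta>) * 1 \<le> (4 * A + A / \<eta>) * 2 ^ D"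
      using A \<eta>(1) by (intro mult_left_mono) (auto simp: add_nonneg_nonneg)
    then show "A / \<eta> \<le> count_const \<eta> A D" using A by (simp add: count_const_def)
  qed simp
  finally show ?thesis by (simp add: add.commute)
qed

text \<open>Sort the eigenvalues by the integer part \<open>\<kappa> j\<close> of \<open>(1 - \<beta> j) / \<theta>\<close>: polynomially many lie below
  level \<open>k + 1\<close>, and each at level \<open>k\<close> contributes at most \<open>exp (- k)\<close>.\<close>

lemma heat_trace_bounded:
  assumes t: "8 * (real \<rho>)\<^sup>2 / \<eta> \<le> t"
  shows "(\<Sum>j\<in>J. exp (- (t * (1 - \<beta> j)))) \<le> count_const \<eta> A D * (\<Sum>k. real (k + 1) ^ D * exp (- real k))"
proof -
  define \<theta> where "\<theta> = \<eta> / (8 * (real \<rho>)\<^sup>2)"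
  have \<theta>: "\<theta> > 0" "t * \<theta> \<ge> 1" using t \<eta>(1) \<rho>(1) by (auto simp: \<theta>_def field_simps)
  define \<kappa> where "\<kappa> j = nat \<lfloor>(1 - \<beta> j) / \<theta>\<rfloor>" for j
  have \<kappa>: "\<kappa> j * \<theta> \<le> 1 - \<beta> j" "1 - \<beta> j \<le> (\<kappa> j + 1) * \<theta>" if "j \<in> J" for j
  proof -
    have "0 \<le> (1 - \<beta> j) / \<theta>" using \<theta>(1) \<beta>_le_1[OF that] by simp
    then have "real (\<kappa> j) \<le> (1 - \<beta> j) / \<theta>" "(1 - \<beta> j) / \<theta> \<le> real (\<kappa> j) + 1"
      unfolding \<kappa>_def by linarith+
    then show "\<kappa> j * \<theta> \<le> 1 - \<beta> j" "1 - \<beta> j \<le> (\<kappa> j + 1) * \<theta>"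
      using \<theta>(1) by (auto simp: field_simps)
  qed
  have "(\<Sum>j\<in>J. exp (- (t * (1 - \<beta> j)))) \<le> (\<Sum>j\<in>J. exp (- real (\<kappa> j)))"
  proof (intro sum_mono)
    fix j assume j: "j \<in> J"
    have t0: "t > 0" using \<theta> by (smt (verit) mult_nonpos_nonneg)
    have "real (\<kappa> j) * 1 \<le> \<kappa> j * (t * \<theta>)" using \<theta> by (intro mult_left_mono) auto
    also have "\<dots> \<le> t * (1 - \<beta> j)" using \<kappa>(1)[OF j] t0 by (simp add: mult.left_commute mult_left_mono)
    finally show "exp (- (t * (1 - \<beta> j))) \<le> exp (- real (\<kappa> j))" by simp
  qed
  also have "\<dots> = (\<Sum>k\<in>\<kappa> ` J. \<Sum>j\<in>{j \<in> J. \<kappa> j = k}. exp (- real (\<kappa> j)))"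
    by (rule sum.image_gen[OF E.finite_J])
  also have "\<dots> = (\<Sum>k\<in>\<kappa> ` J. card {j \<in> J. \<kappa> j = k} * exp (- real k))"
    by (intro sum.cong refl) simp
  also have "\<dots> \<le> (\<Sum>k\<in>\<kappa> ` J. count_const \<eta> A D * (real (k + 1) ^ D * exp (- real k)))"
  proof (intro sum_mono)
    fix k
    have "card {j \<in> J. \<kappa> j = k} \<le> card {j \<in> J. 1 - \<beta> j \<le> (k + 1) * (\<eta> / (8 * (real \<rho>)\<^sup>2))}"
      using \<kappa>(2) E.finite_J by (intro card_mono) (auto simp: \<theta>_def add.commute)
    then have "card {j \<in> J. \<kappa> j = k} \<le> count_const \<eta> A D * real (k + 1) ^ D"
      using low_eigenvalue_count[of k] by linarith
    from mult_right_mono[OF this, of "exp (- real k)"]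
    show "card {j \<in> J. \<kappa> j = k} * exp (- real k) \<le> count_const \<eta> A D * (real (k + 1) ^ D * exp (- real k))"
      by (simp add: mult.assoc)
  qed
  also have "\<dots> \<le> count_const \<eta> A D * (\<Sum>k. real (k + 1) ^ D * exp (- real k))"
    unfolding sum_distrib_left[symmetric]
    using count_const_pos E.finite_J by (intro mult_left_mono sum_le_suminf summable_poly_exp) auto
  finally show ?thesis .
qed

end

context growth_walk
begin

definition word_length :: "'a \<Rightarrow> nat" where "word_length x = (LEAST m. x \<in> set_power G E m)"

lemma word_length_mem: "x \<in> carrier G \<Longrightarrow> x \<in> set_power G E (word_length x)"
  unfolding word_length_def using \<rho>(2) by (intro LeastI[of "\<lambda>m. x \<in> set_power G E m" \<rho>]) auto

lemma word_length_le: "x \<in> set_power G E m \<Longrightarrow> word_length x \<le> m"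
  unfolding word_length_def by (rule Least_le)

lemma word_length_mult: "\<lbrakk>x \<in> carrier G; y \<in> carrier G\<rbrakk> \<Longrightarrow> word_length (x \<otimes> y) \<le> word_length x + word_length y"
  by (intro word_length_le set_power_add supp word_length_mem)

lemma word_length_inv: "x \<in> carrier G \<Longrightarrow> word_length (inv x) \<le> word_length x"
  by (intro word_length_le set_power_inv supp word_length_mem E_inv)

lemma word_length_mult_ge: "\<lbrakk>x \<in> carrier G; y \<in> carrier G\<rbrakk> \<Longrightarrow> word_length x \<le> word_length (x \<otimes> y) + word_length y"
  using word_length_mult[of "x \<otimes> y" "inv y"] word_length_inv[of y] by (simp add: m_assoc)

lemma word_length_gen: "s \<in> E \<Longrightarrow> word_length s \<le> 1"
  using word_length_le[of s 1] set_power_one[OF supp] by simp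

lemma word_length_one: "word_length \<one> = 0" using word_length_le[of \<one> 0] by simp

text \<open>Multiply by \<open>s \<otimes> inv s\<close> as often as needed.\<close>

lemma set_power_even: "x \<in> set_power G E m \<Longrightarrow> x \<in> set_power G E (m + 2 * k)"
proof (induction k)
  case (Suc k)
  obtain s where s: "s \<in> E" using E_ne by blast
  have x: "x \<in> set_power G E (m + 2 * k)" "x \<in> carrier G" using Suc Epow by auto
  have "s \<otimes> inv s \<in> set_power G E (1 + 1)"
    using s by (intro set_power_add supp mem_power_1 E_inv)
  then have "x \<otimes> (s \<otimes> inv s) \<in> set_power G E (m + 2 * k + (1 + 1))"
    by (rule set_power_add[OF supp x(1)])
  moreover have "x \<otimes> (s \<otimes> inv s) = x" using s supp x by auto
  ultimately show ?case by (simp add: eval_nat_numeral)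
qed simp

text \<open>If no generator preserved the word length, then all elements of \<open>E\<^sup>m\<close> would have word length of
  the parity of \<open>m\<close>. This is absurd for \<open>m = \<rho>\<close>, where \<open>E\<^sup>m\<close> contains both \<open>\<one>\<close> and a generator. So some
  generator joins two elements of the same word length, and the path out, across and back is odd.\<close>

lemma odd_loop: obtains x where "x \<in> carrier G" "\<one> \<in> set_power G E (2 * word_length x + 1)"
proof -
  have "\<exists>x\<in>carrier G. \<exists>s\<in>E. word_length (x \<otimes> s) = word_length x"
  proof (rule ccontr)
    assume H: "\<not> ?thesis"
    have par: "even (word_length g + m)" if "g \<in> set_power G E m" for g m
      using that
    proof (induction m arbitrary: g)
      case 0 then show ?case by (simp add: word_length_one)
    next
      case (Suc m)
      then obtain u s where us: "u \<in> set_power G E m" "s \<in> E" "g = u \<otimes> s" by (auto simp: set_mult_def)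
      then have uc: "u \<in> carrier G" "s \<in> carrier G" using Epow supp by auto
      have "word_length g \<le> word_length u + 1" "word_length u \<le> word_length g + 1" "word_length g \<noteq> word_length u"
        using word_length_mult[OF uc] word_length_mult_ge[OF uc] word_length_gen[OF us(2)] us(3) H us(2) uc(1) by auto
      then have "word_length g = word_length u + 1 \<or> word_length u = word_length g + 1" by linarith
      then show ?case using Suc.IH[OF us(1)] by auto
    qed
    obtain s where s: "s \<in> E" using E_ne by blast
    then have "word_length s \<noteq> 0" using H one_closed supp word_length_one
      by (metis l_one subset_iff)
    then have "word_length s = 1" using word_length_gen[OF s] by simp
    moreover have "even (word_length s + \<rho>)" "even (word_length \<one> + \<rho>)" using par \<rho>(2) s supp by auto
    ultimately show False by (simp add: word_length_one)
  qed
  then obtain x s where xs: "x \<in> carrier G" "s \<in> E" "word_length (x \<otimes> s) = word_length x" by blast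
  then have sc: "s \<in> carrier G" using supp by auto
  have "x \<otimes> s \<in> set_power G E (word_length x)" using word_length_mem[of "x \<otimes> s"] xs sc by simp
  then have "inv (x \<otimes> s) \<in> set_power G E (word_length x)" by (intro set_power_inv supp E_inv)
  moreover have "x \<otimes> s \<in> set_power G E (word_length x + 1)"
    using xs by (intro set_power_add supp word_length_mem mem_power_1)
  ultimately have "(x \<otimes> s) \<otimes> inv (x \<otimes> s) \<in> set_power G E ((word_length x + 1) + word_length x)"
    by (rule set_power_add[OF supp, rotated])
  then have "\<one> \<in> set_power G E (2 * word_length x + 1)" using xs(1) sc by (simp add: mult_2)
  then show thesis using that xs(1) by blast
qed

text \<open>The diameter asks for products of one common length, whereas word lengths vary. A shorter word is
  prolonged by even amounts for free, and by an odd amount with the help of an odd loop.\<close>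

lemma diameter_le:
  assumes R: "\<And>x. x \<in> carrier G \<Longrightarrow> word_length x \<le> R"
  shows "\<rho> \<le> 3 * R + 1"
proof (rule \<rho>(3))
  obtain z where z: "z \<in> carrier G" "\<one> \<in> set_power G E (2 * word_length z + 1)" by (rule odd_loop)
  have "g \<in> set_power G E (3 * R + 1)" if g: "g \<in> carrier G" for g
  proof (cases "even (3 * R + 1 + word_length g)")
    case True
    moreover have "word_length g \<le> 3 * R + 1" using R[OF g] by simp
    ultimately have "even (3 * R + 1 - word_length g)" by auto
    then obtain k where "3 * R + 1 = word_length g + 2 * k"
      using \<open>word_length g \<le> 3 * R + 1\<close> by (metis evenE le_add_diff_inverse)
    then show ?thesis using set_power_even[OF word_length_mem[OF g]] by simp
  next
    case False
    let ?l = "2 * word_length z + 1 + word_length g"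
    have "g \<in> set_power G E ?l" using set_power_add[OF supp z(2) word_length_mem[OF g]] g by simp
    moreover have "\<exists>k. 3 * R + 1 = ?l + 2 * k"
    proof -
      have "?l \<le> 3 * R + 1" using R[OF g] R[OF z(1)] by simp
      moreover have "even (3 * R + 1 - ?l)" using False \<open>?l \<le> 3 * R + 1\<close> by auto
      ultimately show ?thesis by (metis evenE le_add_diff_inverse)
    qed
    ultimately show ?thesis using set_power_even by metis
  qed
  then show "set_power G E (3 * R + 1) = carrier G" using Epow by blast
qed simp

end


context growth_walk_basis
begin

text \<open>Both sides are expanded in the eigenbasis. The constant eigenfunction \<open>\<phi> j0\<close> contributes to
  neither: the double sum is invariant under adding constants.\<close>

lemma poincare_spectral:
  assumes gap: "\<And>j. \<lbrakk>j \<in> J; \<beta> j \<noteq> 1\<rbrakk> \<Longrightarrow> \<gamma> \<le> 1 - \<beta> j" and \<gamma>: "0 \<le> \<gamma>"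
  shows "\<gamma> * (\<Sum>x\<in>carrier G. \<Sum>y\<in>carrier G. (f x - f y)\<^sup>2) \<le> 2 * card (carrier G) * energy f"
proof -
  let ?n = "real (card (carrier G))"
  define c where "c j = (\<Sum>x\<in>carrier G. f x * \<phi> j x)" for j
  obtain j0 where j0: "j0 \<in> J" "\<beta> j0 = 1" "\<And>j. \<lbrakk>j \<in> J; \<beta> j = 1\<rbrakk> \<Longrightarrow> j = j0"
    by (rule simple_top_eigenvalue) blast
  have const: "\<phi> j0 x = \<phi> j0 \<one>" if "x \<in> carrier G" for x
    using eigenfunction_1_const[of "\<phi> j0" x] basis_eigenfunction[OF j0(1)] that j0(2) by simp
  have "(\<Sum>x\<in>carrier G. \<phi> j0 x * \<phi> j0 x) = (\<Sum>x\<in>carrier G. (\<phi> j0 \<one>)\<^sup>2)"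
    by (intro sum.cong refl) (metis const power2_eq_square)
  then have unit: "?n * (\<phi> j0 \<one>)\<^sup>2 = 1" using E.orthonormal[OF j0(1) j0(1)] by simp
  have "c j0 = (\<Sum>x\<in>carrier G. f x) * \<phi> j0 \<one>"
    unfolding c_def sum_distrib_right by (intro sum.cong refl) (metis const)
  then have c0: "?n * (c j0)\<^sup>2 = (\<Sum>x\<in>carrier G. f x)\<^sup>2"
    using unit by (simp add: power_mult_distrib mult.left_commute)
  have "(\<Sum>x\<in>carrier G. (f x)\<^sup>2) = (\<Sum>j\<in>J. (c j)\<^sup>2)"
    using E.parseval[of f f] by (simp add: c_def power2_eq_square)
  also have "\<dots> = (c j0)\<^sup>2 + (\<Sum>j\<in>J - {j0}. (c j)\<^sup>2)"
    using j0(1) E.finite_J by (simp add: sum.remove)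
  finally have "(\<Sum>x\<in>carrier G. \<Sum>y\<in>carrier G. (f x - f y)\<^sup>2) = 2 * ?n * (\<Sum>j\<in>J - {j0}. (c j)\<^sup>2)"
    using c0 by (simp add: sum_pairs_square algebra_simps)
  moreover have "\<gamma> * (\<Sum>j\<in>J - {j0}. (c j)\<^sup>2) \<le> energy f"
  proof -
    have "\<gamma> * (\<Sum>j\<in>J - {j0}. (c j)\<^sup>2) \<le> (\<Sum>j\<in>J - {j0}. (1 - \<beta> j) * (c j)\<^sup>2)"
      unfolding sum_distrib_left using gap j0(3) by (intro sum_mono mult_right_mono) auto
    also have "\<dots> \<le> (\<Sum>j\<in>J. (1 - \<beta> j) * (c j)\<^sup>2)"
      using \<beta>_le_1 E.finite_J by (intro sum_mono2) auto
    finally show ?thesis by (simp add: energy_spectral[OF basis] c_def)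
  qed
  ultimately show ?thesis
    using mult_left_mono[of "\<gamma> * (\<Sum>j\<in>J - {j0}. (c j)\<^sup>2)" "energy f" "2 * ?n"] by (simp add: mult_ac)
qed

text \<open>Use the word length as a test function. It changes by at most one in each step, so its energy is
  at most half the order of the group. It is at most \<open>R / 4\<close> on \<open>E\<^sup>r\<close>, \<open>r = R div 4\<close>, and at least
  \<open>3 R / 4\<close> on the translate of \<open>E\<^sup>r\<close> to an element of maximal word length \<open>R\<close>. By moderate growth both
  sets contain a fixed proportion of the group, so the variance is of order \<open>R\<^sup>2\<close>, hence of order \<open>\<rho>\<^sup>2\<close>.
  For \<open>\<rho> \<le> 16\<close>, where \<open>r\<close> may vanish, \<open>\<gamma> \<le> 2\<close> is enough.\<close>

lemma gap_upper:
  assumes gap: "\<And>j. \<lbrakk>j \<in> J; \<beta> j \<noteq> 1\<rbrakk> \<Longrightarrow> \<gamma> \<le> 1 - \<beta> j" and \<gamma>: "0 \<le> \<gamma>" "\<gamma> \<le> 2"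
    and nontriv: "1 < card (carrier G)"
  shows "\<gamma> \<le> gap_const A D / \<rho>\<^sup>2"
proof -
  let ?n = "real (card (carrier G))"
  have "Max (word_length ` carrier G) \<in> word_length ` carrier G" using fin by (intro Max_in) auto
  then obtain y where y: "y \<in> carrier G" and yM: "Max (word_length ` carrier G) = word_length y" by auto
  define R where "R = word_length y"
  have R: "word_length x \<le> R" if "x \<in> carrier G" for x
    using that fin Max_ge[of "word_length ` carrier G" "word_length x"] by (simp add: yM R_def)
  have "R > 0"
  proof (rule ccontr)
    assume "\<not> R > 0"
    then have "word_length x = 0" if "x \<in> carrier G" for x using R[OF that] by simp
    then have "carrier G \<subseteq> {\<one>}" using word_length_mem by (metis set_power.simps(1) subsetI)
    then show False using nontriv by (metis card_mono finite.emptyI finite.insertI card_1_singleton_iff is_singletonI is_singleton_altdef not_less)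
  qed
  then have \<rho>R: "\<rho> \<le> 4 * R" using diameter_le[of R] R by force
  have cpos: "0 \<le> 64 * (A * 32 ^ D)\<^sup>2" by simp
  show ?thesis
  proof (cases "\<rho> \<le> 16")
    case True
    have "\<gamma> * (real \<rho>)\<^sup>2 \<le> 2 * (real 16)\<^sup>2" using True \<gamma> by (intro mult_mono power_mono) simp_all
    also have "\<dots> \<le> gap_const A D" using cpos by (simp add: gap_const_def)
    finally show ?thesis using \<rho>(1) by (simp add: field_simps)
  next
    case False
    define r where "r = R div 4"
    have r: "1 \<le> r" "4 * r \<le> R" "R \<le> 8 * r" using False \<rho>R unfolding r_def by presburger+
    have R\<rho>: "R \<le> \<rho>" using word_length_le[of y \<rho>] y \<rho>(2) by (simp add: R_def)
    define B where "B = set_power G E r"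
    have B: "B \<subseteq> carrier G" "finite B" using Epow by (auto simp: B_def)
    define c where "c = real (card B)"
    have "?n * (1 / 32) ^ D \<le> ?n * (r / \<rho>) ^ D"
      using r \<rho>R \<rho>(1) by (intro mult_left_mono power_mono) (auto simp: field_simps)
    also have "\<dots> \<le> A * c" using growth[of r] r R\<rho> by (simp add: c_def B_def)
    finally have c: "?n \<le> A * 32 ^ D * c" by (simp add: field_simps)
    define f where "f x = real (word_length x)" for x
    have "\<rho>\<^sup>2 / 16 * c\<^sup>2 / 4 \<le> (\<Sum>x\<in>B. \<Sum>z\<in>(\<lambda>b. y \<otimes> b) ` B. (f x - f z)\<^sup>2)"
    proof -
      have inj: "inj_on (\<lambda>b. y \<otimes> b) B" using y B by (meson inj_on_cmult inj_on_subset)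
      have "(R / 2)\<^sup>2 \<le> (f x - f (y \<otimes> b))\<^sup>2" if "x \<in> B" "b \<in> B" for x b
      proof -
        have "word_length x \<le> r" "word_length b \<le> r" "b \<in> carrier G" using that word_length_le B by (auto simp: B_def)
        then have "R / 2 \<le> f (y \<otimes> b) - f x"
          using word_length_mult_ge[OF y, of b] r unfolding f_def R_def by linarith
        then have "(R / 2)\<^sup>2 \<le> (f (y \<otimes> b) - f x)\<^sup>2" by (intro power_mono) auto
        then show ?thesis by (simp add: power2_commute)
      qed
      then have "(\<Sum>x\<in>B. \<Sum>b\<in>B. (R / 2)\<^sup>2) \<le> (\<Sum>x\<in>B. \<Sum>z\<in>(\<lambda>b. y \<otimes> b) ` B. (f x - f z)\<^sup>2)"
        unfolding sum.reindex[OF inj] by (intro sum_mono) auto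
      moreover have "(\<rho> / 4)\<^sup>2 \<le> (real R)\<^sup>2" using \<rho>R by (intro power_mono) auto
      then have "(\<rho>\<^sup>2 / 16) * c\<^sup>2 / 4 \<le> (real R)\<^sup>2 * c\<^sup>2 / 4"
        by (intro divide_right_mono mult_right_mono) (auto simp: power_divide)
      ultimately show ?thesis by (simp add: c_def power2_eq_square field_simps)
    qed
    also have "\<dots> \<le> (\<Sum>x\<in>carrier G. \<Sum>z\<in>carrier G. (f x - f z)\<^sup>2)"
    proof -
      have "(\<Sum>x\<in>B. \<Sum>z\<in>(\<lambda>b. y \<otimes> b) ` B. (f x - f z)\<^sup>2) \<le> (\<Sum>x\<in>B. \<Sum>z\<in>carrier G. (f x - f z)\<^sup>2)"
        using fin y B by (intro sum_mono sum_mono2) auto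
      also have "\<dots> \<le> (\<Sum>x\<in>carrier G. \<Sum>z\<in>carrier G. (f x - f z)\<^sup>2)"
        using fin B by (intro sum_mono2) (auto intro!: sum_nonneg)
      finally show ?thesis .
    qed
    finally have "\<gamma> * (\<rho>\<^sup>2 / 16 * c\<^sup>2 / 4)
        \<le> \<gamma> * (\<Sum>x\<in>carrier G. \<Sum>z\<in>carrier G. (f x - f z)\<^sup>2)"
      using \<gamma>(1) by (rule mult_left_mono)
    also have "\<dots> \<le> 2 * ?n * energy f"
      using poincare_spectral[OF gap \<gamma>(1), of f] by simp
    also have "2 * ?n * energy f \<le> 2 * ?n * (?n / 2)"
    proof -
      have "energy f \<le> (\<Sum>x\<in>carrier G. \<Sum>s\<in>carrier G. pmf Q s * 1) / 2"
        unfolding energy_def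
      proof (intro divide_right_mono sum_mono)
        fix x s assume xs: "x \<in> carrier G" "s \<in> carrier G"
        show "pmf Q s * (f x - f (x \<otimes> s))\<^sup>2 \<le> pmf Q s * 1"
        proof (cases "s \<in> E")
          case True
          then have "\<bar>f x - f (x \<otimes> s)\<bar> \<le> 1"
            using word_length_mult[OF xs] word_length_mult_ge[OF xs] word_length_gen[OF True] by (simp add: f_def)
          then show ?thesis by (intro mult_left_mono) (auto simp: abs_square_le_1)
        qed (simp add: set_pmf_iff)
      qed simp
      then have "energy f \<le> ?n / 2" by (simp add: sum_pmf)
      then show ?thesis by (intro mult_left_mono) auto
    qed
    finally have "\<gamma> * \<rho>\<^sup>2 * c\<^sup>2 \<le> 64 * ?n\<^sup>2"
      by (simp add: power2_eq_square algebra_simps)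
    also have "\<dots> \<le> 64 * (A * 32 ^ D * c)\<^sup>2" using c by (intro mult_left_mono power_mono) auto
    finally have "\<gamma> * \<rho>\<^sup>2 \<le> 64 * (A * 32 ^ D)\<^sup>2"
      using V_pos[of r] by (simp add: power_mult_distrib c_def B_def)
    then have "\<gamma> * \<rho>\<^sup>2 \<le> gap_const A D" by (simp add: gap_const_def)
    then show ?thesis using \<rho>(1) by (simp add: field_simps)
  qed
qed


text \<open>Beyond \<open>t0 = 8 \<rho>\<^sup>2 / \<eta>\<close> every nontrivial eigenvalue contributes a decay of at least \<open>exp (- \<gamma> (t - t0))\<close>
  to the heat trace, which is bounded at \<open>t0\<close>; the factor \<open>exp (\<gamma> t0)\<close> is bounded since \<open>\<gamma>\<close> is of
  order at most \<open>1 / \<rho>\<^sup>2\<close>.\<close>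

theorem spectral_gap:
  assumes nontriv: "1 < card (carrier G)"
  obtains \<gamma> where "0 < \<gamma>" "\<gamma> \<le> 2" "\<eta> / \<rho>\<^sup>2 \<le> \<gamma>" "\<gamma> \<le> gap_const A D / \<rho>\<^sup>2"
    "\<exists>j\<in>J. \<beta> j = 1 - \<gamma>"
    "\<And>t. 8 * (real \<rho>)\<^sup>2 / \<eta> \<le> t \<Longrightarrow> (\<Sum>j\<in>J. exp (- (t * (1 - \<beta> j)))) \<le> 1 + heat_const \<eta> A D * exp (- (\<gamma> * t))"
proof -
  obtain j0 where j0: "j0 \<in> J" "\<beta> j0 = 1" "\<And>j. \<lbrakk>j \<in> J; \<beta> j = 1\<rbrakk> \<Longrightarrow> j = j0"
    by (rule simple_top_eigenvalue) blast
  have ne: "J - {j0} \<noteq> {}"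
  proof
    assume "J - {j0} = {}"
    then have "card J \<le> card {j0}" by (intro card_mono) auto
    then show False using nontriv E.card_index by simp
  qed
  define \<gamma> where "\<gamma> = Min ((\<lambda>j. 1 - \<beta> j) ` (J - {j0}))"
  have "\<gamma> \<in> (\<lambda>j. 1 - \<beta> j) ` (J - {j0})"
    unfolding \<gamma>_def using ne E.finite_J by (intro Min_in) auto
  then obtain j1 where j1: "j1 \<in> J" "j1 \<noteq> j0" "\<gamma> = 1 - \<beta> j1" by auto
  have min: "\<gamma> \<le> 1 - \<beta> j" if "j \<in> J" "j \<noteq> j0" for j
    unfolding \<gamma>_def using that E.finite_J by (intro Min_le) auto
  have b1: "\<beta> j1 \<noteq> 1" using j0(3)[OF j1(1)] j1(2) by blast
  have low: "\<eta> / \<rho>\<^sup>2 \<le> \<gamma>"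
    unfolding j1(3) by (rule basis_nonzero[OF j1(1)]) (rule gap_lower[OF basis_eigenfunction[OF j1(1)] b1])
  then have pos: "0 < \<gamma>" using \<eta>(1) \<rho>(1) by (smt (verit) divide_pos_pos of_nat_0_less_iff zero_less_power less_le_trans zero_less_one_class.zero_less_one of_nat_le_iff of_nat_1)
  have le2: "\<gamma> \<le> 2" using \<beta>_ge[OF j1(1)] pmf_nonneg[of Q \<one>] unfolding j1(3) by linarith
  have up: "\<gamma> \<le> gap_const A D / \<rho>\<^sup>2"
    by (rule gap_upper) (use min j0(2) pos le2 nontriv in auto)
  have heat: "(\<Sum>j\<in>J. exp (- (t * (1 - \<beta> j)))) \<le> 1 + heat_const \<eta> A D * exp (- (\<gamma> * t))"
    if t: "8 * (real \<rho>)\<^sup>2 / \<eta> \<le> t" for t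
  proof -
    define t0 where "t0 = 8 * (real \<rho>)\<^sup>2 / \<eta>"
    have "(\<Sum>j\<in>J. exp (- (t * (1 - \<beta> j)))) = 1 + (\<Sum>j\<in>J - {j0}. exp (- (t * (1 - \<beta> j))))"
      using j0(1,2) E.finite_J by (simp add: sum.remove)
    also have "(\<Sum>j\<in>J - {j0}. exp (- (t * (1 - \<beta> j))))
        \<le> (\<Sum>j\<in>J - {j0}. exp (- ((t - t0) * \<gamma>)) * exp (- (t0 * (1 - \<beta> j))))"
    proof (intro sum_mono)
      fix j assume "j \<in> J - {j0}"
      then have "(t - t0) * \<gamma> \<le> (t - t0) * (1 - \<beta> j)" using min t by (intro mult_left_mono) (auto simp: t0_def)
      then show "exp (- (t * (1 - \<beta> j))) \<le> exp (- ((t - t0) * \<gamma>)) * exp (- (t0 * (1 - \<beta> j)))"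
        unfolding exp_add[symmetric] by (simp add: algebra_simps)
    qed
    also have "\<dots> \<le> (\<Sum>j\<in>J. exp (- ((t - t0) * \<gamma>)) * exp (- (t0 * (1 - \<beta> j))))"
      using E.finite_J by (intro sum_mono2) auto
    also have "\<dots> \<le> exp (- ((t - t0) * \<gamma>)) * (count_const \<eta> A D * (\<Sum>k. real (k + 1) ^ D * exp (- real k)))"
      unfolding sum_distrib_left[symmetric] by (intro mult_left_mono heat_trace_bounded) (auto simp: t0_def)
    also have "exp (- ((t - t0) * \<gamma>)) = exp (\<gamma> * t0) * exp (- (\<gamma> * t))"
      unfolding exp_add[symmetric] by (simp add: algebra_simps)
    also have "\<dots> * (count_const \<eta> A D * (\<Sum>k. real (k + 1) ^ D * exp (- real k)))
       = (count_const \<eta> A D * (\<Sum>k. real (k + 1) ^ D * exp (- real k))) * exp (\<gamma> * t0) * exp (- (\<gamma> * t))" by simp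
    also have "\<dots> \<le> heat_const \<eta> A D * exp (- (\<gamma> * t))"
      unfolding heat_const_def
    proof (intro mult_right_mono mult_left_mono)
      have "\<gamma> * t0 \<le> gap_const A D / \<rho>\<^sup>2 * t0" using up \<eta>(1) by (intro mult_right_mono) (auto simp: t0_def)
      also have "\<dots> = 8 * gap_const A D / \<eta>" using \<rho>(1) by (simp add: t0_def field_simps)
      finally show "exp (\<gamma> * t0) \<le> exp (8 * gap_const A D / \<eta>)" by simp
    qed (use count_const_pos summable_poly_exp in \<open>auto intro!: mult_nonneg_nonneg suminf_nonneg\<close>)
    finally show ?thesis by simp
  qed
  show thesis
    by (rule that[OF pos le2 low up _ heat]) (use j1 in \<open>auto intro!: bexI[of _ j1]\<close>)
qed

end

context growth_walk
begin

text \<open>All that a product needs to know about a factor: its spectral gap \<open>\<gamma>\<close> is of order \<open>1 / \<rho>\<^sup>2\<close>, an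
  eigenfunction for it peaks at the identity, and the heat trace decays at the rate \<open>\<gamma>\<close> with uniform
  constants.\<close>

definition spectral_scale :: "real \<Rightarrow> bool" where
  "spectral_scale \<gamma> \<longleftrightarrow> 0 < \<gamma> \<and> \<gamma> \<le> 2 \<and> \<eta> / \<rho>\<^sup>2 \<le> \<gamma> \<and> \<gamma> \<le> gap_const A D / \<rho>\<^sup>2 \<and>
    (\<exists>\<psi>. eigenfunction \<psi> (1 - \<gamma>) \<and> \<psi> \<one> = 1 \<and> (\<forall>x\<in>carrier G. \<bar>\<psi> x\<bar> \<le> 1)) \<and>
    (\<exists>\<beta> \<phi>. eigenbasis (carrier G) (transition G Q) {..<card (carrier G)} \<beta> (\<phi> :: nat \<Rightarrow> 'a \<Rightarrow> real) \<and>
      (\<forall>t. 8 * (real \<rho>)\<^sup>2 / \<eta> \<le> t \<longrightarrow>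
        (\<Sum>j<card (carrier G). exp (- (t * (1 - \<beta> j)))) \<le> 1 + heat_const \<eta> A D * exp (- (\<gamma> * t))))"

lemma spectral_scale_exists:
  assumes nontriv: "1 < card (carrier G)"
  shows "\<exists>\<gamma>. spectral_scale \<gamma>"
proof -
  obtain \<beta> and \<phi> :: "nat \<Rightarrow> 'a \<Rightarrow> real" where E: "eigenbasis (carrier G) (transition G Q) {..<card (carrier G)} \<beta> \<phi>"
    by (rule obtain_eigenbasis)
  interpret W: growth_walk_basis G Q \<eta> A D \<rho> "{..<card (carrier G)}" \<beta> \<phi>
    by (intro growth_walk_basis.intro growth_walk_axioms growth_walk_basis_axioms.intro E)
  obtain \<gamma> where g: "0 < \<gamma>" "\<gamma> \<le> 2" "\<eta> / \<rho>\<^sup>2 \<le> \<gamma>" "\<gamma> \<le> gap_const A D / \<rho>\<^sup>2"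
    "\<exists>j\<in>{..<card (carrier G)}. \<beta> j = 1 - \<gamma>"
    "\<And>t. 8 * (real \<rho>)\<^sup>2 / \<eta> \<le> t \<Longrightarrow>
       (\<Sum>j<card (carrier G). exp (- (t * (1 - \<beta> j)))) \<le> 1 + heat_const \<eta> A D * exp (- (\<gamma> * t))"
    by (rule W.spectral_gap[OF nontriv]) blast
  then obtain j where j: "j \<in> {..<card (carrier G)}" "\<beta> j = 1 - \<gamma>" by blast
  obtain x0 where x0: "x0 \<in> carrier G" "\<phi> j x0 \<noteq> 0" by (rule W.basis_nonzero[OF j(1)])
  obtain \<psi> where \<psi>: "eigenfunction \<psi> (1 - \<gamma>)" "\<psi> \<one> = 1" "\<And>x. x \<in> carrier G \<Longrightarrow> \<bar>\<psi> x\<bar> \<le> 1"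
    using eigenfunction_peak[OF W.basis_eigenfunction[OF j(1)] x0] j(2) by metis
  have "spectral_scale \<gamma>"
    unfolding spectral_scale_def
  proof (intro conjI)
    show "\<exists>\<psi>. eigenfunction \<psi> (1 - \<gamma>) \<and> \<psi> \<one> = 1 \<and> (\<forall>x\<in>carrier G. \<bar>\<psi> x\<bar> \<le> 1)"
      using \<psi> by blast
    show "\<exists>\<beta> \<phi>. eigenbasis (carrier G) (transition G Q) {..<card (carrier G)} \<beta> (\<phi> :: nat \<Rightarrow> 'a \<Rightarrow> real) \<and>
      (\<forall>t. 8 * (real \<rho>)\<^sup>2 / \<eta> \<le> t \<longrightarrow>
        (\<Sum>j<card (carrier G). exp (- (t * (1 - \<beta> j)))) \<le> 1 + heat_const \<eta> A D * exp (- (\<gamma> * t)))"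
      using E g(6) by blast
  qed (use g in auto)
  then show ?thesis by blast
qed

lemma heat_const_pos: "0 < heat_const \<eta> A D"
proof -
  have "1 \<le> (\<Sum>k. real (k + 1) ^ D * exp (- real k))"
    using sum_le_suminf[OF summable_poly_exp, of "{0}" D] by simp
  then show ?thesis using A \<eta>(1) by (simp add: heat_const_def count_const_def add_pos_pos)
qed

end

section \<open>Product walks\<close>

locale product_walk =
  fixes I :: "'i set" and r :: "'i pmf" and G :: "'i \<Rightarrow> ('a, 'b) monoid_scheme" and Q :: "'i \<Rightarrow> 'a pmf"
  assumes fin_I: "finite I" and supp_r: "set_pmf r \<subseteq> I"
    and factor: "i \<in> I \<Longrightarrow> sym_walk (G i) (Q i)"
begin

abbreviation "\<Gamma> \<equiv> product_group I G"
abbreviation "QP \<equiv> product_prob I r G Q"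

lemma factor_group: "i \<in> I \<Longrightarrow> group (G i)"
  using factor by (simp add: sym_walk_def fin_walk_def)

lemma factor_fin: "i \<in> I \<Longrightarrow> finite (carrier (G i))"
  using factor by (simp add: sym_walk_def fin_walk_def fin_walk_axioms_def)

lemma factor_supp: "i \<in> I \<Longrightarrow> set_pmf (Q i) \<subseteq> carrier (G i)"
  using factor by (simp add: sym_walk_def fin_walk_def fin_walk_axioms_def)

lemma sum_r: "(\<Sum>i\<in>I. pmf r i) = 1"
  by (rule sum_pmf_eq_1[OF fin_I supp_r])

lemma factor_embed_closed: "\<lbrakk>i \<in> I; s \<in> carrier (G i)\<rbrakk> \<Longrightarrow> factor_embed I G i s \<in> carrier \<Gamma>"
  using factor_group by (auto simp: factor_embed_def group.is_monoid)

lemma mult_factor_embed: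
  assumes "x \<in> carrier \<Gamma>" "i \<in> I" "s \<in> carrier (G i)"
  shows "x \<otimes>\<^bsub>\<Gamma>\<^esub> factor_embed I G i s = x(i := x i \<otimes>\<^bsub>G i\<^esub> s)"
proof
  fix k
  show "(x \<otimes>\<^bsub>\<Gamma>\<^esub> factor_embed I G i s) k = (x(i := x i \<otimes>\<^bsub>G i\<^esub> s)) k"
    using assms factor_group[of k]
    by (auto simp: factor_embed_def PiE_iff extensional_def group.is_monoid monoid.r_one)
qed

lemma product_fin_walk: "fin_walk \<Gamma> QP"
proof -
  have "set_pmf QP \<subseteq> carrier \<Gamma>"
    using supp_r factor_supp factor_embed_closed
    unfolding product_prob_def by (simp del: carrier_product_group) blast
  moreover have "finite (carrier \<Gamma>)" using fin_I factor_fin by (auto intro!: finite_PiE)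
  moreover have "group \<Gamma>" using factor_group by simp
  ultimately show ?thesis by (simp add: fin_walk_def fin_walk_axioms_def)
qed

lemma sum_product_prob:
  "(\<Sum>g\<in>carrier \<Gamma>. pmf QP g * F g)
    = (\<Sum>i\<in>I. pmf r i * (\<Sum>s\<in>carrier (G i). pmf (Q i) s * F (factor_embed I G i s)))" for F :: "('i \<Rightarrow> 'a) \<Rightarrow> real"
proof -
  interpret P: fin_walk \<Gamma> QP by (rule product_fin_walk)
  have "(\<Sum>g\<in>carrier \<Gamma>. pmf QP g * F g) = measure_pmf.expectation QP F"
    using P.fin P.supp by (subst integral_measure_pmf_real[of "carrier \<Gamma>"]) (auto simp: mult.commute)
  also have "\<dots> = (\<Sum>i\<in>I. pmf r i * measure_pmf.expectation (Q i) (\<lambda>s. F (factor_embed I G i s)))"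
    unfolding product_prob_def using fin_I supp_r factor_fin factor_supp
    by (subst pmf_expectation_bind[of I]) (auto intro!: finite_imageI intro: finite_subset[OF factor_supp factor_fin])
  also have "\<dots> = (\<Sum>i\<in>I. pmf r i * (\<Sum>s\<in>carrier (G i). pmf (Q i) s * F (factor_embed I G i s)))"
  proof (intro sum.cong refl arg_cong2[where f="(*)"])
    fix i assume "i \<in> I"
    then show "measure_pmf.expectation (Q i) (\<lambda>s. F (factor_embed I G i s))
        = (\<Sum>s\<in>carrier (G i). pmf (Q i) s * F (factor_embed I G i s))"
      using factor_fin factor_supp
      by (subst integral_measure_pmf_real[of "carrier (G i)"]) (auto simp: mult.commute)
  qed
  finally show ?thesis .
qed

lemma inv_factor_embed:
  assumes "i \<in> I" "s \<in> carrier (G i)"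
  shows "inv\<^bsub>\<Gamma>\<^esub> (factor_embed I G i s) = factor_embed I G i (inv\<^bsub>G i\<^esub> s)"
  using factor_embed_closed[OF assms] factor_group
  by (subst inv_product_group) (auto simp: factor_embed_def group.is_monoid monoid.inv_one intro!: restrict_ext)

lemma product_sym_walk: "sym_walk \<Gamma> QP"
proof -
  interpret P: fin_walk \<Gamma> QP by (rule product_fin_walk)
  show ?thesis
  proof unfold_locales
    fix g assume g: "g \<in> carrier \<Gamma>"
    have pmf_eq: "pmf QP h = (\<Sum>i\<in>I. pmf r i * (\<Sum>s\<in>carrier (G i). pmf (Q i) s * of_bool (factor_embed I G i s = h)))"
      if "h \<in> carrier \<Gamma>" for h
    proof -
      have "(\<Sum>x\<in>carrier \<Gamma>. pmf QP x * of_bool (x = h)) = pmf QP h"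
        using that P.fin by (simp add: of_bool_def if_distrib [of "\<lambda>c. _ * c"] cong: if_cong del: carrier_product_group)
      then show ?thesis using sum_product_prob[of "\<lambda>x. of_bool (x = h)"] by simp
    qed
    have "(\<Sum>s\<in>carrier (G i). pmf (Q i) s * of_bool (factor_embed I G i s = inv\<^bsub>\<Gamma>\<^esub> g))
        = (\<Sum>s\<in>carrier (G i). pmf (Q i) s * of_bool (factor_embed I G i s = g))" if i: "i \<in> I" for i
    proof -
      interpret F: sym_walk "G i" "Q i" by (rule factor[OF i])
      have key: "(factor_embed I G i (inv\<^bsub>G i\<^esub> s) = inv\<^bsub>\<Gamma>\<^esub> g) = (factor_embed I G i s = g)" if "s \<in> carrier (G i)" for s
        unfolding inv_factor_embed[OF i that, symmetric]
        using g factor_embed_closed[OF i that] P.inv_inv by metis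
      have "(factor_embed I G i s = inv\<^bsub>\<Gamma>\<^esub> g) = (factor_embed I G i (inv\<^bsub>G i\<^esub> s) = g)" if "s \<in> carrier (G i)" for s
        using key[of "inv\<^bsub>G i\<^esub> s"] that by simp
      then show ?thesis
        by (intro sum.reindex_bij_witness[of _ "\<lambda>s. inv\<^bsub>G i\<^esub> s" "\<lambda>s. inv\<^bsub>G i\<^esub> s"])
          (simp_all add: F.sym del: inv_product_group)
    qed
    then show "pmf QP (inv\<^bsub>\<Gamma>\<^esub> g) = pmf QP g"
      using g by (simp add: pmf_eq del: carrier_product_group inv_product_group)
  qed
qed

sublocale P: sym_walk \<Gamma> QP by (rule product_sym_walk)

lemma product_transition_apply:
  assumes x: "x \<in> carrier \<Gamma>"
  shows "(\<Sum>y\<in>carrier \<Gamma>. transition \<Gamma> QP x y * F y)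
    = (\<Sum>i\<in>I. pmf r i * (\<Sum>s\<in>carrier (G i). pmf (Q i) s * F (x(i := x i \<otimes>\<^bsub>G i\<^esub> s))))"
  unfolding P.transition_apply[OF x] sum_product_prob
  by (intro sum.cong refl arg_cong2[where f="(*)"]) (use x in \<open>auto simp: mult_factor_embed simp del: carrier_product_group mult_product_group\<close>)

lemma product_eigenfunction:
  assumes f: "\<And>i x. \<lbrakk>i \<in> I; x \<in> carrier (G i)\<rbrakk> \<Longrightarrow>
    (\<Sum>y\<in>carrier (G i). transition (G i) (Q i) x y * f i y) = b i * f i x"
  shows "P.eigenfunction (\<lambda>x. \<Prod>i\<in>I. f i (x i)) (\<Sum>i\<in>I. pmf r i * b i)"
proof
  fix x assume x: "x \<in> carrier \<Gamma>"
  have "(\<Sum>s\<in>carrier (G i). pmf (Q i) s * (\<Prod>k\<in>I. f k ((x(i := x i \<otimes>\<^bsub>G i\<^esub> s)) k))) = b i * (\<Prod>k\<in>I. f k (x k))"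
    if i: "i \<in> I" for i
  proof -
    interpret F: sym_walk "G i" "Q i" by (rule factor[OF i])
    have xi: "x i \<in> carrier (G i)" using x i by auto
    have "(\<Prod>k\<in>I. f k ((x(i := x i \<otimes>\<^bsub>G i\<^esub> s)) k)) = f i (x i \<otimes>\<^bsub>G i\<^esub> s) * (\<Prod>k\<in>I - {i}. f k (x k))" for s
      using fin_I i by (subst prod.remove[of _ i]) (auto intro!: prod.cong)
    then have "(\<Sum>s\<in>carrier (G i). pmf (Q i) s * (\<Prod>k\<in>I. f k ((x(i := x i \<otimes>\<^bsub>G i\<^esub> s)) k)))
        = (\<Sum>s\<in>carrier (G i). pmf (Q i) s * f i (x i \<otimes>\<^bsub>G i\<^esub> s)) * (\<Prod>k\<in>I - {i}. f k (x k))"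
      by (simp add: sum_distrib_right mult.assoc)
    also have "\<dots> = b i * f i (x i) * (\<Prod>k\<in>I - {i}. f k (x k))"
      using f[OF i xi] by (simp add: F.transition_apply[OF xi])
    also have "\<dots> = b i * (\<Prod>k\<in>I. f k (x k))"
      using fin_I i by (subst prod.remove[of I i]) auto
    finally show ?thesis .
  qed
  then show "(\<Sum>y\<in>carrier \<Gamma>. transition \<Gamma> QP x y * (\<Prod>i\<in>I. f i (y i)))
      = (\<Sum>i\<in>I. pmf r i * b i) * (\<Prod>i\<in>I. f i (x i))"
    unfolding product_transition_apply[OF x] by (simp add: sum_distrib_right mult.assoc)
qed

text \<open>Tensor products of eigenfunctions of the factors. Orthonormality and completeness are sums of
  products over \<open>PiE\<close>, which factor into products of the corresponding sums over the factors.\<close>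

lemma product_eigenbasis:
  assumes E: "\<And>i. i \<in> I \<Longrightarrow> eigenbasis (carrier (G i)) (transition (G i) (Q i)) (J i) (\<beta> i) (\<phi> i)"
  shows "eigenbasis (carrier \<Gamma>) (transition \<Gamma> QP) (PiE I J)
     (\<lambda>j. \<Sum>i\<in>I. pmf r i * \<beta> i (j i)) (\<lambda>j x. \<Prod>i\<in>I. \<phi> i (j i) (x i))"
proof
  show "finite (carrier \<Gamma>)" by (rule P.fin)
  show "finite (PiE I J)" by (rule finite_PiE[OF fin_I eigenbasis.finite_J[OF E]])
next
  fix j x assume j: "j \<in> PiE I J" and x: "x \<in> carrier \<Gamma>"
  show "(\<Sum>y\<in>carrier \<Gamma>. transition \<Gamma> QP x y * (\<Prod>i\<in>I. \<phi> i (j i) (y i)))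
      = (\<Sum>i\<in>I. pmf r i * \<beta> i (j i)) * (\<Prod>i\<in>I. \<phi> i (j i) (x i))"
    by (rule product_eigenfunction[rule_format, OF _ x]) (use j eigenbasis.eigen[OF E] in auto)
next
  have cancel: "(\<Prod>i\<in>I. if j i = k i then 1 else 0 :: real) = (if j = k then 1 else 0)"
    if "j \<in> extensional I" "k \<in> extensional I" for j k :: "'i \<Rightarrow> 'd"
  proof (cases "j = k")
    case False
    then have "\<exists>i\<in>I. j i \<noteq> k i" using extensionalityI[OF that] by metis
    then obtain i where "i \<in> I" "j i \<noteq> k i" by (elim bexE)
    then show ?thesis using fin_I False by (auto intro!: prod_zero)
  qed simp
  {
    fix j k assume j: "j \<in> PiE I J" "k \<in> PiE I J"
    have "(\<Sum>x\<in>carrier \<Gamma>. (\<Prod>i\<in>I. \<phi> i (j i) (x i)) * (\<Prod>i\<in>I. \<phi> i (k i) (x i)))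
        = (\<Prod>i\<in>I. \<Sum>s\<in>carrier (G i). \<phi> i (j i) s * \<phi> i (k i) s)"
      using fin_I factor_fin by (subst prod_sum_PiE) (auto simp: prod.distrib)
    also have "\<dots> = (\<Prod>i\<in>I. if j i = k i then 1 else 0)"
      using j by (intro prod.cong refl eigenbasis.orthonormal[OF E]) auto
    also have "\<dots> = (if j = k then 1 else 0)" using j by (intro cancel) (auto simp: PiE_iff)
    finally show "(\<Sum>x\<in>carrier \<Gamma>. (\<Prod>i\<in>I. \<phi> i (j i) (x i)) * (\<Prod>i\<in>I. \<phi> i (k i) (x i)))
        = (if j = k then 1 else 0)" .
  }
  {
    fix x y assume x: "x \<in> carrier \<Gamma>" "y \<in> carrier \<Gamma>"
    have "(\<Sum>j\<in>PiE I J. (\<Prod>i\<in>I. \<phi> i (j i) (x i)) * (\<Prod>i\<in>I. \<phi> i (j i) (y i)))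
        = (\<Prod>i\<in>I. \<Sum>k\<in>J i. \<phi> i k (x i) * \<phi> i k (y i))"
      using fin_I eigenbasis.finite_J[OF E] by (subst prod_sum_PiE) (auto simp: prod.distrib)
    also have "\<dots> = (\<Prod>i\<in>I. if x i = y i then 1 else 0)"
      using x by (intro prod.cong refl eigenbasis.complete[OF E]) auto
    also have "\<dots> = (if x = y then 1 else 0)" using x by (intro cancel) (auto simp: PiE_iff)
    finally show "(\<Sum>j\<in>PiE I J. (\<Prod>i\<in>I. \<phi> i (j i) (x i)) * (\<Prod>i\<in>I. \<phi> i (j i) (y i)))
        = (if x = y then 1 else 0)" .
  }
qed

lemma one_minus_mean: "1 - (\<Sum>i\<in>I. pmf r i * b i) = (\<Sum>i\<in>I. pmf r i * (1 - b i))"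
  using sum_r by (simp add: right_diff_distrib sum_subtractf)

text \<open>The eigenvalue gaps of the product are sums over the coordinates, so the trace factorises.\<close>

lemma product_heat_trace:
  assumes "\<And>i. i \<in> I \<Longrightarrow> finite (J i)"
  shows "(\<Sum>j\<in>PiE I J. exp (- (t * (1 - (\<Sum>i\<in>I. pmf r i * \<beta> i (j i))))))
    = (\<Prod>i\<in>I. \<Sum>k\<in>J i. exp (- (t * pmf r i * (1 - \<beta> i k))))"
  unfolding one_minus_mean
  using assms fin_I
  by (subst prod_sum_PiE) (auto simp: exp_sum[symmetric] sum_distrib_left sum_negf mult.assoc)

lemma coordinate_eigenfunction:
  assumes i: "i \<in> I" and f: "\<And>x. x \<in> carrier (G i) \<Longrightarrow>
    (\<Sum>y\<in>carrier (G i). transition (G i) (Q i) x y * f y) = (1 - \<gamma>) * f x"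
  shows "P.eigenfunction (\<lambda>x. f (x i)) (1 - pmf r i * \<gamma>)"
proof -
  have "P.eigenfunction (\<lambda>x. \<Prod>k\<in>I. (if k = i then f else (\<lambda>_. 1)) (x k))
      (\<Sum>k\<in>I. pmf r k * (if k = i then 1 - \<gamma> else 1))"
    using f sym_walk.eigenfunction_const[OF factor, of _ 1] by (intro product_eigenfunction) auto
  moreover have "(\<Prod>k\<in>I. (if k = i then f else (\<lambda>_. 1)) (x k)) = f (x i)" for x
    using fin_I i by (subst prod.remove[of _ i]) auto
  moreover have "1 - (\<Sum>k\<in>I. pmf r k * (if k = i then 1 - \<gamma> else 1)) = pmf r i * \<gamma>"
    unfolding one_minus_mean using fin_I i
    by (simp add: if_distrib [of "\<lambda>c. _ * c"] if_distrib [of "\<lambda>c. 1 - c"] cong: if_cong)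
  then have "(\<Sum>k\<in>I. pmf r k * (if k = i then 1 - \<gamma> else 1)) = 1 - pmf r i * \<gamma>" by linarith
  ultimately show ?thesis by simp
qed

lemma two_coordinate_eigenfunction:
  assumes ik: "i \<in> I" "k \<in> I" "i \<noteq> k" and f: "\<And>x. x \<in> carrier (G i) \<Longrightarrow>
    (\<Sum>y\<in>carrier (G i). transition (G i) (Q i) x y * f y) = (1 - \<gamma>) * f x"
    and g: "\<And>x. x \<in> carrier (G k) \<Longrightarrow>
    (\<Sum>y\<in>carrier (G k). transition (G k) (Q k) x y * g y) = (1 - \<delta>) * g x"
  shows "P.eigenfunction (\<lambda>x. f (x i) * g (x k)) (1 - (pmf r i * \<gamma> + pmf r k * \<delta>))"
proof -
  let ?f = "\<lambda>l. if l = i then f else if l = k then g else (\<lambda>_. 1)"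
  let ?b = "\<lambda>l. if l = i then 1 - \<gamma> else if l = k then 1 - \<delta> else 1"
  have "P.eigenfunction (\<lambda>x. \<Prod>l\<in>I. ?f l (x l)) (\<Sum>l\<in>I. pmf r l * ?b l)"
    using f g sym_walk.eigenfunction_const[OF factor, of _ 1] ik by (intro product_eigenfunction) auto
  moreover have "(\<Prod>l\<in>I. ?f l (x l)) = f (x i) * g (x k)" for x
    using fin_I ik by (subst prod.remove[of _ i], simp, simp, subst prod.remove[of _ k]) auto
  moreover have "1 - (\<Sum>l\<in>I. pmf r l * ?b l) = pmf r i * \<gamma> + pmf r k * \<delta>"
    unfolding one_minus_mean using fin_I ik
    by (subst sum.remove[of _ i], simp, simp, subst sum.remove[of _ k]) auto
  then have "(\<Sum>l\<in>I. pmf r l * ?b l) = 1 - (pmf r i * \<gamma> + pmf r k * \<delta>)" by linarith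
  ultimately show ?thesis by simp
qed

end

section \<open>The critical time of a system of rates\<close>

text \<open>Remove an index of maximal \<open>b\<close>: its rank is \<open>card S\<close>, and the ranks of the others can only
  decrease, which increases \<open>g\<close>. With ties, the ranks exceed \<open>1, 2, 3, \<dots>\<close>, so equality may fail.\<close>

lemma sum_rank_le:
  fixes b :: "'i \<Rightarrow> real" and g :: "nat \<Rightarrow> real"
  assumes "finite S" and g: "\<And>m n. m \<le> n \<Longrightarrow> g n \<le> g m"
  shows "(\<Sum>i\<in>S. g (card {k \<in> S. b k \<le> b i})) \<le> (\<Sum>k=1..card S. g k)"
  using assms(1)
proof (induction "card S" arbitrary: S)
  case (Suc n)
  then have "Max (b ` S) \<in> b ` S" by (intro Max_in) auto
  then obtain m where m: "m \<in> S" and bm: "b m = Max (b ` S)" by auto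
  then have max: "b k \<le> b m" if "k \<in> S" for k using that Suc.prems by simp
  have cS: "card (S - {m}) = n" using Suc m by simp
  have "(\<Sum>i\<in>S. g (card {k \<in> S. b k \<le> b i}))
      = g (card {k \<in> S. b k \<le> b m}) + (\<Sum>i\<in>S - {m}. g (card {k \<in> S. b k \<le> b i}))"
    using Suc.prems m by (simp add: sum.remove)
  also have "{k \<in> S. b k \<le> b m} = S" using max by auto
  also have "(\<Sum>i\<in>S - {m}. g (card {k \<in> S. b k \<le> b i})) \<le> (\<Sum>i\<in>S - {m}. g (card {k \<in> S - {m}. b k \<le> b i}))"
    using Suc.prems by (intro sum_mono g card_mono) auto
  also have "\<dots> \<le> (\<Sum>k=1..n. g k)" using Suc.hyps(1)[of "S - {m}"] Suc.prems cS by simp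
  finally show ?case using Suc.hyps(2)[symmetric] by simp
qed simp

locale rates =
  fixes S :: "'i set" and b :: "'i \<Rightarrow> real"
  assumes fin: "finite S" and ne: "S \<noteq> {}" and pos: "i \<in> S \<Longrightarrow> 0 < b i"
begin

text \<open>If the coordinates of a product relax at the rates \<open>b i\<close>, then the distance to uniformity at time
  \<open>t\<close> is governed by the sum of the \<open>exp (- 2 * b i * t)\<close>. The \<open>rank x\<close> terms with \<open>b i \<le> x\<close> contribute at least
  \<open>rank x * exp (- 2 * x * t)\<close>, and \<open>critical\<close> is the first time at which
  \<open>(1 + rank (b i)) * exp (- 2 * b i * t) \<le> 1\<close> for all \<open>i\<close>.\<close>

definition rank :: "real \<Rightarrow> nat" where "rank x = card {k \<in> S. b k \<le> x}"
definition critical :: real where "critical = Max ((\<lambda>i. ln (1 + rank (b i)) / (2 * b i)) ` S)"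
definition slowest :: real where "slowest = Min (b ` S)"

lemma slowest_le: "i \<in> S \<Longrightarrow> slowest \<le> b i"
  unfolding slowest_def using fin by simp

lemma slowest_in: obtains i where "i \<in> S" "b i = slowest"
proof -
  have "slowest \<in> b ` S" unfolding slowest_def using fin ne by (intro Min_in) auto
  then show thesis using that by auto
qed

lemma slowest_pos: "0 < slowest" using pos by (metis slowest_in)

lemma rank_pos: "i \<in> S \<Longrightarrow> 1 \<le> rank (b i)"
  unfolding rank_def using fin by (auto simp: Suc_le_eq card_gt_0_iff)

lemma rank_le: "i \<in> S \<Longrightarrow> ln (1 + rank (b i)) \<le> 2 * b i * critical"
proof -
  assume i: "i \<in> S"
  then have "ln (1 + rank (b i)) / (2 * b i) \<le> critical"
    unfolding critical_def using fin by (intro Max_ge) auto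
  then show ?thesis using pos[OF i] by (simp add: field_simps)
qed

lemma critical_attained: obtains i where "i \<in> S" "ln (1 + rank (b i)) = 2 * b i * critical"
proof -
  have "critical \<in> (\<lambda>i. ln (1 + rank (b i)) / (2 * b i)) ` S"
    unfolding critical_def using fin ne by (intro Max_in) auto
  then obtain i where i: "i \<in> S" "critical = ln (1 + rank (b i)) / (2 * b i)" by auto
  then have "ln (1 + rank (b i)) = 2 * b i * critical" using pos[OF i(1)] by simp
  then show thesis using that i(1) by blast
qed

lemma slowest_critical: "ln 2 \<le> 2 * (slowest * critical)"
proof -
  obtain i where i: "i \<in> S" "b i = slowest" by (rule slowest_in)
  have "ln 2 \<le> ln (1 + rank (b i))" using rank_pos[OF i(1)] by simp
  also have "\<dots> \<le> 2 * b i * critical" by (rule rank_le[OF i(1)])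
  finally show ?thesis using i by simp
qed

lemma critical_pos: "0 < critical"
proof -
  have "0 < ln (2::real)" by simp
  then have "0 < slowest * critical" using slowest_critical by linarith
  then show ?thesis using slowest_pos by (simp add: zero_less_mult_iff)
qed

lemma exp_rate_le:
  assumes i: "i \<in> S" and a: "0 \<le> a"
  shows "exp (- (2 * b i * (a * critical))) \<le> (1 + rank (b i)) powr (- a)"
proof -
  have "a * ln (1 + rank (b i)) \<le> a * (2 * b i * critical)" using rank_le[OF i] a by (rule mult_left_mono)
  then show ?thesis by (simp add: powr_def mult_ac)
qed

text \<open>By definition of the critical time, the terms at time \<open>a * critical\<close> are at most
  \<open>(1 + rank) powr (- a)\<close>, and the ranks may be replaced by \<open>1, 2, 3, \<dots>\<close>; the resulting series converges for
  \<open>a > 1\<close>. The additional time \<open>\<epsilon> * critical\<close> yields the factor in front, which tends to zero when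
  \<open>slowest * critical\<close> tends to infinity.\<close>

lemma laplace_le:
  assumes a: "1 < a" and t: "(a + \<epsilon>) * critical \<le> t" and e: "0 \<le> \<epsilon>"
  shows "(\<Sum>i\<in>S. exp (- (2 * b i * t)))
    \<le> exp (- (2 * \<epsilon> * (slowest * critical))) * (\<Sum>k. real (k + 1) powr (- a))"
proof -
  have sm: "summable (\<lambda>k. real (k + 1) powr (- a))"
    using summable_real_powr_iff[of "-a"] a by (subst summable_Suc_iff[of "\<lambda>k. real k powr (- a)", simplified Suc_eq_plus1]) auto
  have "(\<Sum>i\<in>S. exp (- (2 * b i * t)))
      \<le> (\<Sum>i\<in>S. exp (- (2 * \<epsilon> * (slowest * critical))) * (1 + rank (b i)) powr (- a))"
  proof (intro sum_mono)
    fix i assume i: "i \<in> S"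
    have "2 * b i * ((a + \<epsilon>) * critical) \<le> 2 * b i * t" using t pos[OF i] by (intro mult_left_mono) auto
    moreover have "2 * \<epsilon> * (slowest * critical) \<le> 2 * \<epsilon> * (b i * critical)"
      using slowest_le[OF i] e critical_pos by (intro mult_left_mono mult_right_mono) auto
    ultimately have "exp (- (2 * b i * t)) \<le> exp (- (2 * \<epsilon> * (slowest * critical))) * exp (- (2 * b i * (a * critical)))"
      unfolding exp_add[symmetric] exp_le_cancel_iff by (simp add: algebra_simps)
    also have "\<dots> \<le> exp (- (2 * \<epsilon> * (slowest * critical))) * (1 + rank (b i)) powr (- a)"
      using exp_rate_le[OF i, of a] a by (intro mult_left_mono) auto
    finally show "exp (- (2 * b i * t)) \<le> exp (- (2 * \<epsilon> * (slowest * critical))) * (1 + rank (b i)) powr (- a)" .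
  qed
  also have "\<dots> = exp (- (2 * \<epsilon> * (slowest * critical))) * (\<Sum>i\<in>S. (1 + rank (b i)) powr (- a))"
    by (simp add: sum_distrib_left)
  also have "(\<Sum>i\<in>S. (1 + rank (b i)) powr (- a)) \<le> (\<Sum>k=1..card S. (1 + real k) powr (- a))"
    using sum_rank_le[OF fin, of "\<lambda>m. (1 + real m) powr (- a)" b] a
    by (simp add: rank_def powr_mono2')
  also have "\<dots> \<le> (\<Sum>k. real (k + 1) powr (- a))"
    using sum_le_suminf[OF sm, of "{1..card S}"] by (simp add: add.commute)
  finally show ?thesis by (simp add: mult_left_mono)
qed

end

text \<open>Here \<open>\<D> n t\<close> is the distance to uniformity of the \<open>n\<close>th walk at time \<open>t\<close>, \<open>T\<close> is the set of
  admissible times, which is \<open>{0..}\<close> or \<open>range real\<close>, and \<open>\<tau> n \<epsilon>\<close> is the mixing time. What matters is that the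
  same exponents \<open>2 * b n i * t\<close> occur in the upper bound and in the second lower bound. The terms
  \<open>exp (- (c * (slowest * t)))\<close> and \<open>1 + 2 * x\<close> are corrections for discrete time, asymptotically negligible at
  the critical time.\<close>

locale cutoff_profile =
  fixes S :: "nat \<Rightarrow> 'i set" and b :: "nat \<Rightarrow> 'i \<Rightarrow> real" and \<D> :: "nat \<Rightarrow> real \<Rightarrow> real"
    and T :: "real set" and \<tau> :: "nat \<Rightarrow> real \<Rightarrow> real" and C c B :: real
  assumes rates: "\<forall>\<^sub>F n in sequentially. rates (S n) (b n)"
    and total_rate: "\<forall>\<^sub>F n in sequentially. (\<Sum>i\<in>S n. b n i) \<le> 2"
    and card_S: "filterlim (\<lambda>n. card (S n)) at_top sequentially"
    and C_c_pos: "0 < C" "0 < c"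
    and times_nonneg: "t \<in> T \<Longrightarrow> 0 \<le> t"
    and times_dense: "0 \<le> t \<Longrightarrow> \<exists>s\<in>T. t \<le> s \<and> s \<le> t + 1"
    and upper: "\<forall>\<^sub>F n in sequentially. \<forall>t\<in>T. (\<forall>i\<in>S n. B \<le> b n i * t) \<longrightarrow>
      (\<D> n t)\<^sup>2 \<le> exp (C * (\<Sum>i\<in>S n. exp (- (2 * b n i * t)))) - 1 + exp (- (c * (rates.slowest (S n) (b n) * t)))"
    and lower_one: "\<forall>\<^sub>F n in sequentially. \<forall>t\<in>T. \<forall>i\<in>S n. b n i \<le> 1 / 2 \<longrightarrow> exp (- (2 * b n i * t)) / 2 \<le> \<D> n t"
    and lower_many: "\<forall>\<^sub>F n in sequentially. \<forall>t\<in>T. \<forall>x. 0 < x \<and> x \<le> 1 / 2 \<and> 0 < rates.rank (S n) (b n) x \<longrightarrow>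
      1 - 8 * exp (2 * x * t * (1 + 2 * x)) / rates.rank (S n) (b n) x \<le> \<D> n t"
    and mixing_attained: "\<lbrakk>0 < \<epsilon>; \<epsilon> < 1; 1 \<le> n; t \<in> T; \<D> n t \<le> \<epsilon>\<rbrakk> \<Longrightarrow> \<tau> n \<epsilon> \<in> T \<and> \<D> n (\<tau> n \<epsilon>) \<le> \<epsilon>"
    and mixing_least: "\<lbrakk>0 < \<epsilon>; \<epsilon> < 1; 1 \<le> n; t \<in> T; \<D> n t \<le> \<epsilon>\<rbrakk> \<Longrightarrow> \<tau> n \<epsilon> \<le> t"
begin

definition "\<theta> n = rates.critical (S n) (b n)"
definition "\<sigma> n = rates.slowest (S n) (b n)"

lemma critical_pos_ev: "\<forall>\<^sub>F n in sequentially. 0 < \<theta> n"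
  using rates by eventually_elim (simp add: \<theta>_def rates.critical_pos)

lemma slowest_card_le: "\<forall>\<^sub>F n in sequentially. \<sigma> n * card (S n) \<le> 2"
  using rates total_rate
proof eventually_elim
  case (elim n)
  interpret rates "S n" "b n" by fact
  have "card (S n) * slowest \<le> (\<Sum>i\<in>S n. b n i)"
    using slowest_le by (intro sum_bounded_below) auto
  then show ?case using elim by (simp add: \<sigma>_def mult.commute)
qed

text \<open>The total rate is bounded while the number of rates tends to infinity.\<close>

lemma slowest_small: "\<forall>\<^sub>F n in sequentially. \<sigma> n \<le> 1 / 2"
proof -
  have "\<forall>\<^sub>F n in sequentially. 4 \<le> card (S n)" using card_S by (simp add: filterlim_at_top)
  then show ?thesis using slowest_card_le rates
  proof eventually_elim
    case (elim n)
    interpret rates "S n" "b n" by fact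
    have "\<sigma> n * 4 \<le> \<sigma> n * card (S n)" using elim(1) slowest_pos by (intro mult_left_mono) (auto simp: \<sigma>_def)
    then show ?case using elim by linarith
  qed
qed

lemma upper_slowest: "\<forall>\<^sub>F n in sequentially. \<forall>t\<in>T. B \<le> \<sigma> n * t \<longrightarrow>
      (\<D> n t)\<^sup>2 \<le> exp (C * (\<Sum>i\<in>S n. exp (- (2 * b n i * t)))) - 1 + exp (- (c * (\<sigma> n * t)))"
  using upper rates
proof eventually_elim
  case (elim n)
  interpret rates "S n" "b n" by fact
  have "B \<le> b n i * t" if "t \<in> T" "B \<le> \<sigma> n * t" "i \<in> S n" for i t
    using that slowest_le[OF that(3)] times_nonneg[OF that(1)] mult_right_mono[of "\<sigma> n" "b n i" t]
    by (simp add: \<sigma>_def)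
  then show ?case using elim(1) by (auto simp: \<sigma>_def)
qed

lemma above_critical:
  assumes M: "filterlim (\<lambda>n. \<sigma> n * \<theta> n) at_top sequentially" and e: "0 < e" and d: "0 < d"
  shows "\<forall>\<^sub>F n in sequentially. \<forall>t\<in>T. (1 + e) * \<theta> n \<le> t \<longrightarrow> \<D> n t \<le> d"
proof -
  define K where "K = (\<Sum>k. real (k + 1) powr (- (1 + e / 2)))"
  have "((\<lambda>x::real. exp (C * (exp (- (2 * (e / 2) * x)) * K)) - 1 + exp (- (c * x))) \<longlongrightarrow> 0) at_top"
    using C_c_pos e by real_asymp
  then have "((\<lambda>n. exp (C * (exp (- (2 * (e / 2) * (\<sigma> n * \<theta> n))) * K)) - 1 + exp (- (c * (\<sigma> n * \<theta> n)))) \<longlongrightarrow> 0) sequentially"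
    using M by (rule filterlim_compose)
  then have "\<forall>\<^sub>F n in sequentially. exp (C * (exp (- (2 * (e / 2) * (\<sigma> n * \<theta> n))) * K)) - 1 + exp (- (c * (\<sigma> n * \<theta> n))) < d\<^sup>2"
    using d by (intro order_tendstoD(2)) auto
  moreover have "\<forall>\<^sub>F n in sequentially. max B 0 \<le> \<sigma> n * \<theta> n" using M by (simp only: filterlim_at_top)
  ultimately show ?thesis using upper_slowest rates
  proof eventually_elim
    case (elim n)
    interpret rates "S n" "b n" by fact
    show ?case
    proof (intro ballI impI)
      fix t assume t: "t \<in> T" "(1 + e) * \<theta> n \<le> t"
      have th: "0 < \<theta> n" "0 < \<sigma> n" using critical_pos slowest_pos by (auto simp: \<theta>_def \<sigma>_def)
      have "\<theta> n \<le> (1 + e) * \<theta> n" using th e by simp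
      then have "\<theta> n \<le> t" using t(2) by linarith
      then have st: "\<sigma> n * \<theta> n \<le> \<sigma> n * t" using th by (intro mult_left_mono) auto
      then have "B \<le> \<sigma> n * t" using elim(2) by simp
      then have "(\<D> n t)\<^sup>2 \<le> exp (C * (\<Sum>i\<in>S n. exp (- (2 * b n i * t)))) - 1 + exp (- (c * (\<sigma> n * t)))"
        using elim(3) t(1) by blast
      also have "\<dots> \<le> exp (C * (exp (- (2 * (e / 2) * (\<sigma> n * \<theta> n))) * K)) - 1 + exp (- (c * (\<sigma> n * \<theta> n)))"
        using C_c_pos st laplace_le[of "1 + e / 2" "e / 2" t] e t(2)
        by (intro add_mono diff_mono) (auto simp: K_def \<theta>_def \<sigma>_def add.commute)
      also have "\<dots> < d\<^sup>2" by (rule elim(1))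
      finally show "\<D> n t \<le> d" using d by (meson less_eq_real_def power2_less_imp_less)
    qed
  qed
qed

text \<open>Let \<open>x\<close> be the rate at which the maximum defining the critical time is attained. The number of
  rates up to \<open>x\<close> is \<open>exp (2 * x * \<theta> n) - 1\<close>, which beats \<open>exp (2 * x * t)\<close> by a factor tending to infinity. The
  correction \<open>1 + 2 * x\<close> is harmless, since \<open>x\<close> is at most \<open>1 / (\<sigma> n * \<theta> n)\<close>: the logarithm
  \<open>2 * x * \<theta> n\<close> is at most \<open>card (S n)\<close>, which is at most \<open>2 / \<sigma> n\<close>.\<close>

lemma below_critical:
  assumes M: "filterlim (\<lambda>n. \<sigma> n * \<theta> n) at_top sequentially" and e: "0 < e" "e < 1" and d: "0 < d"
  shows "\<forall>\<^sub>F n in sequentially. \<forall>t\<in>T. t \<le> (1 - e) * \<theta> n \<longrightarrow> 1 - d \<le> \<D> n t"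
proof -
  have "((\<lambda>x::real. 16 * exp (- (e * x))) \<longlongrightarrow> 0) at_top" using e by real_asymp
  then have "((\<lambda>n. 16 * exp (- (e * (\<sigma> n * \<theta> n)))) \<longlongrightarrow> 0) sequentially"
    using M by (rule filterlim_compose)
  then have "\<forall>\<^sub>F n in sequentially. 16 * exp (- (e * (\<sigma> n * \<theta> n))) < d"
    using d by (intro order_tendstoD(2)) auto
  moreover have "\<forall>\<^sub>F n in sequentially. 4 / e \<le> \<sigma> n * \<theta> n" using M by (simp only: filterlim_at_top)
  ultimately show ?thesis using lower_many rates slowest_card_le
  proof eventually_elim
    case (elim n)
    interpret rates "S n" "b n" by fact
    have th: "0 < \<theta> n" "0 < \<sigma> n" using critical_pos slowest_pos by (auto simp: \<theta>_def \<sigma>_def)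
    let ?M = "\<sigma> n * \<theta> n"
    have M4: "4 \<le> ?M" using elim(2) e by (smt (verit) divide_le_eq mult_left_le)
    obtain i where i: "i \<in> S n" "ln (1 + rank (b n i)) = 2 * b n i * \<theta> n"
      unfolding \<theta>_def by (rule critical_attained)
    define x where "x = b n i"
    have x0: "0 < x" using pos[OF i(1)] by (simp add: x_def)
    have rk: "1 \<le> rank x" using rank_pos[OF i(1)] by (simp add: x_def)
    have cS: "0 < card (S n)" using fin ne by (simp add: card_gt_0_iff)
    have xM: "x \<le> 1 / ?M"
    proof -
      have "rank x \<le> card (S n)" unfolding rank_def using fin by (intro card_mono) auto
      then have "2 * x * \<theta> n \<le> real (card (S n))"
        using i(2) ln_le_minus_one[of "1 + rank x"] by (simp add: x_def)
      then have "2 * x * \<theta> n * \<sigma> n \<le> real (card (S n)) * \<sigma> n" using th by (intro mult_right_mono) auto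
      then have "x * ?M \<le> 1" using elim(5) by (simp add: mult_ac)
      then show ?thesis using th by (simp add: field_simps)
    qed
    also have "\<dots> \<le> 1 / 4" using M4 by (intro divide_left_mono) auto
    finally have x4: "x \<le> 1 / 2" by simp
    have xe: "2 * x \<le> e / 2"
    proof -
      have "x \<le> 1 / (4 / e)" using xM elim(2) e th by (meson divide_left_mono divide_pos_pos mult_pos_pos order_trans zero_le_one zero_less_numeral)
      then show ?thesis by simp
    qed
    have xth: "?M \<le> x * \<theta> n" using slowest_le[OF i(1)] th by (simp add: x_def \<sigma>_def)
    show ?case
    proof (intro ballI impI)
      fix t assume t: "t \<in> T" "t \<le> (1 - e) * \<theta> n"
      have rk_eq: "real (rank x) = exp (2 * x * \<theta> n) - 1"
        using i(2) by (simp add: x_def) (metis add_pos_nonneg exp_ln add_diff_cancel_left' of_nat_0_le_iff zero_less_one)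
      have "exp (2 * x * \<theta> n) \<le> 2 * rank x" using rk rk_eq by simp
      have "2 * x * t * (1 + 2 * x) \<le> 2 * x * \<theta> n - e * ?M"
      proof -
        have "t * (1 + 2 * x) \<le> (1 - e) * \<theta> n * (1 + e / 2)"
          using t(2) xe x0 th e times_nonneg[OF t(1)] by (intro mult_mono) auto
        also have "\<dots> \<le> \<theta> n - e / 2 * \<theta> n"
          using th e by (simp add: algebra_simps)
        finally have "2 * x * (t * (1 + 2 * x)) \<le> 2 * x * (\<theta> n - e / 2 * \<theta> n)"
          using x0 by (intro mult_left_mono) auto
        also have "\<dots> = 2 * x * \<theta> n - e * (x * \<theta> n)" by (simp add: algebra_simps)
        also have "\<dots> \<le> 2 * x * \<theta> n - e * ?M" using xth e by simp
        finally show ?thesis by (simp add: mult.assoc)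
      qed
      then have "8 * exp (2 * x * t * (1 + 2 * x)) / rank x \<le> 8 * exp (2 * x * \<theta> n - e * ?M) / rank x"
        using rk by (intro divide_right_mono) auto
      also have "\<dots> = 8 * exp (- (e * ?M)) * (exp (2 * x * \<theta> n) / rank x)"
        by (simp add: exp_diff exp_minus field_simps)
      also have "\<dots> \<le> 8 * exp (- (e * ?M)) * 2"
        using \<open>exp (2 * x * \<theta> n) \<le> 2 * rank x\<close> rk by (intro mult_left_mono) (auto simp: field_simps)
      also have "\<dots> < d" using elim(1) by simp
      finally have "1 - d \<le> 1 - 8 * exp (2 * x * t * (1 + 2 * x)) / rank x" by simp
      also have "\<dots> \<le> \<D> n t" using elim(3) t(1) x0 x4 rk by auto
      finally show "1 - d \<le> \<D> n t" .
    qed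
  qed
qed

text \<open>Since \<open>\<sigma> n * \<theta> n\<close> is always at least \<open>ln 2 / 2\<close>, a sufficiently large multiple of the critical
  time makes the upper bound small.\<close>

lemma half_mixed:
  obtains K where "1 \<le> K" "\<forall>\<^sub>F n in sequentially. \<forall>t\<in>T. K * \<theta> n \<le> t \<longrightarrow> \<D> n t \<le> 1 / 2"
proof -
  define L where "L = (\<Sum>k. real (k + 1) powr (- 2))"
  have "((\<lambda>x::real. exp (C * (exp (- (2 * x * (ln 2 / 2))) * L)) - 1 + exp (- (c * (x * (ln 2 / 2))))) \<longlongrightarrow> 0) at_top"
    using C_c_pos by real_asymp
  then have "\<forall>\<^sub>F x in at_top. exp (C * (exp (- (2 * x * (ln 2 / 2))) * L)) - 1 + exp (- (c * (x * (ln 2 / 2)))) < (1 / 4 :: real)"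
    by (intro order_tendstoD(2)) auto
  then have "\<forall>\<^sub>F x in at_top. exp (C * (exp (- (2 * x * (ln 2 / 2))) * L)) - 1 + exp (- (c * (x * (ln 2 / 2)))) < (1 / 4 :: real)
     \<and> 1 \<le> x \<and> B \<le> x * (ln 2 / 2)"
    by (intro eventually_conj eventually_ge_at_top) (auto, real_asymp)
  then obtain x :: real where x: "exp (C * (exp (- (2 * x * (ln 2 / 2))) * L)) - 1 + exp (- (c * (x * (ln 2 / 2)))) < 1 / 4"
    "1 \<le> x" "B \<le> x * (ln 2 / 2)"
    using eventually_happens'[OF trivial_limit_at_top_linorder] by blast
  show thesis
  proof (rule that[of "2 + x"])
    show "\<forall>\<^sub>F n in sequentially. \<forall>t\<in>T. (2 + x) * \<theta> n \<le> t \<longrightarrow> \<D> n t \<le> 1 / 2"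
      using upper_slowest rates
    proof eventually_elim
      case (elim n)
      interpret rates "S n" "b n" by fact
      show ?case
      proof (intro ballI impI)
        fix t assume t: "t \<in> T" "(2 + x) * \<theta> n \<le> t"
        have th: "0 < \<theta> n" "0 < \<sigma> n" using critical_pos slowest_pos by (auto simp: \<theta>_def \<sigma>_def)
        have M: "ln 2 / 2 \<le> \<sigma> n * \<theta> n" using slowest_critical by (simp add: \<theta>_def \<sigma>_def)
        have "x * \<theta> n \<le> t" using t(2) th by (simp add: distrib_right)
        then have "\<sigma> n * (x * \<theta> n) \<le> \<sigma> n * t" using th by (intro mult_left_mono) auto
        moreover have "x * (ln 2 / 2) \<le> x * (\<sigma> n * \<theta> n)" using M x(2) by (intro mult_left_mono) auto
        ultimately have st: "x * (ln 2 / 2) \<le> \<sigma> n * t" by (simp add: mult_ac)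
        have lap: "(\<Sum>i\<in>S n. exp (- (2 * b n i * t))) \<le> exp (- (2 * x * (ln 2 / 2))) * L"
        proof -
          have "(\<Sum>i\<in>S n. exp (- (2 * b n i * t))) \<le> exp (- (2 * x * (\<sigma> n * \<theta> n))) * L"
            using laplace_le[of 2 x t] t(2) x(2) by (simp add: L_def \<theta>_def \<sigma>_def)
          also have "\<dots> \<le> exp (- (2 * x * (ln 2 / 2))) * L"
          proof (rule mult_right_mono)
            have "2 * x * (ln 2 / 2) \<le> 2 * x * (\<sigma> n * \<theta> n)" using M x(2) by (intro mult_left_mono) auto
            then show "exp (- (2 * x * (\<sigma> n * \<theta> n))) \<le> exp (- (2 * x * (ln 2 / 2)))" by simp
            have "summable (\<lambda>k. real (k + 1) powr (- 2))"
              using summable_real_powr_iff[of "-2"] by (subst summable_Suc_iff[of "\<lambda>k. real k powr (- 2)", simplified Suc_eq_plus1]) auto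
            then show "0 \<le> L" unfolding L_def by (intro suminf_nonneg) auto
          qed
          finally show ?thesis .
        qed
        have "(\<D> n t)\<^sup>2 \<le> exp (C * (\<Sum>i\<in>S n. exp (- (2 * b n i * t)))) - 1 + exp (- (c * (\<sigma> n * t)))"
          using elim(1) t(1) st x(3) by (meson order_trans)
        also have "\<dots> \<le> exp (C * (exp (- (2 * x * (ln 2 / 2))) * L)) - 1 + exp (- (c * (x * (ln 2 / 2))))"
          using C_c_pos st lap by (intro add_mono diff_mono) auto
        also have "\<dots> < (1 / 2)\<^sup>2" using x(1) by (simp add: power2_eq_square)
        finally show "\<D> n t \<le> 1 / 2" by (meson less_eq_real_def power2_less_imp_less zero_le_divide_1_iff zero_le_numeral)
      qed
    qed
  qed (use x(2) in simp)
qed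

lemma critical_tendsto:
  assumes M: "filterlim (\<lambda>n. \<sigma> n * \<theta> n) at_top sequentially"
  shows "filterlim \<theta> at_top sequentially"
proof (rule filterlim_at_top_mono[OF M])
  show "\<forall>\<^sub>F n in sequentially. \<sigma> n * \<theta> n \<le> \<theta> n"
    using slowest_small rates
  proof eventually_elim
    case (elim n)
    interpret rates "S n" "b n" by fact
    show ?case using elim critical_pos by (simp add: \<theta>_def)
  qed
qed

lemma mixing_critical:
  assumes M: "filterlim (\<lambda>n. \<sigma> n * \<theta> n) at_top sequentially" and eps: "0 < \<epsilon>" "\<epsilon> < 1"
  shows "(\<lambda>n. \<tau> n \<epsilon> / \<theta> n) \<longlonglongrightarrow> 1"
proof (rule LIMSEQ_I)
  fix r :: real assume r: "0 < r"
  define e where "e = min (r / 3) (1 / 2)"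
  have e: "0 < e" "e < 1" "2 * e < r" using r by (auto simp: e_def)
  have "\<forall>\<^sub>F n in sequentially. 1 / e \<le> \<theta> n" using critical_tendsto[OF M] by (simp only: filterlim_at_top)
  moreover have "\<forall>\<^sub>F n in sequentially. \<forall>t\<in>T. t \<le> (1 - e) * \<theta> n \<longrightarrow> 1 - (1 - \<epsilon>) / 2 \<le> \<D> n t"
    using M e eps by (intro below_critical) auto
  moreover have "\<forall>\<^sub>F n in sequentially. \<forall>t\<in>T. (1 + e) * \<theta> n \<le> t \<longrightarrow> \<D> n t \<le> \<epsilon>"
    using M e eps by (intro above_critical) auto
  ultimately have "\<forall>\<^sub>F n in sequentially. norm (\<tau> n \<epsilon> / \<theta> n - 1) < r"
    using eventually_ge_at_top[of 1]
  proof eventually_elim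
    case (elim n)
    have th: "0 < \<theta> n" using elim(1) e by (meson divide_pos_pos less_le_trans zero_less_one)
    obtain s where s: "s \<in> T" "(1 + e) * \<theta> n \<le> s" "s \<le> (1 + e) * \<theta> n + 1"
      using times_dense[of "(1 + e) * \<theta> n"] th e by auto
    have Ds: "\<D> n s \<le> \<epsilon>" using elim(3) s by blast
    have up: "\<tau> n \<epsilon> \<le> s" by (rule mixing_least[OF eps elim(4) s(1) Ds])
    have att: "\<tau> n \<epsilon> \<in> T" "\<D> n (\<tau> n \<epsilon>) \<le> \<epsilon>" using mixing_attained[OF eps elim(4) s(1) Ds] by auto
    have low: "(1 - e) * \<theta> n < \<tau> n \<epsilon>"
    proof (rule ccontr)
      assume "\<not> ?thesis"
      then have "1 - (1 - \<epsilon>) / 2 \<le> \<D> n (\<tau> n \<epsilon>)" using elim(2) att by auto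
      then show False using att(2) eps by (simp add: field_simps)
    qed
    have "1 \<le> e * \<theta> n" using elim(1) e by (simp add: field_simps)
    then have "\<tau> n \<epsilon> \<le> (1 + 2 * e) * \<theta> n" using up s(3) by (simp add: algebra_simps)
    then have "\<tau> n \<epsilon> / \<theta> n \<le> 1 + 2 * e" "1 - e \<le> \<tau> n \<epsilon> / \<theta> n"
      using low th by (auto simp: field_simps)
    then show ?case using e by (auto simp: abs_less_iff)
  qed
  then show "\<exists>no. \<forall>n\<ge>no. norm (\<tau> n \<epsilon> / \<theta> n - 1) < r" by (simp add: eventually_sequentially)
qed

lemma mixing_tendsto:
  assumes M: "filterlim (\<lambda>n. \<sigma> n * \<theta> n) at_top sequentially" and eps: "0 < \<epsilon>" "\<epsilon> < 1"
  shows "filterlim (\<lambda>n. \<tau> n \<epsilon>) at_top sequentially"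
proof -
  have "filterlim (\<lambda>n. \<tau> n \<epsilon> / \<theta> n * \<theta> n) at_top sequentially"
    by (rule filterlim_tendsto_pos_mult_at_top[OF mixing_critical[OF M eps] _ critical_tendsto[OF M]]) simp
  moreover have "\<forall>\<^sub>F n in sequentially. \<tau> n \<epsilon> / \<theta> n * \<theta> n = \<tau> n \<epsilon>"
    using critical_pos_ev by eventually_elim simp
  ultimately show ?thesis by (simp cong: filterlim_cong)
qed

lemma ex_mixed:
  assumes d: "0 < d"
  shows "\<forall>\<^sub>F n in sequentially. \<exists>t\<in>T. \<D> n t \<le> d"
  using upper_slowest rates
proof eventually_elim
  case (elim n)
  interpret rates "S n" "b n" by fact
  have \<sigma>: "0 < \<sigma> n" using slowest_pos by (simp add: \<sigma>_def)
  define s where "s = \<sigma> n"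
  define k where "k = real (card (S n))"
  have "0 < k" using fin ne by (simp add: k_def card_gt_0_iff)
  then have "((\<lambda>t. exp (C * (k * exp (- (2 * s * t)))) - 1 + exp (- (c * (s * t)))) \<longlongrightarrow> 0) at_top"
    using C_c_pos \<sigma>[folded s_def] by real_asymp
  then have "\<forall>\<^sub>F t in at_top. exp (C * (k * exp (- (2 * \<sigma> n * t)))) - 1 + exp (- (c * (\<sigma> n * t))) < d\<^sup>2"
    unfolding s_def using d by (intro order_tendstoD(2)) auto
  then obtain t0 where t0: "\<And>t. t0 \<le> t \<Longrightarrow> exp (C * (k * exp (- (2 * \<sigma> n * t)))) - 1 + exp (- (c * (\<sigma> n * t))) < d\<^sup>2"
    by (auto simp: eventually_at_top_linorder)
  have "0 \<le> max t0 (max 0 (B / \<sigma> n))" by simp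
  from times_dense[OF this] obtain t where t: "t \<in> T" "max t0 (max 0 (B / \<sigma> n)) \<le> t"
    by blast
  have "B \<le> \<sigma> n * t" using t(2) \<sigma> by (simp add: field_simps)
  then have "(\<D> n t)\<^sup>2 \<le> exp (C * (\<Sum>i\<in>S n. exp (- (2 * b n i * t)))) - 1 + exp (- (c * (\<sigma> n * t)))"
    using elim(1) t(1) by blast
  also have "\<dots> \<le> exp (C * (k * exp (- (2 * \<sigma> n * t)))) - 1 + exp (- (c * (\<sigma> n * t)))"
  proof -
    have "(\<Sum>i\<in>S n. exp (- (2 * b n i * t))) \<le> (\<Sum>i\<in>S n. exp (- (2 * \<sigma> n * t)))"
      using slowest_le times_nonneg[OF t(1)] by (intro sum_mono) (auto simp: \<sigma>_def mult_right_mono)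
    then show ?thesis using C_c_pos by (simp add: k_def)
  qed
  also have "\<dots> < d\<^sup>2" using t0 t(2) by simp
  finally have "\<D> n t \<le> d" using d by (meson less_eq_real_def power2_less_imp_less)
  then show ?case using t(1) by blast
qed

theorem cutoff_time_order:
  assumes M: "filterlim (\<lambda>n. \<sigma> n * \<theta> n) at_top sequentially"
    and s: "\<And>n. s n \<in> T" "(\<lambda>n. \<D> n (s n)) \<longlonglongrightarrow> 0" "\<forall>\<^sub>F n in sequentially. s n \<le> 2 * t n + 1"
    and s': "\<And>n. s' n \<in> T" "(\<lambda>n. \<D> n (s' n)) \<longlonglongrightarrow> 1" "\<forall>\<^sub>F n in sequentially. t n / 2 - 1 \<le> s' n"
  shows "\<forall>\<^sub>F n in sequentially. \<theta> n / 8 \<le> t n \<and> t n \<le> 6 * \<theta> n"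
proof -
  have "\<forall>\<^sub>F n in sequentially. \<D> n (s n) < 1 / 2" "\<forall>\<^sub>F n in sequentially. 1 / 2 < \<D> n (s' n)"
    by (rule order_tendstoD(2)[OF s(2)], simp) (rule order_tendstoD(1)[OF s'(2)], simp)
  moreover have "\<forall>\<^sub>F n in sequentially. \<forall>t\<in>T. (1 + 1) * \<theta> n \<le> t \<longrightarrow> \<D> n t \<le> 1 / 2"
    by (intro above_critical M) auto
  moreover have "\<forall>\<^sub>F n in sequentially. \<forall>t\<in>T. t \<le> (1 - 1 / 2) * \<theta> n \<longrightarrow> 1 - 1 / 2 \<le> \<D> n t"
    by (intro below_critical M) auto
  moreover have "\<forall>\<^sub>F n in sequentially. 4 \<le> \<theta> n" using critical_tendsto[OF M] by (simp only: filterlim_at_top)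
  ultimately show ?thesis using s(3) s'(3)
  proof eventually_elim
    case (elim n)
    have "s' n < 2 * \<theta> n" using elim(2,3) s'(1)[of n] by (metis linorder_not_less one_add_one)
    moreover have "\<theta> n / 2 < s n"
    proof (rule ccontr)
      assume "\<not> \<theta> n / 2 < s n"
      then have "1 - 1 / 2 \<le> \<D> n (s n)" using elim(4) s(1)[of n] by auto
      then show False using elim(1) by simp
    qed
    ultimately show ?case using elim(5-7) by linarith
  qed
qed

text \<open>If \<open>\<sigma> n * \<theta> n\<close> tends to infinity, then all mixing times are asymptotic to the critical time. If it
  stays below \<open>Z\<close> along a subsequence, then \<open>\<tau> n (1 / 2)\<close> is at most of order \<open>\<theta> n\<close> there, while
  the slowest coordinate alone keeps the distance above a small \<open>x\<close> for a time longer by a factor of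
  at least two, so that the mixing times at \<open>x\<close> and at \<open>1 / 2\<close> are not asymptotic.\<close>

theorem cutoff_iff:
  "(\<forall>\<epsilon>\<in>{0<..<1}. \<forall>\<delta>\<in>{0<..<1}. (\<lambda>n. \<tau> n \<epsilon> / \<tau> n \<delta>) \<longlonglongrightarrow> 1)
    \<longleftrightarrow> filterlim (\<lambda>n. \<sigma> n * \<theta> n) at_top sequentially" (is "?L \<longleftrightarrow> ?R")
proof
  assume M: ?R
  show ?L
  proof (intro ballI)
    fix \<epsilon> \<delta> :: real assume "\<epsilon> \<in> {0<..<1}" "\<delta> \<in> {0<..<1}"
    then have "(\<lambda>n. (\<tau> n \<epsilon> / \<theta> n) / (\<tau> n \<delta> / \<theta> n)) \<longlonglongrightarrow> 1 / 1"
      by (intro tendsto_divide mixing_critical[OF M]) auto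
    moreover have "\<forall>\<^sub>F n in sequentially. (\<tau> n \<epsilon> / \<theta> n) / (\<tau> n \<delta> / \<theta> n) = \<tau> n \<epsilon> / \<tau> n \<delta>"
      using critical_pos_ev by eventually_elim simp
    ultimately have "(\<lambda>n. \<tau> n \<epsilon> / \<tau> n \<delta>) \<longlonglongrightarrow> 1 / 1" by (rule Lim_transform_eventually)
    then show "(\<lambda>n. \<tau> n \<epsilon> / \<tau> n \<delta>) \<longlonglongrightarrow> 1" by simp
  qed
next
  assume L: ?L
  show ?R
  proof (rule ccontr)
    assume "\<not> ?R"
    then obtain Z where Z: "\<exists>\<^sub>F n in sequentially. \<sigma> n * \<theta> n < Z"
      by (auto simp: filterlim_at_top not_eventually not_le)
    obtain K where K: "1 \<le> K" "\<forall>\<^sub>F n in sequentially. \<forall>t\<in>T. K * \<theta> n \<le> t \<longrightarrow> \<D> n t \<le> 1 / 2"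
      by (rule half_mixed)
    obtain x where x: "0 < x" "x < 1 / 4" "\<And>z. z \<le> 8 * K * Z + 8 \<Longrightarrow> x < exp (- z) / 2"
    proof -
      let ?x = "min (1 / 8) (exp (- (8 * K * Z + 8)) / 4)"
      have "?x < exp (- z) / 2" if "z \<le> 8 * K * Z + 8" for z
      proof -
        have "exp (- (8 * K * Z + 8)) \<le> exp (- z)" using that by simp
        moreover have "exp (- z) > 0" by simp
        ultimately have "exp (- (8 * K * Z + 8)) / 4 < exp (- z) / 2" by linarith
        then show ?thesis by linarith
      qed
      then show thesis using that[of ?x] by auto
    qed
    have "(\<lambda>n. \<tau> n x / \<tau> n (1 / 2)) \<longlonglongrightarrow> 1" using L x by auto
    then have ev: "\<forall>\<^sub>F n in sequentially. 1 / 2 < \<tau> n x / \<tau> n (1 / 2)" "\<forall>\<^sub>F n in sequentially. \<tau> n x / \<tau> n (1 / 2) < 2"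
      by (rule order_tendstoD, simp)+
    have long: "\<forall>\<^sub>F n in sequentially. \<forall>t\<in>T. \<D> n t \<le> x \<longrightarrow> 8 * K * Z + 8 \<le> 2 * \<sigma> n * t"
      using lower_one slowest_small rates
    proof eventually_elim
      case (elim n)
      interpret rates "S n" "b n" by fact
      obtain i where i: "i \<in> S n" "b n i = \<sigma> n" unfolding \<sigma>_def by (rule slowest_in)
      show ?case
      proof (intro ballI impI)
        fix t assume t: "t \<in> T" "\<D> n t \<le> x"
        have "exp (- (2 * \<sigma> n * t)) / 2 \<le> \<D> n t" using elim(1,2) i t(1) by metis
        then show "8 * K * Z + 8 \<le> 2 * \<sigma> n * t" using x(3)[of "2 * \<sigma> n * t"] t(2) by linarith
      qed
    qed
    have "\<exists>\<^sub>F n in sequentially. False"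
      using Z
    proof (rule frequently_rev_mp)
      show "\<forall>\<^sub>F n in sequentially. \<sigma> n * \<theta> n < Z \<longrightarrow> False"
        using ev K(2) long rates slowest_small eventually_ge_at_top[of 1] ex_mixed[OF x(1)]
      proof eventually_elim
        case (elim n)
        interpret rates "S n" "b n" by fact
        have th: "0 < \<theta> n" "0 < \<sigma> n" using critical_pos slowest_pos by (auto simp: \<theta>_def \<sigma>_def)
        show ?case
        proof
          assume nZ: "\<sigma> n * \<theta> n < Z"
          obtain s where s: "s \<in> T" "K * \<theta> n \<le> s" "s \<le> K * \<theta> n + 1"
            using times_dense[of "K * \<theta> n"] th K(1) by auto
          have "\<D> n s \<le> 1 / 2" using elim(3) s by blast
          then have up: "\<tau> n (1 / 2) \<le> s" and nn: "0 \<le> \<tau> n (1 / 2)"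
            using mixing_least[of "1/2" n s] mixing_attained[of "1/2" n s] times_nonneg elim(7) s(1) by auto
          have sup: "\<sigma> n * \<tau> n (1 / 2) \<le> K * Z + 1 / 2"
          proof -
            have "\<sigma> n * \<tau> n (1 / 2) \<le> \<sigma> n * (K * \<theta> n + 1)" using up s(3) th by (intro mult_left_mono) auto
            also have "\<dots> = K * (\<sigma> n * \<theta> n) + \<sigma> n" by (simp add: algebra_simps)
            also have "\<dots> \<le> K * Z + 1 / 2" using nZ K(1) elim(6) by (intro add_mono mult_left_mono) auto
            finally show ?thesis .
          qed
          obtain s' where "s' \<in> T" "\<D> n s' \<le> x" using elim(8) by auto
          then have "\<tau> n x \<in> T" "\<D> n (\<tau> n x) \<le> x"
            using mixing_attained[of x n s'] x(1,2) elim(7) by auto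
          then have low: "8 * K * Z + 8 \<le> 2 * \<sigma> n * \<tau> n x" using elim(4) by blast
          have "\<tau> n (1 / 2) > 0" using elim(1) nn by (cases "\<tau> n (1 / 2) = 0") auto
          then have "\<tau> n x \<le> 2 * \<tau> n (1 / 2)" using elim(2) by (simp add: field_simps)
          then have "2 * \<sigma> n * \<tau> n x \<le> 4 * (\<sigma> n * \<tau> n (1 / 2))" using th by simp
          moreover have "0 < K * Z" using nZ th K(1) by (smt (verit) mult_pos_pos)
          moreover have "8 * (K * Z) + 8 \<le> 2 * \<sigma> n * \<tau> n x" using low by (simp add: mult.assoc)
          ultimately show False using sup by linarith
        qed
      qed
    qed
    then show False by simp
  qed
qed

end

section \<open>Distance to uniformity of a product\<close>

text \<open>The set \<open>Z\<close> consists of the nontrivial factors; a trivial factor has no spectral gap, and it does not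
  move the product walk.\<close>

locale growth_product = product_walk I r G Q
  for I :: "'i set" and r and G :: "'i \<Rightarrow> ('a, 'b) monoid_scheme" and Q +
  fixes \<eta> A :: real and D :: nat and \<rho> :: "'i \<Rightarrow> nat" and Z :: "'i set" and \<gamma> :: "'i \<Rightarrow> real"
  assumes growth_factor: "i \<in> I \<Longrightarrow> growth_walk (G i) (Q i) \<eta> A D (\<rho> i)"
    and Z: "Z \<subseteq> I" "Z \<noteq> {}"
    and scale: "i \<in> Z \<Longrightarrow> growth_walk.spectral_scale (G i) (Q i) \<eta> A D (\<rho> i) (\<gamma> i)"
    and trivial: "i \<in> I - Z \<Longrightarrow> card (carrier (G i)) = 1"
    and r_pos: "i \<in> Z \<Longrightarrow> 0 < pmf r i"
begin

definition "rate i = pmf r i * \<gamma> i"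
abbreviation "K \<equiv> gap_const A D"
abbreviation "H \<equiv> heat_const \<eta> A D"

lemma scaleD:
  assumes "i \<in> Z"
  shows "0 < \<gamma> i" "\<gamma> i \<le> 2" "\<eta> / (\<rho> i)\<^sup>2 \<le> \<gamma> i" "\<gamma> i \<le> K / (\<rho> i)\<^sup>2"
  using scale[OF assms] growth_walk.spectral_scale_def[OF growth_factor, of i "\<gamma> i"] assms Z by auto

lemma \<eta>_pos: "0 < \<eta>" and \<eta>_le_1: "\<eta> \<le> 1" and H_pos: "0 < H"
  using Z growth_factor growth_walk.\<eta>(1) growth_walk.\<eta>_le_1 growth_walk.heat_const_pos by blast+

lemma K_pos: "0 < K" by (simp add: gap_const_def add_pos_nonneg)

lemma \<rho>_pos: "i \<in> I \<Longrightarrow> 0 < \<rho> i"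
  using growth_walk.\<rho>(1)[OF growth_factor] by force

lemma fin_Z: "finite Z" using Z fin_I finite_subset by blast

lemma rate_pos: "i \<in> Z \<Longrightarrow> 0 < rate i" using r_pos scaleD by (simp add: rate_def)

lemma rates_Z: "rates Z rate" using fin_Z Z rate_pos by unfold_locales auto

sublocale R: rates Z rate by (rule rates_Z)

lemma total_rate: "(\<Sum>i\<in>Z. rate i) \<le> 2"
proof -
  have "(\<Sum>i\<in>Z. rate i) \<le> (\<Sum>i\<in>Z. pmf r i * 2)"
    unfolding rate_def using scaleD by (intro sum_mono mult_left_mono) auto
  also have "\<dots> \<le> (\<Sum>i\<in>I. pmf r i * 2)" using fin_I Z by (intro sum_mono2) auto
  finally show ?thesis by (simp add: sum_distrib_right[symmetric] sum_r)
qed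

lemma rate_le_2: "i \<in> Z \<Longrightarrow> rate i \<le> 2"
  by (rule order_trans[OF member_le_sum total_rate]) (auto simp: fin_Z intro: less_imp_le rate_pos)

lemma peak_eigenfunctions:
  obtains \<psi> where "\<And>i x. \<lbrakk>i \<in> Z; x \<in> carrier (G i)\<rbrakk> \<Longrightarrow>
      (\<Sum>y\<in>carrier (G i). transition (G i) (Q i) x y * \<psi> i y) = (1 - \<gamma> i) * \<psi> i x"
    "\<And>i. i \<in> Z \<Longrightarrow> \<psi> i \<one>\<^bsub>G i\<^esub> = 1" "\<And>i x. \<lbrakk>i \<in> Z; x \<in> carrier (G i)\<rbrakk> \<Longrightarrow> \<bar>\<psi> i x\<bar> \<le> 1"
proof -
  have "\<forall>i\<in>Z. \<exists>\<psi>. (\<forall>x\<in>carrier (G i). (\<Sum>y\<in>carrier (G i). transition (G i) (Q i) x y * \<psi> y) = (1 - \<gamma> i) * \<psi> x)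
      \<and> \<psi> \<one>\<^bsub>G i\<^esub> = 1 \<and> (\<forall>x\<in>carrier (G i). \<bar>\<psi> x\<bar> \<le> 1)"
    using scale Z growth_walk.spectral_scale_def[OF growth_factor] by blast
  from bchoice[OF this] show thesis using that by blast
qed

text \<open>The heat trace of each factor is at most \<open>1 + H * exp (- rate i * s)\<close> from the time on at which the
  coordinate has been moved for a time of order \<open>\<rho>\<^sup>2\<close>, and that time is at most of order \<open>1 / rate i\<close>.
  Multiply these bounds, using \<open>1 + y \<le> exp y\<close>.\<close>

lemma product_spectrum:
  obtains \<beta> :: "('i \<Rightarrow> nat) \<Rightarrow> real" and \<Phi> and J where
    "eigenbasis (carrier \<Gamma>) (transition \<Gamma> QP) J \<beta> \<Phi>"
    "\<And>s. \<lbrakk>0 \<le> s; \<And>i. i \<in> Z \<Longrightarrow> 8 * K / \<eta> \<le> rate i * s\<rbrakk> \<Longrightarrow>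
      (\<Sum>j\<in>J. exp (- (s * (1 - \<beta> j)))) \<le> exp (H * (\<Sum>i\<in>Z. exp (- (rate i * s))))"
    "\<And>j. j \<in> J \<Longrightarrow> \<beta> j \<le> 1"
    "\<And>j. \<lbrakk>j \<in> J; \<And>i. i \<in> I \<Longrightarrow> \<eta> \<le> pmf (Q i) \<one>\<^bsub>G i\<^esub>\<rbrakk> \<Longrightarrow> 2 * \<eta> - 1 \<le> \<beta> j"
proof -
  let ?N = "\<lambda>i. card (carrier (G i))"
  have "\<forall>i\<in>I. \<exists>\<beta>\<phi>. eigenbasis (carrier (G i)) (transition (G i) (Q i)) {..<?N i} (fst \<beta>\<phi>) (snd \<beta>\<phi> :: nat \<Rightarrow> 'a \<Rightarrow> real) \<and>
      (i \<in> Z \<longrightarrow> (\<forall>t. 8 * (real (\<rho> i))\<^sup>2 / \<eta> \<le> t \<longrightarrow>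
        (\<Sum>j<?N i. exp (- (t * (1 - fst \<beta>\<phi> j)))) \<le> 1 + H * exp (- (\<gamma> i * t))))"
    (is "\<forall>i\<in>I. ?X i")
  proof
    fix i assume i: "i \<in> I"
    show "?X i"
    proof (cases "i \<in> Z")
      case True
      obtain \<beta> and \<phi> :: "nat \<Rightarrow> 'a \<Rightarrow> real" where "eigenbasis (carrier (G i)) (transition (G i) (Q i)) {..<?N i} \<beta> \<phi>"
         "\<forall>t. 8 * (real (\<rho> i))\<^sup>2 / \<eta> \<le> t \<longrightarrow> (\<Sum>j<?N i. exp (- (t * (1 - \<beta> j)))) \<le> 1 + H * exp (- (\<gamma> i * t))"
        using scale[OF True] growth_walk.spectral_scale_def[OF growth_factor[OF i]] by blast
      then show ?thesis by (intro exI[of _ "(\<beta>, \<phi>)"]) simp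
    next
      case False
      obtain \<beta> and \<phi> :: "nat \<Rightarrow> 'a \<Rightarrow> real" where "eigenbasis (carrier (G i)) (transition (G i) (Q i)) {..<?N i} \<beta> \<phi>"
        by (rule sym_walk.obtain_eigenbasis[OF factor[OF i]])
      then show ?thesis using False by (intro exI[of _ "(\<beta>, \<phi>)"]) simp
    qed
  qed
  from bchoice[OF this] obtain f where f: "\<And>i. i \<in> I \<Longrightarrow> eigenbasis (carrier (G i)) (transition (G i) (Q i)) {..<?N i} (fst (f i)) (snd (f i) :: nat \<Rightarrow> 'a \<Rightarrow> real)"
      "\<And>i t. \<lbrakk>i \<in> I; i \<in> Z; 8 * (real (\<rho> i))\<^sup>2 / \<eta> \<le> t\<rbrakk> \<Longrightarrow>
        (\<Sum>j<?N i. exp (- (t * (1 - fst (f i) j)))) \<le> 1 + H * exp (- (\<gamma> i * t))"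
    by blast
  define \<beta> where "\<beta> i = fst (f i)" for i
  define \<phi> where "\<phi> i = snd (f i)" for i
  note E = f(1)[folded \<beta>_def \<phi>_def] and heat = f(2)[folded \<beta>_def]
  have gwb: "growth_walk_basis (G i) (Q i) \<eta> A D (\<rho> i) {..<?N i} (\<beta> i) (\<phi> i)" if "i \<in> I" for i
    using growth_factor[OF that] E[OF that] by (simp add: growth_walk_basis_def growth_walk_basis_axioms_def)
  let ?J = "PiE I (\<lambda>i. {..<?N i})" and ?\<beta> = "\<lambda>j. \<Sum>i\<in>I. pmf r i * \<beta> i (j i)"
  show thesis
  proof (rule that)
    show "eigenbasis (carrier \<Gamma>) (transition \<Gamma> QP) ?J ?\<beta> (\<lambda>j x. \<Prod>i\<in>I. \<phi> i (j i) (x i))"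
      by (rule product_eigenbasis[OF E])
    show "?\<beta> j \<le> 1" if j: "j \<in> ?J" for j
    proof -
      have "?\<beta> j \<le> (\<Sum>i\<in>I. pmf r i * 1)"
        using j growth_walk_basis.\<beta>_le_1[OF gwb] by (intro sum_mono mult_left_mono) auto
      then show ?thesis by (simp add: sum_r)
    qed
    show "2 * \<eta> - 1 \<le> ?\<beta> j" if j: "j \<in> ?J" and lazy: "\<And>i. i \<in> I \<Longrightarrow> \<eta> \<le> pmf (Q i) \<one>\<^bsub>G i\<^esub>" for j
    proof -
      have "2 * \<eta> - 1 \<le> \<beta> i (j i)" if "i \<in> I" for i
        using growth_walk_basis.\<beta>_ge[OF gwb[OF that], of "j i"] j that lazy[OF that] by (auto simp: PiE_iff)
      then have "(\<Sum>i\<in>I. pmf r i * (2 * \<eta> - 1)) \<le> ?\<beta> j" by (intro sum_mono mult_left_mono) auto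
      then show ?thesis by (simp add: sum_r sum_distrib_right[symmetric])
    qed
    fix s :: real assume s: "0 \<le> s" "\<And>i. i \<in> Z \<Longrightarrow> 8 * K / \<eta> \<le> rate i * s"
    have one: "(\<Sum>k<?N i. exp (- (s * pmf r i * (1 - \<beta> i k)))) \<le> exp (if i \<in> Z then H * exp (- (rate i * s)) else 0)"
      if i: "i \<in> I" for i
    proof (cases "i \<in> Z")
      case True
      have "8 * K / \<eta> \<le> pmf r i * (K / (\<rho> i)\<^sup>2) * s"
        using s(2)[OF True] mult_left_mono[OF scaleD(4)[OF True], of "pmf r i * s"] s(1)
        by (simp add: rate_def mult_ac)
      then have "K * (8 / \<eta>) \<le> K * (pmf r i * s / (\<rho> i)\<^sup>2)" by (simp add: mult_ac)
      then have "8 / \<eta> \<le> pmf r i * s / (\<rho> i)\<^sup>2" using K_pos by (simp only: mult_le_cancel_left_pos)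
      then have "8 * (real (\<rho> i))\<^sup>2 / \<eta> \<le> s * pmf r i" using \<rho>_pos[OF i] by (simp add: field_simps)
      from heat[OF i True this]
      have "(\<Sum>k<?N i. exp (- (s * pmf r i * (1 - \<beta> i k)))) \<le> 1 + H * exp (- (rate i * s))"
        by (simp add: rate_def mult_ac)
      also have "\<dots> \<le> exp (H * exp (- (rate i * s)))" by (rule exp_ge_add_one_self)
      finally show ?thesis using True by simp
    next
      case False
      then have "?N i = 1" using trivial i by simp
      moreover have "\<beta> i 0 \<le> 1" using growth_walk_basis.\<beta>_le_1[OF gwb[OF i], of 0] calculation by simp
      ultimately show ?thesis using False s(1) by simp
    qed
    have "(\<Sum>j\<in>?J. exp (- (s * (1 - ?\<beta> j)))) = (\<Prod>i\<in>I. \<Sum>k<?N i. exp (- (s * pmf r i * (1 - \<beta> i k))))"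
      by (rule product_heat_trace) simp
    also have "\<dots> \<le> (\<Prod>i\<in>I. exp (if i \<in> Z then H * exp (- (rate i * s)) else 0))"
      using one by (intro prod_mono) (auto intro!: sum_nonneg)
    also have "\<dots> = exp (H * (\<Sum>i\<in>Z. exp (- (rate i * s))))"
      unfolding exp_sum[OF fin_I, symmetric] sum_distrib_left
      using fin_I Z by (simp add: sum.inter_restrict[symmetric] Int_absorb1)
    finally show "(\<Sum>j\<in>?J. exp (- (s * (1 - ?\<beta> j)))) \<le> exp (H * (\<Sum>i\<in>Z. exp (- (rate i * s))))" .
  qed
qed

text \<open>From the time on at which \<open>rate i * t\<close> reaches this value, the trace bound is available for the
  exponents \<open>2 * t\<close> and \<open>\<eta> * t\<close>, and \<open>H * card Z\<close> is at most \<open>\<eta> * t / 2\<close>.\<close>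

definition "threshold = 8 * K / \<eta>\<^sup>2 + 4 * H / \<eta>"

lemma threshold_ge: "4 * K / \<eta> \<le> threshold" "8 * K / \<eta>\<^sup>2 \<le> threshold" "4 * H / \<eta> \<le> threshold"
proof -
  have "4 * K / \<eta> \<le> 8 * K / \<eta>\<^sup>2"
    using K_pos \<eta>_pos \<eta>_le_1 by (simp add: field_simps power2_eq_square)
  then show "4 * K / \<eta> \<le> threshold" using H_pos \<eta>_pos by (simp add: threshold_def add_increasing2)
  show "8 * K / \<eta>\<^sup>2 \<le> threshold" "4 * H / \<eta> \<le> threshold"
    using K_pos H_pos \<eta>_pos by (auto simp: threshold_def)
qed

lemma heat_upper:
  assumes t: "0 \<le> t" "\<And>i. i \<in> Z \<Longrightarrow> threshold \<le> rate i * t"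
  shows "(d_TV_c \<Gamma> QP t)\<^sup>2 \<le> exp (H * (\<Sum>i\<in>Z. exp (- (2 * rate i * t)))) - 1"
proof -
  interpret W: walk_kernel \<Gamma> QP "\<lambda>b. exp (t * (b - 1))" "heat_kernel \<Gamma> QP t"
    by (rule P.heat_walk_kernel[OF t(1)])
  obtain \<beta> :: "('i \<Rightarrow> nat) \<Rightarrow> real" and \<Phi> J where E: "eigenbasis (carrier \<Gamma>) (transition \<Gamma> QP) J \<beta> \<Phi>"
    and tr: "\<And>s. \<lbrakk>0 \<le> s; \<And>i. i \<in> Z \<Longrightarrow> 8 * K / \<eta> \<le> rate i * s\<rbrakk> \<Longrightarrow>
      (\<Sum>j\<in>J. exp (- (s * (1 - \<beta> j)))) \<le> exp (H * (\<Sum>i\<in>Z. exp (- (rate i * s))))"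
    by (rule product_spectrum) blast
  have "(d_TV_c \<Gamma> QP t)\<^sup>2 \<le> (\<Sum>j\<in>J. (exp (t * (\<beta> j - 1)))\<^sup>2) - 1"
    unfolding d_TV_c_def by (rule W.tv_square_le[OF E])
  also have "(\<Sum>j\<in>J. (exp (t * (\<beta> j - 1)))\<^sup>2) = (\<Sum>j\<in>J. exp (- (2 * t * (1 - \<beta> j))))"
    by (intro sum.cong refl) (simp add: exp_double[symmetric] algebra_simps)
  also have "\<dots> \<le> exp (H * (\<Sum>i\<in>Z. exp (- (rate i * (2 * t)))))"
  proof (rule tr)
    fix i assume "i \<in> Z"
    then have "4 * K / \<eta> \<le> rate i * t" using t(2)[of i] threshold_ge(1) by linarith
    from mult_left_mono[OF this, of 2] show "8 * K / \<eta> \<le> rate i * (2 * t)" by (simp add: mult.left_commute)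
  qed (use t in simp)
  finally show ?thesis by (simp add: mult_ac)
qed

text \<open>In discrete time the eigenvalues of either sign enter. The nonnegative ones are at most
  \<open>exp (- (1 - b))\<close>, as in continuous time. The negative ones have \<open>\<bar>b\<bar> \<le> 1 - 2 * \<eta> \<le> exp (- 2 * \<eta>)\<close>, and they
  are charged to the heat trace at the shorter time \<open>\<eta> * m\<close>, with a factor \<open>exp (- \<eta> * m)\<close> to spare.\<close>

lemma lazy_power_le:
  fixes b :: real
  assumes "2 * \<eta> - 1 \<le> b" "b \<le> 1"
  shows "(b ^ m)\<^sup>2 \<le> exp (- (2 * real m * (1 - b))) + exp (- (\<eta> * real m)) * exp (- (\<eta> * real m * (1 - b)))"
proof (cases "0 \<le> b")
  case True
  have "b \<le> exp (- (1 - b))" using exp_ge_add_one_self[of "b - 1"] by simp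
  then have "(b ^ m)\<^sup>2 \<le> (exp (- (1 - b)) ^ m)\<^sup>2" using True by (intro power_mono) auto
  also have "\<dots> = exp (- (2 * real m * (1 - b)))"
    by (simp add: exp_of_nat_mult[symmetric] exp_double[symmetric] algebra_simps)
  finally show ?thesis by (simp add: add_increasing2)
next
  case False
  have "\<bar>b\<bar> \<le> exp (- (2 * \<eta>))" using exp_ge_add_one_self[of "- (2 * \<eta>)"] assms False by simp
  then have "(\<bar>b\<bar> ^ m)\<^sup>2 \<le> (exp (- (2 * \<eta>)) ^ m)\<^sup>2" by (intro power_mono) auto
  also have "\<dots> = exp (- (4 * \<eta> * real m))"
    by (simp add: exp_of_nat_mult[symmetric] exp_double[symmetric] algebra_simps)
  also have "\<dots> \<le> exp (- (\<eta> * real m) + - (\<eta> * real m * (1 - b)))"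
  proof -
    have "\<eta> * real m * (1 - b) \<le> \<eta> * real m * 2" using assms \<eta>_pos by (intro mult_left_mono) auto
    moreover have "0 \<le> \<eta> * real m" using \<eta>_pos by simp
    ultimately show ?thesis by simp
  qed
  finally have "(b ^ m)\<^sup>2 \<le> exp (- (\<eta> * real m)) * exp (- (\<eta> * real m * (1 - b)))"
    by (simp only: exp_add power_abs[symmetric] power2_abs)
  then show ?thesis by (simp add: add_increasing)
qed

text \<open>The negative eigenvalues contribute at most \<open>exp (- \<eta> * m)\<close> times a heat trace, which is at most
  \<open>exp (H * card Z)\<close>. As the rates add up to at most 2, \<open>card Z\<close> is at most \<open>2 * m / threshold\<close> once
  \<open>rate i * m \<ge> threshold\<close>, so the factor \<open>exp (- \<eta> * m)\<close> prevails.\<close>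

lemma discrete_upper:
  assumes lazy: "\<And>i. i \<in> I \<Longrightarrow> \<eta> \<le> pmf (Q i) \<one>\<^bsub>G i\<^esub>"
    and m: "\<And>i. i \<in> Z \<Longrightarrow> threshold \<le> rate i * real m"
  shows "(d_TV \<Gamma> QP m)\<^sup>2 \<le> exp (H * (\<Sum>i\<in>Z. exp (- (2 * rate i * real m)))) - 1
     + exp (- (\<eta> / 4 * (R.slowest * real m)))"
proof -
  interpret W: walk_kernel \<Gamma> QP "\<lambda>b. b ^ m" "discrete_kernel \<Gamma> QP m"
    by (rule P.discrete_walk_kernel)
  obtain \<beta> :: "('i \<Rightarrow> nat) \<Rightarrow> real" and \<Phi> J where E: "eigenbasis (carrier \<Gamma>) (transition \<Gamma> QP) J \<beta> \<Phi>"
    and tr: "\<And>s. \<lbrakk>0 \<le> s; \<And>i. i \<in> Z \<Longrightarrow> 8 * K / \<eta> \<le> rate i * s\<rbrakk> \<Longrightarrow>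
      (\<Sum>j\<in>J. exp (- (s * (1 - \<beta> j)))) \<le> exp (H * (\<Sum>i\<in>Z. exp (- (rate i * s))))"
    and le1: "\<And>j. j \<in> J \<Longrightarrow> \<beta> j \<le> 1"
    and ge: "\<And>j. \<lbrakk>j \<in> J; \<And>i. i \<in> I \<Longrightarrow> \<eta> \<le> pmf (Q i) \<one>\<^bsub>G i\<^esub>\<rbrakk> \<Longrightarrow> 2 * \<eta> - 1 \<le> \<beta> j"
    by (rule product_spectrum) blast
  have "(d_TV \<Gamma> QP m)\<^sup>2 \<le> (\<Sum>j\<in>J. (\<beta> j ^ m)\<^sup>2) - 1"
    unfolding d_TV_def by (rule W.tv_square_le[OF E])
  also have "(\<Sum>j\<in>J. (\<beta> j ^ m)\<^sup>2) \<le> (\<Sum>j\<in>J. exp (- (2 * real m * (1 - \<beta> j))) + exp (- (\<eta> * real m)) * exp (- (\<eta> * real m * (1 - \<beta> j))))"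
    by (intro sum_mono lazy_power_le) (auto intro: ge le1 lazy)
  also have "\<dots> = (\<Sum>j\<in>J. exp (- (2 * real m * (1 - \<beta> j)))) + exp (- (\<eta> * real m)) * (\<Sum>j\<in>J. exp (- (\<eta> * real m * (1 - \<beta> j))))"
    by (simp add: sum.distrib sum_distrib_left)
  also have "(\<Sum>j\<in>J. exp (- (2 * real m * (1 - \<beta> j)))) \<le> exp (H * (\<Sum>i\<in>Z. exp (- (rate i * (2 * real m)))))"
  proof (rule tr)
    fix i assume "i \<in> Z"
    then have "4 * K / \<eta> \<le> rate i * m" using m[of i] threshold_ge(1) by linarith
    from mult_left_mono[OF this, of 2] show "8 * K / \<eta> \<le> rate i * (2 * real m)" by (simp add: mult.left_commute)
  qed simp
  also have "exp (- (\<eta> * real m)) * (\<Sum>j\<in>J. exp (- (\<eta> * real m * (1 - \<beta> j)))) \<le> exp (- (\<eta> / 4 * (R.slowest * real m)))"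
  proof -
    have "(\<Sum>j\<in>J. exp (- (\<eta> * real m * (1 - \<beta> j)))) \<le> exp (H * (\<Sum>i\<in>Z. exp (- (rate i * (\<eta> * real m)))))"
    proof (rule tr)
      fix i assume "i \<in> Z"
      then have "8 * K / \<eta>\<^sup>2 \<le> rate i * m" using m[of i] threshold_ge(2) by linarith
      then show "8 * K / \<eta> \<le> rate i * (\<eta> * real m)" using \<eta>_pos by (simp add: field_simps power2_eq_square)
    qed (use \<eta>_pos in simp)
    also have "\<dots> \<le> exp (\<eta> / 2 * real m)"
    proof -
      have "(\<Sum>i\<in>Z. exp (- (rate i * (\<eta> * real m)))) \<le> (\<Sum>i\<in>Z. 1)"
      proof (rule sum_mono)
        fix i assume "i \<in> Z"
        then have "0 \<le> rate i * (\<eta> * real m)" using rate_pos[of i] \<eta>_pos by simp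
        then show "exp (- (rate i * (\<eta> * real m))) \<le> 1" by simp
      qed
      then have "H * (\<Sum>i\<in>Z. exp (- (rate i * (\<eta> * real m)))) \<le> H * card Z"
        using H_pos by (intro mult_left_mono) auto
      moreover have "card Z * (4 * H / \<eta>) \<le> 2 * real m"
      proof -
        have "card Z * (4 * H / \<eta>) \<le> (\<Sum>i\<in>Z. rate i * real m)"
          using m threshold_ge(3) by (intro sum_bounded_below) fastforce
        also have "\<dots> \<le> 2 * real m" unfolding sum_distrib_right[symmetric]
          using total_rate by (intro mult_right_mono) auto
        finally show ?thesis .
      qed
      then have "H * card Z \<le> \<eta> / 2 * m" using \<eta>_pos by (simp add: field_simps)
      ultimately show ?thesis by simp
    qed
    finally have "exp (- (\<eta> * real m)) * (\<Sum>j\<in>J. exp (- (\<eta> * real m * (1 - \<beta> j)))) \<le> exp (- (\<eta> * real m)) * exp (\<eta> / 2 * real m)"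
      by (intro mult_left_mono) auto
    also have "\<dots> \<le> exp (- (\<eta> / 4 * (R.slowest * real m)))"
    proof -
      obtain i where i: "i \<in> Z" "rate i = R.slowest" by (rule R.slowest_in)
      have "\<eta> / 4 * (R.slowest * real m) \<le> \<eta> / 4 * (2 * real m)"
        using rate_le_2[OF i(1)] i(2) \<eta>_pos by (intro mult_left_mono mult_right_mono) auto
      then show ?thesis unfolding exp_add[symmetric] by simp
    qed
    finally show ?thesis .
  qed
  finally show ?thesis by (simp add: mult_ac)
qed

lemma kernel_lower_one:
  assumes W: "walk_kernel \<Gamma> QP h P" and i: "i \<in> Z"
  shows "h (1 - rate i) / 2 \<le> tv_to_uniform \<Gamma> (P \<one>\<^bsub>\<Gamma>\<^esub>)"
proof -
  interpret W: walk_kernel \<Gamma> QP h P by (rule W)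
  obtain \<psi> where \<psi>: "\<And>i x. \<lbrakk>i \<in> Z; x \<in> carrier (G i)\<rbrakk> \<Longrightarrow>
      (\<Sum>y\<in>carrier (G i). transition (G i) (Q i) x y * \<psi> i y) = (1 - \<gamma> i) * \<psi> i x"
    "\<And>i. i \<in> Z \<Longrightarrow> \<psi> i \<one>\<^bsub>G i\<^esub> = 1" "\<And>i x. \<lbrakk>i \<in> Z; x \<in> carrier (G i)\<rbrakk> \<Longrightarrow> \<bar>\<psi> i x\<bar> \<le> 1"
    by (rule peak_eigenfunctions) blast
  have iI: "i \<in> I" using i Z by auto
  have "P.eigenfunction (\<lambda>x. \<psi> i (x i)) (1 - rate i)"
    unfolding rate_def by (rule coordinate_eigenfunction[OF iI \<psi>(1)[OF i]])
  then show ?thesis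
    by (rule W.tv_ge_eigenvalue) (use rate_pos[OF i] \<psi>(2,3)[OF i] iI in auto)
qed

text \<open>Chebyshev's inequality for the sum of the peaked eigenfunctions of all coordinates of rate at most \<open>x\<close>;
  every one of them has mean at least \<open>exp (- e)\<close>.\<close>

lemma kernel_lower_many:
  assumes W: "walk_kernel \<Gamma> QP h P" and N: "0 < R.rank x"
    and h1: "\<And>b. \<lbrakk>0 < b; b \<le> x\<rbrakk> \<Longrightarrow> exp (- e) \<le> h (1 - b)"
    and h2: "\<And>b b'. \<lbrakk>0 < b; b \<le> x; 0 < b'; b' \<le> x\<rbrakk> \<Longrightarrow> h (1 - (b + b')) \<le> h (1 - b) * h (1 - b')"
  shows "1 - 8 * exp (2 * e) / R.rank x \<le> tv_to_uniform \<Gamma> (P \<one>\<^bsub>\<Gamma>\<^esub>)"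
proof -
  interpret W: walk_kernel \<Gamma> QP h P by (rule W)
  obtain \<psi> where \<psi>: "\<And>i x. \<lbrakk>i \<in> Z; x \<in> carrier (G i)\<rbrakk> \<Longrightarrow>
      (\<Sum>y\<in>carrier (G i). transition (G i) (Q i) x y * \<psi> i y) = (1 - \<gamma> i) * \<psi> i x"
    "\<And>i. i \<in> Z \<Longrightarrow> \<psi> i \<one>\<^bsub>G i\<^esub> = 1" "\<And>i x. \<lbrakk>i \<in> Z; x \<in> carrier (G i)\<rbrakk> \<Longrightarrow> \<bar>\<psi> i x\<bar> \<le> 1"
    by (rule peak_eigenfunctions) blast
  define B where "B = {i \<in> Z. rate i \<le> x}"
  have B: "finite B" "card B = R.rank x" using fin_Z by (auto simp: B_def R.rank_def)
  have BZ: "i \<in> Z" "i \<in> I" "rate i \<le> x" "0 < rate i" if "i \<in> B" for i using that Z rate_pos by (auto simp: B_def)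
  let ?M = "\<Sum>i\<in>B. h (1 - rate i)"
  have M: "card B * exp (- e) \<le> ?M" using h1 BZ by (intro sum_bounded_below) auto
  have c0: "0 < real (card B)" using N B by simp
  have M0: "0 < ?M" using M c0 by (smt (verit) exp_gt_zero mult_pos_pos)
  have e1: "P.eigenfunction (\<lambda>x. \<psi> i (x i)) (1 - rate i)" if "i \<in> B" for i
    unfolding rate_def by (rule coordinate_eigenfunction[OF BZ(2)[OF that] \<psi>(1)[OF BZ(1)[OF that]]])
  have e2: "\<psi> i (\<one>\<^bsub>\<Gamma>\<^esub> i) = 1" if "i \<in> B" for i
    using BZ[OF that] \<psi>(2) by simp
  have e3: "\<bar>\<psi> i (x i)\<bar> \<le> 1" if "i \<in> B" "x \<in> carrier \<Gamma>" for i x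
    using BZ[OF that(1)] that(2) by (intro \<psi>(3)) auto
  have e4: "P.eigenfunction (\<lambda>x. \<psi> i (x i) * \<psi> k (x k)) (1 - (rate i + rate k))" if "i \<in> B" "k \<in> B" "i \<noteq> k" for i k
    unfolding rate_def by (rule two_coordinate_eigenfunction[OF BZ(2)[OF that(1)] BZ(2)[OF that(2)] that(3)
       \<psi>(1)[OF BZ(1)[OF that(1)]] \<psi>(1)[OF BZ(1)[OF that(2)]]])
  have e5: "1 - (rate i + rate k) \<noteq> 1" if "i \<in> B" "k \<in> B" "i \<noteq> k" for i k
    using BZ(4)[OF that(1)] BZ(4)[OF that(2)] by simp
  have e6: "h (1 - (rate i + rate k)) \<le> h (1 - rate i) * h (1 - rate k)" if "i \<in> B" "k \<in> B" "i \<noteq> k" for i k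
    using BZ that by (intro h2) auto
  have "1 - 8 * card B / ?M\<^sup>2 \<le> tv_to_uniform \<Gamma> (P \<one>\<^bsub>\<Gamma>\<^esub>)"
    by (rule W.tv_ge_chebyshev[of B "\<lambda>i x. \<psi> i (x i)" "\<lambda>i. 1 - rate i" "\<lambda>i k. 1 - (rate i + rate k)"]; (fact B(1) M0 | (rule e1 e2 e4 e5 e6; assumption) | (rule e3; assumption)))
  moreover have "8 * card B / ?M\<^sup>2 \<le> 8 * exp (2 * e) / R.rank x"
  proof -
    have "(card B * exp (- e))\<^sup>2 \<le> ?M\<^sup>2" using M by (intro power_mono) auto
    then have "8 * card B / ?M\<^sup>2 \<le> 8 * card B / (card B * exp (- e))\<^sup>2"
      using c0 M0 by (intro divide_left_mono mult_pos_pos zero_less_power) auto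
    also have "\<dots> = 8 * exp (2 * e) / card B"
    proof -
      have "exp (2 * e) = exp e * exp e" by (simp add: exp_add[symmetric])
      then show ?thesis using c0 by (simp add: power2_eq_square exp_minus field_simps)
    qed
    finally show ?thesis using B by simp
  qed
  ultimately show ?thesis by linarith
qed

lemma heat_lower_one:
  assumes "0 \<le> t" "i \<in> Z" shows "exp (- (2 * rate i * t)) / 2 \<le> d_TV_c \<Gamma> QP t"
proof -
  have "0 \<le> rate i * t" using assms rate_pos by (intro mult_nonneg_nonneg) (auto intro: less_imp_le)
  then have "exp (- (2 * rate i * t)) \<le> exp (t * (1 - rate i - 1))" by (simp add: algebra_simps)
  then show ?thesis
    using kernel_lower_one[OF P.heat_walk_kernel[OF assms(1)] assms(2)] unfolding d_TV_c_def by linarith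
qed

lemma heat_lower_many:
  assumes t: "0 \<le> t" and x: "0 < x" and N: "0 < R.rank x"
  shows "1 - 8 * exp (2 * x * t * (1 + 2 * x)) / R.rank x \<le> d_TV_c \<Gamma> QP t"
proof -
  have "1 - 8 * exp (2 * (x * t * (1 + 2 * x))) / R.rank x \<le> d_TV_c \<Gamma> QP t"
    unfolding d_TV_c_def
  proof (rule kernel_lower_many[OF P.heat_walk_kernel[OF t] N])
    fix b assume b: "0 < b" "b \<le> x"
    have "b \<le> x * (1 + 2 * x)"
    proof -
      have "0 \<le> x * (2 * x)" using x by simp
      then show ?thesis using b unfolding distrib_left by linarith
    qed
    then have "t * b \<le> t * (x * (1 + 2 * x))" using t by (rule mult_left_mono)
    then show "exp (- (x * t * (1 + 2 * x))) \<le> exp (t * (1 - b - 1))" by (simp add: mult_ac)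
  next
    show "exp (t * (1 - (b + b') - 1)) \<le> exp (t * (1 - b - 1)) * exp (t * (1 - b' - 1))" for b b'
      unfolding exp_add[symmetric] by (simp add: algebra_simps)
  qed
  then show ?thesis by (simp add: mult.assoc)
qed

lemma one_minus_power_ge:
  fixes b x :: real
  assumes "0 < b" "b \<le> x" "x \<le> 1 / 2"
  shows "exp (- (x * real m * (1 + 2 * x))) \<le> (1 - b) ^ m"
proof -
  have "- x - 2 * x\<^sup>2 \<le> ln (1 - x)" using assms by (intro ln_one_minus_pos_lower_bound) auto
  then have "exp (- x - 2 * x\<^sup>2) \<le> 1 - x" using assms by (subst (asm) ln_ge_iff) auto
  also have "\<dots> \<le> 1 - b" using assms by simp
  finally have "exp (- x - 2 * x\<^sup>2) ^ m \<le> (1 - b) ^ m" by (intro power_mono) auto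
  then show ?thesis by (simp add: exp_of_nat_mult[symmetric] power2_eq_square algebra_simps)
qed

lemma discrete_lower_one:
  assumes "i \<in> Z" "rate i \<le> 1 / 2"
  shows "exp (- (2 * rate i * real m)) / 2 \<le> d_TV \<Gamma> QP m"
proof -
  have "rate i * real m * (1 + 2 * rate i) \<le> rate i * real m * 2"
    using assms rate_pos[of i] by (intro mult_left_mono) auto
  then have "exp (- (2 * rate i * real m)) \<le> exp (- (rate i * real m * (1 + 2 * rate i)))"
    by simp
  also have "\<dots> \<le> (1 - rate i) ^ m" using assms rate_pos by (intro one_minus_power_ge) auto
  finally show ?thesis
    using kernel_lower_one[OF P.discrete_walk_kernel assms(1), of m] by (simp add: d_TV_def)
qed

lemma discrete_lower_many:
  assumes x: "0 < x" "x \<le> 1 / 2" and N: "0 < R.rank x"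
  shows "1 - 8 * exp (2 * x * real m * (1 + 2 * x)) / R.rank x \<le> d_TV \<Gamma> QP m"
proof -
  have "1 - 8 * exp (2 * (x * real m * (1 + 2 * x))) / R.rank x \<le> d_TV \<Gamma> QP m"
    unfolding d_TV_def
  proof (rule kernel_lower_many[OF P.discrete_walk_kernel N])
    show "exp (- (x * real m * (1 + 2 * x))) \<le> (1 - b) ^ m" if "0 < b" "b \<le> x" for b
      using that x by (intro one_minus_power_ge) auto
  next
    fix b b' assume b: "0 < b" "b \<le> x" "0 < b'" "b' \<le> x"
    have "(1 - (b + b')) ^ m \<le> ((1 - b) * (1 - b')) ^ m"
      using b x by (intro power_mono) (auto simp: algebra_simps)
    then show "(1 - (b + b')) ^ m \<le> (1 - b) ^ m * (1 - b') ^ m" by (simp add: power_mult_distrib)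
  qed
  then show ?thesis by (simp add: mult.assoc)
qed

end

section \<open>Comparison of the critical time with the given sequence\<close>

text \<open>An index shift costs only a constant factor, by Bernoulli's inequality.\<close>

lemma ln_shift_le:
  assumes "1 \<le> n0" "n0 \<le> i"
  shows "ln (real (i + 1)) \<le> real n0 * ln (real (i - n0 + 2))"
proof -
  have "1 + real n0 * (real (i - n0) + 1) \<le> (1 + (real (i - n0) + 1)) ^ n0"
    by (rule Bernoulli_inequality) simp
  moreover have "real (i - n0) \<le> real n0 * real (i - n0)"
    using assms(1) mult_right_mono[of 1 "real n0" "real (i - n0)"] by simp
  ultimately have "real (i + 1) \<le> real (i - n0 + 2) ^ n0"
    using assms by (simp add: algebra_simps of_nat_diff)
  then have "ln (real (i + 1)) \<le> ln (real (i - n0 + 2) ^ n0)" by (subst ln_le_cancel_iff) auto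
  then show ?thesis by (simp add: ln_realpow)
qed

lemma Max_image_ge: "\<lbrakk>finite I; i \<in> I\<rbrakk> \<Longrightarrow> f i \<le> Max (f ` I)" for f :: "'i \<Rightarrow> real"
  by (intro Max_ge) auto

lemma u_increasing_ge: "\<lbrakk>1 \<le> i; i \<le> n\<rbrakk> \<Longrightarrow> ln (real (i + 1)) / l i \<le> u_increasing l n"
  unfolding u_increasing_def by (rule Max_image_ge) auto

lemma u_increasing_le:
  assumes "1 \<le> n" "\<And>i. \<lbrakk>1 \<le> i; i \<le> n\<rbrakk> \<Longrightarrow> ln (real (i + 1)) / l i \<le> c"
  shows "u_increasing l n \<le> c"
  unfolding u_increasing_def using assms by (intro Max.boundedI) auto

lemma u_decreasing_ge: "\<lbrakk>1 \<le> k; k \<le> n\<rbrakk> \<Longrightarrow> ln (real (n - k + 2)) / l k \<le> u_decreasing l n"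
proof -
  assume k: "1 \<le> k" "k \<le> n"
  have "ln (real ((n - k + 1) + 1)) / l (n - (n - k + 1) + 1) \<le> u_decreasing l n"
    unfolding u_decreasing_def using k
    by (intro Max_image_ge[of _ _ "\<lambda>i. ln (real (i + 1)) / l (n - i + 1)"]) auto
  moreover have "n - (n - k + 1) + 1 = k" using k by simp
  ultimately show ?thesis by simp
qed

lemma u_decreasing_le:
  assumes "1 \<le> n" "\<And>k. \<lbrakk>1 \<le> k; k \<le> n\<rbrakk> \<Longrightarrow> ln (real (n - k + 2)) / l k \<le> c"
  shows "u_decreasing l n \<le> c"
proof -
  have "ln (real (i + 1)) / l (n - i + 1) \<le> c" if "1 \<le> i" "i \<le> n" for i
    using assms(2)[of "n - i + 1"] that by simp
  then show ?thesis unfolding u_decreasing_def using assms(1) by (intro Max.boundedI) auto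
qed

text \<open>The rates agree with \<open>l i / q\<close> up to the factor \<open>\<kappa>\<close>; indices below \<open>n0\<close> may be missing from \<open>S\<close>,
  because finitely many of the factors may be trivial.\<close>

locale comparable_rates = rates S b for S :: "nat set" and b +
  fixes l :: "nat \<Rightarrow> real" and \<kappa> q :: real and n n0 :: nat
  assumes S: "S \<subseteq> {1..n}" "{n0..n} \<subseteq> S" and n0: "1 \<le> n0" "n0 \<le> n"
    and l_pos: "1 \<le> i \<Longrightarrow> 0 < l i" and q: "0 < q" and \<kappa>: "0 < \<kappa>"
    and comparable: "i \<in> S \<Longrightarrow> l i / (\<kappa> * q) \<le> b i" "i \<in> S \<Longrightarrow> b i \<le> \<kappa> * l i / q"
begin

lemma ln_card_le:
  assumes B: "B \<subseteq> S" "B \<noteq> {}" and le: "\<And>j. j \<in> B \<Longrightarrow> l j \<le> L"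
  shows "ln (1 + real (card B)) \<le> 2 * (\<kappa> * L / q) * critical"
proof -
  have fB: "finite B" using B(1) fin finite_subset by blast
  then have "Max (b ` B) \<in> b ` B" using B(2) by (intro Max_in) auto
  then obtain j where j: "j \<in> B" and bj: "b j = Max (b ` B)" by auto
  have "b k \<le> b j" if "k \<in> B" for k using that fB by (simp add: bj)
  then have "card B \<le> rank (b j)" unfolding rank_def using B(1) fin by (intro card_mono) auto
  then have "ln (1 + real (card B)) \<le> ln (1 + rank (b j))" by (subst ln_le_cancel_iff) auto
  also have "\<dots> \<le> 2 * b j * critical" using rank_le[of j] j B(1) by auto
  also have "\<dots> \<le> 2 * (\<kappa> * L / q) * critical"
  proof -
    have "b j \<le> \<kappa> * l j / q" using comparable(2) j B(1) by auto
    also have "\<dots> \<le> \<kappa> * L / q" using le[OF j] \<kappa> q by (intro divide_right_mono mult_left_mono) auto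
    finally show ?thesis using critical_pos by (intro mult_right_mono) auto
  qed
  finally show ?thesis .
qed

text \<open>Apply the assumption to the set \<open>R\<close> of all rates up to the one at which the maximum in \<open>critical\<close> is
  attained.\<close>

lemma critical_le:
  assumes "\<And>R. \<lbrakk>R \<subseteq> S; R \<noteq> {}\<rbrakk> \<Longrightarrow> \<exists>m\<in>R. ln (1 + real (card R)) / l m \<le> u"
  shows "critical \<le> \<kappa> / 2 * (u * q)"
proof -
  obtain i where i: "i \<in> S" "ln (1 + rank (b i)) = 2 * b i * critical" by (rule critical_attained)
  define R where "R = {k \<in> S. b k \<le> b i}"
  have R: "R \<subseteq> S" "R \<noteq> {}" "rank (b i) = card R" using i(1) by (auto simp: R_def rank_def)
  then obtain m where m: "m \<in> R" "ln (1 + real (card R)) / l m \<le> u" using assms by blast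
  then have mS: "m \<in> S" "b m \<le> b i" "1 \<le> m" using S by (auto simp: R_def)
  have lm: "0 < l m" using l_pos mS by blast
  have "2 * (l m / (\<kappa> * q)) * critical \<le> 2 * b i * critical"
    using comparable(1)[OF mS(1)] mS(2) critical_pos by (intro mult_right_mono) auto
  also have "\<dots> \<le> u * l m" using m(2) i(2) R(3) lm by (simp add: field_simps)
  finally show ?thesis using lm \<kappa> q by (simp add: field_simps)
qed

text \<open>When \<open>l\<close> increases, the indices up to \<open>i\<close> have rates of order at most \<open>l i / q\<close>, and conversely a set
  of \<open>i\<close> indices has an element \<open>m \<ge> i\<close>, whose rate is of order at least \<open>l m / q\<close>. So the maximum over ranks in
  \<open>critical\<close> and the maximum over indices in \<open>u_increasing\<close> bound each other.\<close>

lemma increasing_comparison: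
  assumes incr: "\<And>i j. \<lbrakk>1 \<le> i; i \<le> j\<rbrakk> \<Longrightarrow> l i \<le> l j"
  shows "critical \<le> \<kappa> / 2 * (u_increasing l n * q)"
    and "u_increasing l n * q \<le> (2 * \<kappa> * n0 + 2 * \<kappa> * l n0 * ln (real (n0 + 1)) / (l 1 * ln 2)) * critical"
    and "l 1 / (\<kappa> * q) \<le> slowest" "slowest \<le> \<kappa> * l n0 / q"
proof -
  show "critical \<le> \<kappa> / 2 * (u_increasing l n * q)"
  proof (rule critical_le)
    fix R assume R: "R \<subseteq> S" "R \<noteq> {}"
    then have fR: "finite R" using fin finite_subset by blast
    define m where "m = Max R"
    have m: "m \<in> R" "R \<subseteq> {1..m}" using fR R S by (auto simp: m_def)
    then have "card R \<le> m" using card_mono[of "{1..m}" R] by simp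
    have m1: "1 \<le> m" "m \<le> n" using m(1) R S by auto
    have "ln (1 + real (card R)) / l m \<le> ln (real (m + 1)) / l m"
      using \<open>card R \<le> m\<close> l_pos[OF m1(1)] by (intro divide_right_mono) auto
    also have "\<dots> \<le> u_increasing l n" by (rule u_increasing_ge[OF m1])
    finally show "\<exists>m\<in>R. ln (1 + real (card R)) / l m \<le> u_increasing l n" using m(1) by blast
  qed
  let ?C = "2 * \<kappa> * n0 + 2 * \<kappa> * l n0 * ln (real (n0 + 1)) / (l 1 * ln 2)"
  have l1: "0 < l 1" and ln0: "0 < l n0" using l_pos n0 by auto
  have late: "ln (real (i - n0 + 2)) * q \<le> 2 * \<kappa> * l i * critical" if i: "n0 \<le> i" "i \<le> n" for i
  proof -
    have "ln (1 + real (card {n0..i})) \<le> 2 * (\<kappa> * l i / q) * critical"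
      using i S n0 by (intro ln_card_le incr) auto
    moreover have "1 + real (card {n0..i}) = real (i - n0 + 2)" using i by simp
    ultimately show ?thesis using q by (simp add: field_simps)
  qed
  have "u_increasing l n \<le> ?C * critical / q"
  proof (rule u_increasing_le)
    fix i assume i: "1 \<le> i" "i \<le> n"
    have li: "0 < l i" using l_pos i by blast
    show "ln (real (i + 1)) / l i \<le> ?C * critical / q"
    proof (cases "n0 \<le> i")
      case True
      have "ln (real (i + 1)) * q \<le> n0 * ln (real (i - n0 + 2)) * q"
        using ln_shift_le[OF n0(1) True] q by (intro mult_right_mono) auto
      also have "\<dots> \<le> n0 * (2 * \<kappa> * l i * critical)"
        using late[OF True i(2)] by (simp add: mult.assoc mult_left_mono)
      finally have "ln (real (i + 1)) / l i \<le> 2 * \<kappa> * n0 * critical / q"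
        using li q by (simp add: field_simps)
      also have "\<dots> \<le> ?C * critical / q"
        using critical_pos q \<kappa> l1 ln0 by (intro divide_right_mono mult_right_mono) auto
      finally show ?thesis .
    next
      case False
      have "ln (real (i + 1)) / l i \<le> ln (real (n0 + 1)) / l 1"
        using False i incr[of 1 i] l1 by (intro frac_le) auto
      also have "\<dots> \<le> ln (real (n0 + 1)) / l 1 * (2 * \<kappa> * l n0 * critical / (q * ln 2))"
      proof -
        have "ln 2 * q \<le> 2 * \<kappa> * l n0 * critical" using late[of n0] n0 by simp
        then have "1 \<le> 2 * \<kappa> * l n0 * critical / (q * ln 2)" using q by (simp add: field_simps)
        then have "ln (real (n0 + 1)) / l 1 * 1 \<le> ln (real (n0 + 1)) / l 1 * (2 * \<kappa> * l n0 * critical / (q * ln 2))"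
          using l1 by (intro mult_left_mono) auto
        then show ?thesis by simp
      qed
      also have "\<dots> = 2 * \<kappa> * l n0 * ln (real (n0 + 1)) / (l 1 * ln 2) * critical / q"
        by (simp add: mult_ac)
      also have "\<dots> \<le> ?C * critical / q"
        using critical_pos q \<kappa> by (intro divide_right_mono mult_right_mono) auto
      finally show ?thesis .
    qed
  qed (use n0 in simp)
  then show "u_increasing l n * q \<le> ?C * critical" using q by (simp add: field_simps)
  obtain i where i: "i \<in> S" "b i = slowest" by (rule slowest_in)
  have "l 1 / (\<kappa> * q) \<le> l i / (\<kappa> * q)" using i S incr[of 1 i] \<kappa> q by (intro divide_right_mono) auto
  then show "l 1 / (\<kappa> * q) \<le> slowest" using comparable(1)[OF i(1)] i(2) by simp
  show "slowest \<le> \<kappa> * l n0 / q" using slowest_le[of n0] comparable(2)[of n0] S n0 by fastforce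
qed

text \<open>When \<open>l\<close> decreases, the role of \<open>{n0..i}\<close> is played by \<open>{k..n}\<close>; now the slowest rate belongs to the
  last index, and thus is of order \<open>l n / q\<close>.\<close>

lemma decreasing_comparison:
  assumes decr: "\<And>i j. \<lbrakk>1 \<le> i; i \<le> j\<rbrakk> \<Longrightarrow> l j \<le> l i"
  shows "critical \<le> \<kappa> / 2 * (u_decreasing l n * q)"
    and "u_decreasing l n * q \<le> 2 * \<kappa> * n0 * critical"
    and "l n / (\<kappa> * q) \<le> slowest" "slowest \<le> \<kappa> * l n / q"
proof -
  show "critical \<le> \<kappa> / 2 * (u_decreasing l n * q)"
  proof (rule critical_le)
    fix R assume R: "R \<subseteq> S" "R \<noteq> {}"
    then have fR: "finite R" using fin finite_subset by blast
    define m where "m = Min R"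
    have m: "m \<in> R" "R \<subseteq> {m..n}" using fR R S by (auto simp: m_def)
    have m1: "1 \<le> m" "m \<le> n" using m(1) R S by auto
    have "card R \<le> n - m + 1" using card_mono[OF _ m(2)] m1 by simp
    then have "ln (1 + real (card R)) \<le> ln (real (n - m + 2))" by (subst ln_le_cancel_iff) auto
    then have "ln (1 + real (card R)) / l m \<le> ln (real (n - m + 2)) / l m"
      using l_pos[OF m1(1)] by (intro divide_right_mono) auto
    also have "\<dots> \<le> u_decreasing l n" by (rule u_decreasing_ge[OF m1])
    finally show "\<exists>m\<in>R. ln (1 + real (card R)) / l m \<le> u_decreasing l n" using m(1) by blast
  qed
  have late: "ln (real (n - k + 2)) * q \<le> 2 * \<kappa> * l k * critical" if k: "n0 \<le> k" "k \<le> n" for k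
  proof -
    have "ln (1 + real (card {k..n})) \<le> 2 * (\<kappa> * l k / q) * critical"
      using k S n0 by (intro ln_card_le decr) auto
    moreover have "1 + real (card {k..n}) = real (n - k + 2)" using k by simp
    ultimately show ?thesis using q by (simp add: field_simps)
  qed
  have "u_decreasing l n \<le> 2 * \<kappa> * n0 * critical / q"
  proof (rule u_decreasing_le)
    fix k assume k: "1 \<le> k" "k \<le> n"
    define k' where "k' = max k n0"
    have k': "n0 \<le> k'" "k' \<le> n" "1 \<le> k'" "l k' \<le> l k" "0 < l k'" using k n0 decr[of k k'] l_pos by (auto simp: k'_def)
    have "ln (real (n - k + 2)) \<le> n0 * ln (real (n - k' + 2))"
    proof (cases "n0 \<le> k")
      case True
      have "1 * ln (real (n - k' + 2)) \<le> n0 * ln (real (n - k' + 2))" using n0 by (intro mult_right_mono) auto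
      then show ?thesis using True by (simp add: k'_def)
    next
      case False
      have "ln (real (n - k + 2)) \<le> ln (real (n + 1))" using k by (subst ln_le_cancel_iff) auto
      also have "\<dots> \<le> n0 * ln (real (n - n0 + 2))" by (rule ln_shift_le[OF n0])
      finally show ?thesis using False by (simp add: k'_def)
    qed
    then have "ln (real (n - k + 2)) * q \<le> n0 * ln (real (n - k' + 2)) * q" using q by (intro mult_right_mono) auto
    also have "\<dots> \<le> n0 * (2 * \<kappa> * l k' * critical)"
      using late[OF k'(1,2)] by (simp add: mult.assoc mult_left_mono)
    also have "\<dots> \<le> n0 * (2 * \<kappa> * l k * critical)"
      using k'(4) \<kappa> critical_pos by (intro mult_left_mono mult_right_mono) auto
    finally show "ln (real (n - k + 2)) / l k \<le> 2 * \<kappa> * n0 * critical / q"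
      using l_pos[OF k(1)] q by (simp add: field_simps)
  qed (use n0 in simp)
  then show "u_decreasing l n * q \<le> 2 * \<kappa> * n0 * critical" using q by (simp add: field_simps)
  obtain i where i: "i \<in> S" "b i = slowest" by (rule slowest_in)
  have "l n / (\<kappa> * q) \<le> l i / (\<kappa> * q)" using i S decr[of i n] \<kappa> q by (intro divide_right_mono) auto
  then show "l n / (\<kappa> * q) \<le> slowest" using comparable(1)[OF i(1)] i(2) by simp
  show "slowest \<le> \<kappa> * l n / q" using slowest_le[of n] comparable(2)[of n] S n0 by fastforce
qed

end

lemma filterlim_at_top_comparable:
  fixes f g :: "nat \<Rightarrow> real"
  assumes "0 < c" "0 < c'" "\<forall>\<^sub>F n in sequentially. f n \<le> c * g n" "\<forall>\<^sub>F n in sequentially. g n \<le> c' * f n"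
  shows "filterlim f at_top sequentially \<longleftrightarrow> filterlim g at_top sequentially"
proof
  assume "filterlim f at_top sequentially"
  then have "filterlim (\<lambda>n. c * g n) at_top sequentially" using assms(3) by (rule filterlim_at_top_mono)
  then show "filterlim g at_top sequentially"
    using filterlim_tendsto_pos_mult_at_top_iff[OF tendsto_const assms(1)] by blast
next
  assume "filterlim g at_top sequentially"
  then have "filterlim (\<lambda>n. c' * f n) at_top sequentially" using assms(4) by (rule filterlim_at_top_mono)
  then show "filterlim f at_top sequentially"
    using filterlim_tendsto_pos_mult_at_top_iff[OF tendsto_const assms(2)] by blast
qed

lemma same_order_trans_eventually:
  fixes t \<theta> v :: "nat \<Rightarrow> real"
  assumes "\<forall>\<^sub>F n in sequentially. \<theta> n / 8 \<le> t n \<and> t n \<le> 6 * \<theta> n"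
    and "\<forall>\<^sub>F n in sequentially. \<theta> n \<le> c * v n" "\<forall>\<^sub>F n in sequentially. v n \<le> c' * \<theta> n"
    and "\<forall>\<^sub>F n in sequentially. 0 < \<theta> n" "0 < c" "0 < c'"
  shows "same_order t v"
  unfolding same_order_def
proof
  show "Bseq (\<lambda>n. t n / v n)"
  proof (rule BfunI)
    show "\<forall>\<^sub>F n in sequentially. norm (t n / v n) \<le> 6 * c"
      using assms(1,2,4)
    proof eventually_elim
      case (elim n)
      then have "0 < v n" using assms(5) by (smt (verit) zero_less_mult_pos)
      moreover have "t n \<le> 6 * c * v n" "0 \<le> t n" using elim by (auto simp: mult.assoc)
      ultimately show ?case by (simp add: divide_le_eq)
    qed
  qed
  show "Bseq (\<lambda>n. v n / t n)"
  proof (rule BfunI)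
    show "\<forall>\<^sub>F n in sequentially. norm (v n / t n) \<le> 8 * c'"
      using assms(1,2,3,4)
    proof eventually_elim
      case (elim n)
      then have "0 < v n" using assms(5) by (smt (verit) zero_less_mult_pos)
      moreover have "0 < t n" using elim by linarith
      moreover have "c' * \<theta> n \<le> c' * (8 * t n)"
        using elim assms(6) by (intro mult_left_mono) auto
      then have "v n \<le> c' * (8 * t n)" using elim by linarith
      ultimately show ?case by (simp add: divide_le_eq)
    qed
  qed
qed

section \<open>Cutoff for families of products\<close>

context sym_walk
begin

lemma closed_mixed: "closed {t. d_TV_c G Q t \<le> \<epsilon>}"
proof -
  have "{t. d_TV_c G Q t \<le> \<epsilon>} = (\<Inter>F\<in>Pow (carrier G).
      {t. (\<Sum>y\<in>F. heat_kernel G Q t \<one> y) - measure_pmf.prob (pmf_of_set (carrier G)) F \<le> \<epsilon>})"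
    unfolding d_TV_c_def tv_to_uniform_def using fin by (subst Max_le_iff) auto
  moreover have "closed {t. (\<Sum>y\<in>F. heat_kernel G Q t \<one> y) - measure_pmf.prob (pmf_of_set (carrier G)) F \<le> \<epsilon>}"
    if "F \<subseteq> carrier G" for F
    using that by (intro closed_Collect_le continuous_intros continuous_heat_kernel) auto
  ultimately show ?thesis by (auto intro!: closed_INT)
qed

text \<open>In continuous time the least element in the definition of the mixing time exists because the
  distance is continuous.\<close>

lemma heat_mixing_time:
  assumes t: "0 \<le> t" "d_TV_c G Q t \<le> \<epsilon>"
  shows "0 \<le> T_TV_c G Q \<epsilon>" "d_TV_c G Q (T_TV_c G Q \<epsilon>) \<le> \<epsilon>" "T_TV_c G Q \<epsilon> \<le> t"
proof -
  let ?A = "{0..t} \<inter> {t. d_TV_c G Q t \<le> \<epsilon>}"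
  have "compact ?A" by (intro compact_Int_closed closed_mixed) auto
  moreover have "?A \<noteq> {}" using t by auto
  ultimately obtain s where s: "s \<in> ?A" "\<forall>u\<in>?A. s \<le> u"
    by (elim compact_attains_inf[elim_format] bexE)
  have "T_TV_c G Q \<epsilon> = s"
    unfolding T_TV_c_def
  proof (rule Least_equality)
    fix y assume y: "0 \<le> y \<and> d_TV_c G Q y \<le> \<epsilon>"
    show "s \<le> y"
    proof (cases "y \<le> t")
      case True then show ?thesis using s(2) y by auto
    next
      case False then show ?thesis using s(1) by auto
    qed
  qed (use s in auto)
  then show "0 \<le> T_TV_c G Q \<epsilon>" "d_TV_c G Q (T_TV_c G Q \<epsilon>) \<le> \<epsilon>" "T_TV_c G Q \<epsilon> \<le> t"
    using s(1) by auto
qed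

end

locale product_family =
  fixes G :: "nat \<Rightarrow> ('a, 'b) monoid_scheme" and Q :: "nat \<Rightarrow> 'a pmf"
    and p l :: "nat \<Rightarrow> real" and \<eta> A :: real and D :: nat and \<rho> :: "nat \<Rightarrow> nat" and \<kappa> :: real and n0 :: nat
  assumes growth: "1 \<le> i \<Longrightarrow> growth_walk (G i) (Q i) \<eta> A D (\<rho> i)"
    and p_pos: "1 \<le> i \<Longrightarrow> 0 < p i" and l_pos: "1 \<le> i \<Longrightarrow> 0 < l i"
    and n0: "1 \<le> n0" and nontrivial: "n0 \<le> i \<Longrightarrow> 1 < card (carrier (G i))"
    and \<kappa>: "0 < \<kappa>"
    and order: "1 \<le> i \<Longrightarrow> l i / \<kappa> \<le> p i / (real (\<rho> i))\<^sup>2" "1 \<le> i \<Longrightarrow> p i / (real (\<rho> i))\<^sup>2 \<le> \<kappa> * l i"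
begin

abbreviation "PG \<equiv> prod_family_group G"
abbreviation "PQ \<equiv> prod_family_prob G Q p"
abbreviation "q \<equiv> partial_sum p"

definition Z :: "nat \<Rightarrow> nat set" where "Z n = {i \<in> {1..n}. 1 < card (carrier (G i))}"
definition \<gamma> :: "nat \<Rightarrow> real" where
  "\<gamma> i = (SOME c. growth_walk.spectral_scale (G i) (Q i) \<eta> A D (\<rho> i) c)"
definition b :: "nat \<Rightarrow> nat \<Rightarrow> real" where "b n = growth_product.rate (weight_pmf p n) \<gamma>"

lemma scale: "\<lbrakk>1 \<le> i; 1 < card (carrier (G i))\<rbrakk> \<Longrightarrow> growth_walk.spectral_scale (G i) (Q i) \<eta> A D (\<rho> i) (\<gamma> i)"
  unfolding \<gamma>_def by (rule someI_ex) (rule growth_walk.spectral_scale_exists[OF growth])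

lemma walk: "1 \<le> i \<Longrightarrow> sym_walk (G i) (Q i)"
  using growth by (simp add: growth_walk_def)

lemma q_pos: "1 \<le> n \<Longrightarrow> 0 < q n"
  unfolding partial_sum_def using p_pos by (intro sum_pos) auto

lemma weight: "\<lbrakk>1 \<le> n; i \<in> {1..n}\<rbrakk> \<Longrightarrow> pmf (weight_pmf p n) i = p i / q n"
  using p_pos by (subst pmf_weight_pmf) auto

lemma product_walk: assumes n: "1 \<le> n" shows "product_walk {1..n} (weight_pmf p n) G Q"
proof (rule product_walk.intro)
  show "set_pmf (weight_pmf p n) \<subseteq> {1..n}"
    using pmf_weight_pmf[OF p_pos n] by (auto simp: set_pmf_eq split: if_splits)
qed (use walk in auto)

lemma sym_walk: "1 \<le> n \<Longrightarrow> sym_walk (PG n) (PQ n)"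
  unfolding prod_family_group_def prod_family_prob_def
  by (rule product_walk.product_sym_walk[OF product_walk])

lemma Z_props: assumes n: "n0 \<le> n" shows "Z n \<subseteq> {1..n}" "{n0..n} \<subseteq> Z n" "Z n \<noteq> {}"
proof -
  show "Z n \<subseteq> {1..n}" and *: "{n0..n} \<subseteq> Z n" using nontrivial n0 by (auto simp: Z_def)
  have "n0 \<in> Z n" using * n by auto
  then show "Z n \<noteq> {}" by auto
qed

lemma growth_product:
  assumes n: "n0 \<le> n" shows "growth_product {1..n} (weight_pmf p n) G Q \<eta> A D \<rho> (Z n) \<gamma>"
proof -
  have n1: "1 \<le> n" using n n0 by simp
  have "card (carrier (G i)) = 1" if "i \<in> {1..n} - Z n" for i
  proof -
    have i: "1 \<le> i" "\<not> 1 < card (carrier (G i))" using that by (auto simp: Z_def)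
    have "0 < card (carrier (G i))"
      using walk[OF i(1)] fin_walk.card_pos by (auto simp: sym_walk_def)
    then show ?thesis using i(2) by simp
  qed
  moreover have "growth_walk.spectral_scale (G i) (Q i) \<eta> A D (\<rho> i) (\<gamma> i)" if "i \<in> Z n" for i
    using that by (intro scale) (auto simp: Z_def)
  moreover have "0 < pmf (weight_pmf p n) i" if "i \<in> Z n" for i
    using that Z_props(1)[OF n] weight[OF n1, of i] p_pos[of i] q_pos[OF n1] by auto
  ultimately show ?thesis
    using product_walk[OF n1] Z_props[OF n] growth
    by (simp add: growth_product_def growth_product_axioms_def)
qed

lemma comparable:
  assumes n: "n0 \<le> n"
  shows "comparable_rates (Z n) (b n) l (\<kappa> * (1 / \<eta> + gap_const A D)) (q n) n n0"
proof -
  interpret P: growth_product "{1..n}" "weight_pmf p n" G Q \<eta> A D \<rho> "Z n" \<gamma> by (rule growth_product[OF n])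
  have n1: "1 \<le> n" using n n0 by simp
  let ?k = "1 / \<eta> + gap_const A D"
  have k: "1 / \<eta> \<le> ?k" "gap_const A D \<le> ?k" "0 < ?k" using P.K_pos P.\<eta>_pos by (auto simp: add_pos_pos)
  have q: "0 < q n" by (rule q_pos[OF n1])
  have bounds: "l i / (\<kappa> * ?k * q n) \<le> b n i" "b n i \<le> \<kappa> * ?k * l i / q n" if i: "i \<in> Z n" for i
  proof -
    have i1: "i \<in> {1..n}" "1 \<le> i" using i Z_props(1)[OF n] by auto
    have b_eq: "b n i = p i / q n * \<gamma> i" by (simp add: b_def P.rate_def weight[OF n1 i1(1)])
    note pi = p_pos[OF i1(2)] and li = l_pos[OF i1(2)]
    have \<rho>: "0 < (real (\<rho> i))\<^sup>2" using P.\<rho>_pos[OF i1(1)] by simp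
    have "p i / (real (\<rho> i))\<^sup>2 / ?k \<le> p i / (real (\<rho> i))\<^sup>2 * \<eta>"
    proof -
      have "1 \<le> \<eta> * ?k" using k(1) P.\<eta>_pos by (simp add: field_simps)
      then have "p i / (real (\<rho> i))\<^sup>2 * 1 \<le> p i / (real (\<rho> i))\<^sup>2 * (\<eta> * ?k)" using pi by (intro mult_left_mono) auto
      then show ?thesis by (subst pos_divide_le_eq[OF k(3)]) (simp only: mult.assoc mult_1_right)
    qed
    also have "\<dots> \<le> p i * \<gamma> i"
      using mult_left_mono[OF P.scaleD(3)[OF i], of "p i"] pi by (simp add: mult.commute)
    finally have low: "p i / (real (\<rho> i))\<^sup>2 / ?k \<le> p i * \<gamma> i" .
    have "l i / \<kappa> / ?k \<le> p i / (real (\<rho> i))\<^sup>2 / ?k" using order(1)[OF i1(2)] k(3) by (intro divide_right_mono) auto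
    also note low
    finally have "l i / \<kappa> / ?k / q n \<le> p i * \<gamma> i / q n" using q by (intro divide_right_mono) auto
    then show "l i / (\<kappa> * ?k * q n) \<le> b n i" by (simp add: b_eq divide_divide_eq_left mult.assoc)
    have "p i * \<gamma> i \<le> p i * (gap_const A D / (real (\<rho> i))\<^sup>2)"
      using P.scaleD(4)[OF i] pi by (intro mult_left_mono) auto
    also have "\<dots> = p i / (real (\<rho> i))\<^sup>2 * gap_const A D" by simp
    also have "\<dots> \<le> (\<kappa> * l i) * ?k"
      using order(2)[OF i1(2)] k P.K_pos \<kappa> li by (intro mult_mono) auto
    finally have "p i * \<gamma> i / q n \<le> \<kappa> * l i * ?k / q n" using q by (intro divide_right_mono) auto
    then show "b n i \<le> \<kappa> * ?k * l i / q n" by (simp add: b_eq mult_ac)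
  qed
  have "0 < \<kappa> * ?k" using \<kappa> k(3) by (rule mult_pos_pos)
  then show ?thesis
    using P.R.rates_axioms Z_props[OF n] n0 n l_pos q bounds
    by (simp add: comparable_rates_def comparable_rates_axioms_def b_def)
qed

lemma lazy_growth: "\<lbrakk>1 \<le> i; \<one>\<^bsub>G i\<^esub> \<in> set_pmf (Q i)\<rbrakk> \<Longrightarrow> \<eta> \<le> pmf (Q i) \<one>\<^bsub>G i\<^esub>"
  by (rule growth_walk.\<eta>(2)[OF growth])

lemma eventually_n0: "\<forall>\<^sub>F n in sequentially. n0 \<le> n"
  by (rule eventually_ge_at_top)

lemma Z_card: "filterlim (\<lambda>n. card (Z n)) at_top sequentially"
proof (rule filterlim_at_top_mono)
  show "filterlim (\<lambda>n. n - n0) at_top sequentially" by (rule filterlim_minus_const_nat_at_top)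
  show "\<forall>\<^sub>F n in sequentially. n - n0 \<le> card (Z n)"
    using eventually_n0
  proof eventually_elim
    case (elim n)
    have "card {n0..n} \<le> card (Z n)"
      using Z_props[OF elim] by (intro card_mono) (auto intro: finite_subset)
    then show ?case by simp
  qed
qed

lemma const_pos: "0 < \<eta>" "0 < heat_const \<eta> A D"
  using growth_walk.\<eta>(1) growth_walk.heat_const_pos growth[of 1] by blast+

lemma rates: "\<forall>\<^sub>F n in sequentially. rates (Z n) (b n)"
  using eventually_n0 by eventually_elim (use growth_product.rates_Z[OF growth_product] in \<open>simp add: b_def\<close>)

lemma total_rate: "\<forall>\<^sub>F n in sequentially. (\<Sum>i\<in>Z n. b n i) \<le> 2"
  using eventually_n0 by eventually_elim (use growth_product.total_rate[OF growth_product] in \<open>simp add: b_def\<close>)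

lemma heat_profile:
  "cutoff_profile Z b (\<lambda>n. d_TV_c (PG n) (PQ n)) {0..} (\<lambda>n. T_TV_c (PG n) (PQ n))
     (heat_const \<eta> A D) (\<eta> / 4) (growth_product.threshold \<eta> A D)"
proof
  show "\<forall>\<^sub>F n in sequentially. rates (Z n) (b n)" by (rule rates)
  show "\<forall>\<^sub>F n in sequentially. (\<Sum>i\<in>Z n. b n i) \<le> 2" by (rule total_rate)
  show "filterlim (\<lambda>n. card (Z n)) at_top sequentially" by (rule Z_card)
  show "0 < heat_const \<eta> A D" "0 < \<eta> / 4" using const_pos by auto
  show "\<exists>s\<in>{0..}. t \<le> s \<and> s \<le> t + 1" if "0 \<le> t" for t :: real
    using that by (intro bexI[of _ t]) auto
  show "\<forall>\<^sub>F n in sequentially. \<forall>t\<in>{0..}. (\<forall>i\<in>Z n. growth_product.threshold \<eta> A D \<le> b n i * t) \<longrightarrow>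
      (d_TV_c (PG n) (PQ n) t)\<^sup>2 \<le> exp (heat_const \<eta> A D * (\<Sum>i\<in>Z n. exp (- (2 * b n i * t)))) - 1
        + exp (- (\<eta> / 4 * (rates.slowest (Z n) (b n) * t)))"
    using eventually_n0
  proof eventually_elim
    case (elim n)
    interpret P: growth_product "{1..n}" "weight_pmf p n" G Q \<eta> A D \<rho> "Z n" \<gamma> by (rule growth_product[OF elim])
    show ?case
      using P.heat_upper unfolding prod_family_group_def prod_family_prob_def b_def
      by (smt (verit) atLeast_iff exp_ge_zero)
  qed
  show "\<forall>\<^sub>F n in sequentially. \<forall>t\<in>{0..}. \<forall>i\<in>Z n. b n i \<le> 1 / 2 \<longrightarrow>
      exp (- (2 * b n i * t)) / 2 \<le> d_TV_c (PG n) (PQ n) t"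
    using eventually_n0
  proof eventually_elim
    case (elim n)
    interpret P: growth_product "{1..n}" "weight_pmf p n" G Q \<eta> A D \<rho> "Z n" \<gamma> by (rule growth_product[OF elim])
    show ?case
      using P.heat_lower_one unfolding prod_family_group_def prod_family_prob_def b_def by simp
  qed
  show "\<forall>\<^sub>F n in sequentially. \<forall>t\<in>{0..}. \<forall>x. 0 < x \<and> x \<le> 1 / 2 \<and> 0 < rates.rank (Z n) (b n) x \<longrightarrow>
      1 - 8 * exp (2 * x * t * (1 + 2 * x)) / rates.rank (Z n) (b n) x \<le> d_TV_c (PG n) (PQ n) t"
    using eventually_n0
  proof eventually_elim
    case (elim n)
    interpret P: growth_product "{1..n}" "weight_pmf p n" G Q \<eta> A D \<rho> "Z n" \<gamma> by (rule growth_product[OF elim])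
    show ?case
      using P.heat_lower_many unfolding prod_family_group_def prod_family_prob_def b_def by auto
  qed
next
  fix \<epsilon> t :: real and n :: nat
  assume *: "1 \<le> n" "t \<in> {0..}" "d_TV_c (PG n) (PQ n) t \<le> \<epsilon>"
  interpret W: sym_walk "PG n" "PQ n" by (rule sym_walk[OF *(1)])
  show "T_TV_c (PG n) (PQ n) \<epsilon> \<in> {0..} \<and> d_TV_c (PG n) (PQ n) (T_TV_c (PG n) (PQ n) \<epsilon>) \<le> \<epsilon>"
    "T_TV_c (PG n) (PQ n) \<epsilon> \<le> t"
    using W.heat_mixing_time[of t \<epsilon>] * by auto
qed auto

lemma discrete_profile:
  assumes lazy: "\<And>i. 1 \<le> i \<Longrightarrow> \<one>\<^bsub>G i\<^esub> \<in> set_pmf (Q i)"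
  shows "cutoff_profile Z b (\<lambda>n t. d_TV (PG n) (PQ n) (nat \<lfloor>t\<rfloor>)) (range real) (\<lambda>n \<epsilon>. real (T_TV (PG n) (PQ n) \<epsilon>))
     (heat_const \<eta> A D) (\<eta> / 4) (growth_product.threshold \<eta> A D)"
proof
  show "\<forall>\<^sub>F n in sequentially. rates (Z n) (b n)" by (rule rates)
  show "\<forall>\<^sub>F n in sequentially. (\<Sum>i\<in>Z n. b n i) \<le> 2" by (rule total_rate)
  show "filterlim (\<lambda>n. card (Z n)) at_top sequentially" by (rule Z_card)
  show "0 < heat_const \<eta> A D" "0 < \<eta> / 4" using const_pos by auto
  show "\<exists>s\<in>range real. t \<le> s \<and> s \<le> t + 1" if "0 \<le> t" for t :: real
  proof (rule bexI)
    have "real (nat \<lceil>t\<rceil>) = of_int \<lceil>t\<rceil>" using that by simp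
    then show "t \<le> real (nat \<lceil>t\<rceil>) \<and> real (nat \<lceil>t\<rceil>) \<le> t + 1" using ceiling_correct[of t] by linarith
  qed (rule rangeI)
  show "\<forall>\<^sub>F n in sequentially. \<forall>t\<in>range real. (\<forall>i\<in>Z n. growth_product.threshold \<eta> A D \<le> b n i * t) \<longrightarrow>
      (d_TV (PG n) (PQ n) (nat \<lfloor>t\<rfloor>))\<^sup>2 \<le> exp (heat_const \<eta> A D * (\<Sum>i\<in>Z n. exp (- (2 * b n i * t)))) - 1
        + exp (- (\<eta> / 4 * (rates.slowest (Z n) (b n) * t)))"
    using eventually_n0
  proof eventually_elim
    case (elim n)
    interpret P: growth_product "{1..n}" "weight_pmf p n" G Q \<eta> A D \<rho> "Z n" \<gamma> by (rule growth_product[OF elim])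
    have lz: "\<eta> \<le> pmf (Q i) \<one>\<^bsub>G i\<^esub>" if "i \<in> {1..n}" for i using that by (intro lazy_growth lazy) auto
    show ?case
      using P.discrete_upper[OF lz] unfolding prod_family_group_def prod_family_prob_def b_def by auto
  qed
  show "\<forall>\<^sub>F n in sequentially. \<forall>t\<in>range real. \<forall>i\<in>Z n. b n i \<le> 1 / 2 \<longrightarrow>
      exp (- (2 * b n i * t)) / 2 \<le> d_TV (PG n) (PQ n) (nat \<lfloor>t\<rfloor>)"
    using eventually_n0
  proof eventually_elim
    case (elim n)
    interpret P: growth_product "{1..n}" "weight_pmf p n" G Q \<eta> A D \<rho> "Z n" \<gamma> by (rule growth_product[OF elim])
    show ?case
      using P.discrete_lower_one unfolding prod_family_group_def prod_family_prob_def b_def by auto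
  qed
  show "\<forall>\<^sub>F n in sequentially. \<forall>t\<in>range real. \<forall>x. 0 < x \<and> x \<le> 1 / 2 \<and> 0 < rates.rank (Z n) (b n) x \<longrightarrow>
      1 - 8 * exp (2 * x * t * (1 + 2 * x)) / rates.rank (Z n) (b n) x \<le> d_TV (PG n) (PQ n) (nat \<lfloor>t\<rfloor>)"
    using eventually_n0
  proof eventually_elim
    case (elim n)
    interpret P: growth_product "{1..n}" "weight_pmf p n" G Q \<eta> A D \<rho> "Z n" \<gamma> by (rule growth_product[OF elim])
    show ?case
      using P.discrete_lower_many unfolding prod_family_group_def prod_family_prob_def b_def by auto
  qed
next
  fix \<epsilon> t :: real and n :: nat
  assume *: "t \<in> range real" "d_TV (PG n) (PQ n) (nat \<lfloor>t\<rfloor>) \<le> \<epsilon>"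
  then obtain m where m: "t = real m" "d_TV (PG n) (PQ n) m \<le> \<epsilon>" by auto
  show "real (T_TV (PG n) (PQ n) \<epsilon>) \<in> range real \<and>
      d_TV (PG n) (PQ n) (nat \<lfloor>real (T_TV (PG n) (PQ n) \<epsilon>)\<rfloor>) \<le> \<epsilon>"
    using LeastI[of "\<lambda>m. d_TV (PG n) (PQ n) m \<le> \<epsilon>", OF m(2)] by (simp add: T_TV_def)
  show "real (T_TV (PG n) (PQ n) \<epsilon>) \<le> t"
    using Least_le[of "\<lambda>m. d_TV (PG n) (PQ n) m \<le> \<epsilon>", OF m(2)] by (simp add: T_TV_def m(1))
qed auto

text \<open>When the critical time is of order \<open>u n * q n\<close> and the slowest rate of order \<open>w n / q n\<close>, the
  normalisation \<open>q n\<close> cancels in their product.\<close>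

lemma cutoff_criterion:
  assumes k: "0 < k" "0 < k1" "0 < k2" and u: "\<forall>\<^sub>F n in sequentially. 0 < w n"
    and main: "\<forall>\<^sub>F n in sequentially. rates.critical (Z n) (b n) \<le> k * (u n * q n) \<and>
      u n * q n \<le> k1 * rates.critical (Z n) (b n) \<and>
      w n / (k2 * q n) \<le> rates.slowest (Z n) (b n) \<and> rates.slowest (Z n) (b n) \<le> k2 * w n / q n"
  shows "filterlim (\<lambda>n. rates.slowest (Z n) (b n) * rates.critical (Z n) (b n)) at_top sequentially
      \<longleftrightarrow> filterlim (\<lambda>n. u n * w n) at_top sequentially"
proof (rule filterlim_at_top_comparable[of "k2 * k" "k1 * k2"])
  show "\<forall>\<^sub>F n in sequentially. rates.slowest (Z n) (b n) * rates.critical (Z n) (b n) \<le> k2 * k * (u n * w n)"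
    using main u rates eventually_ge_at_top[of 1]
  proof eventually_elim
    case (elim n)
    interpret R: rates "Z n" "b n" by fact
    have q: "0 < q n" by (rule q_pos[OF elim(4)])
    have "R.slowest * R.critical \<le> k2 * w n / q n * (k * (u n * q n))"
      using elim R.critical_pos R.slowest_pos k q by (intro mult_mono) auto
    then show ?case using q by (simp add: mult_ac)
  qed
  show "\<forall>\<^sub>F n in sequentially. u n * w n \<le> k1 * k2 * (rates.slowest (Z n) (b n) * rates.critical (Z n) (b n))"
    using main u rates eventually_ge_at_top[of 1]
  proof eventually_elim
    case (elim n)
    interpret R: rates "Z n" "b n" by fact
    have q: "0 < q n" by (rule q_pos[OF elim(4)])
    have "w n \<le> k2 * (R.slowest * q n)" "u n \<le> k1 * R.critical / q n"
      using elim(1) k q by (auto simp: field_simps)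
    then have "u n * w n \<le> (k1 * R.critical / q n) * (k2 * (R.slowest * q n))"
      using k R.critical_pos q elim(2) by (intro mult_mono) auto
    then show ?case using q by (simp add: mult_ac)
  qed
qed (use k in auto)

text \<open>The factor up to which the rates agree with \<open>l i / q n\<close>: it combines \<open>\<kappa>\<close> with the two bounds for
  \<open>\<rho>\<^sup>2\<close> times a spectral gap.\<close>

definition "k = \<kappa> * (1 / \<eta> + gap_const A D)"

lemma k_pos: "0 < k"
  using \<kappa> const_pos by (auto simp: k_def gap_const_def intro!: mult_pos_pos add_pos_nonneg)

lemma increasing_order:
  assumes incr: "\<forall>n\<ge>1. l n \<le> l (n + 1)"
  obtains c c' where "0 < c" "0 < c'"
    "\<forall>\<^sub>F n in sequentially. rates.critical (Z n) (b n) \<le> c * (u_increasing l n * q n)"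
    "\<forall>\<^sub>F n in sequentially. u_increasing l n * q n \<le> c' * rates.critical (Z n) (b n)"
    "filterlim (\<lambda>n. rates.slowest (Z n) (b n) * rates.critical (Z n) (b n)) at_top sequentially
      \<longleftrightarrow> filterlim (u_increasing l) at_top sequentially"
proof -
  define c' where "c' = 2 * k * n0 + 2 * k * l n0 * ln (real (n0 + 1)) / (l 1 * ln 2)"
  have l0: "0 < l n0" "0 < l 1" using l_pos n0 by auto
  have c': "0 < c'" using k_pos n0 l0 by (auto simp: c'_def intro!: add_pos_nonneg)
  \<comment> \<open>The slowest rate times \<open>q n\<close> stays between \<open>l 1 / k\<close> and \<open>k * l n0\<close>.\<close>
  define k2 where "k2 = max (k / l 1) (k * l n0)"
  have k2: "k / l 1 \<le> k2" "k * l n0 \<le> k2" by (auto simp: k2_def)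
  have k2_pos: "0 < k2" using k_pos l0 by (auto simp: k2_def less_max_iff_disj)
  have mono: "l i \<le> l j" if "1 \<le> i" "i \<le> j" for i j
    using that(2,1) by (induction j rule: dec_induct) (use incr in \<open>auto intro: order_trans\<close>)
  have main: "\<forall>\<^sub>F n in sequentially. rates.critical (Z n) (b n) \<le> k / 2 * (u_increasing l n * q n) \<and>
     u_increasing l n * q n \<le> c' * rates.critical (Z n) (b n) \<and>
     1 / (k2 * q n) \<le> rates.slowest (Z n) (b n) \<and> rates.slowest (Z n) (b n) \<le> k2 * 1 / q n"
    using eventually_n0
  proof eventually_elim
    case (elim n)
    interpret R: comparable_rates "Z n" "b n" l k "q n" n n0 unfolding k_def by (rule comparable[OF elim])
    have 1: "R.critical \<le> k / 2 * (u_increasing l n * q n)" "u_increasing l n * q n \<le> c' * R.critical"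
      "l 1 / (k * q n) \<le> R.slowest" "R.slowest \<le> k * l n0 / q n"
      unfolding c'_def by (rule R.increasing_comparison; use mono in blast)+
    have "1 / (k2 * q n) \<le> 1 / (k / l 1 * q n)"
      using k2 k2_pos k_pos l0 R.q by (intro divide_left_mono mult_right_mono mult_pos_pos) auto
    moreover have "k * l n0 / q n \<le> k2 * 1 / q n" using k2 R.q by (intro divide_right_mono) auto
    ultimately show ?case using 1 by simp
  qed
  show thesis
  proof (rule that[of "k / 2" c'])
    show "filterlim (\<lambda>n. rates.slowest (Z n) (b n) * rates.critical (Z n) (b n)) at_top sequentially
      \<longleftrightarrow> filterlim (u_increasing l) at_top sequentially"
      using cutoff_criterion[OF _ c' k2_pos _ main] k_pos by simp
  qed (use k_pos c' main in \<open>auto elim: eventually_mono\<close>)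
qed

lemma decreasing_order:
  assumes decr: "\<forall>n\<ge>1. l n \<ge> l (n + 1)"
  obtains c c' where "0 < c" "0 < c'"
    "\<forall>\<^sub>F n in sequentially. rates.critical (Z n) (b n) \<le> c * (u_decreasing l n * q n)"
    "\<forall>\<^sub>F n in sequentially. u_decreasing l n * q n \<le> c' * rates.critical (Z n) (b n)"
    "filterlim (\<lambda>n. rates.slowest (Z n) (b n) * rates.critical (Z n) (b n)) at_top sequentially
      \<longleftrightarrow> filterlim (\<lambda>n. u_decreasing l n * l n) at_top sequentially"
proof -
  have c': "0 < 2 * k * n0" using k_pos n0 by auto
  have mono: "l j \<le> l i" if "1 \<le> i" "i \<le> j" for i j
    using that(2,1) by (induction j rule: dec_induct) (use decr in \<open>auto intro: order_trans\<close>)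
  have main: "\<forall>\<^sub>F n in sequentially. rates.critical (Z n) (b n) \<le> k / 2 * (u_decreasing l n * q n) \<and>
     u_decreasing l n * q n \<le> 2 * k * n0 * rates.critical (Z n) (b n) \<and>
     l n / (k * q n) \<le> rates.slowest (Z n) (b n) \<and> rates.slowest (Z n) (b n) \<le> k * l n / q n"
    using eventually_n0
  proof eventually_elim
    case (elim n)
    interpret R: comparable_rates "Z n" "b n" l k "q n" n n0 unfolding k_def by (rule comparable[OF elim])
    show ?case using R.decreasing_comparison mono by blast
  qed
  have pos: "\<forall>\<^sub>F n in sequentially. 0 < l n"
    using eventually_ge_at_top[of 1] by eventually_elim (rule l_pos)
  show thesis
  proof (rule that[of "k / 2" "2 * k * n0"])
    show "filterlim (\<lambda>n. rates.slowest (Z n) (b n) * rates.critical (Z n) (b n)) at_top sequentially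
      \<longleftrightarrow> filterlim (\<lambda>n. u_decreasing l n * l n) at_top sequentially"
      using cutoff_criterion[OF _ c' k_pos pos main] k_pos by simp
  qed (use k_pos c' main in \<open>auto elim: eventually_mono\<close>)
qed

lemma heat_cutoff:
  assumes c: "0 < c" "0 < c'"
    "\<forall>\<^sub>F n in sequentially. rates.critical (Z n) (b n) \<le> c * v n"
    "\<forall>\<^sub>F n in sequentially. v n \<le> c' * rates.critical (Z n) (b n)"
    "filterlim (\<lambda>n. rates.slowest (Z n) (b n) * rates.critical (Z n) (b n)) at_top sequentially \<longleftrightarrow> X"
  shows "cutoff_c PG PQ \<longleftrightarrow> X" and "\<lbrakk>cutoff_c PG PQ; cutoff_time_c PG PQ t\<rbrakk> \<Longrightarrow> same_order t v"
proof -
  interpret C: cutoff_profile Z b "\<lambda>n. d_TV_c (PG n) (PQ n)" "{0..}" "\<lambda>n. T_TV_c (PG n) (PQ n)"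
     "heat_const \<eta> A D" "\<eta> / 4" "growth_product.threshold \<eta> A D" by (rule heat_profile)
  have iff: "cutoff_c PG PQ \<longleftrightarrow> filterlim (\<lambda>n. C.\<sigma> n * C.\<theta> n) at_top sequentially"
    unfolding cutoff_c_def by (rule C.cutoff_iff)
  then show "cutoff_c PG PQ \<longleftrightarrow> X" using c(5) by (simp add: C.\<sigma>_def C.\<theta>_def)
  assume cut: "cutoff_c PG PQ" and t: "cutoff_time_c PG PQ t"
  have pos: "\<forall>\<^sub>F n in sequentially. 0 < t n"
    using eventually_ge_at_top[of 1] by eventually_elim (use t in \<open>auto simp: cutoff_time_c_def\<close>)
  have lim: "(\<lambda>n. d_TV_c (PG n) (PQ n) (max 0 (a * t n))) \<longlonglongrightarrow> L"
    if "(\<lambda>n. d_TV_c (PG n) (PQ n) (a * t n)) \<longlonglongrightarrow> L" "0 < a" for a L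
    by (rule Lim_transform_eventually[OF that(1)])
      (use pos that(2) in \<open>auto elim!: eventually_mono simp: max_def\<close>)
  have "\<forall>\<^sub>F n in sequentially. C.\<theta> n / 8 \<le> t n \<and> t n \<le> 6 * C.\<theta> n"
  proof (rule C.cutoff_time_order)
    show "filterlim (\<lambda>n. C.\<sigma> n * C.\<theta> n) at_top sequentially" using iff cut by simp
    show "(\<lambda>n. d_TV_c (PG n) (PQ n) (max 0 (2 * t n))) \<longlonglongrightarrow> 0"
      using t by (intro lim) (auto simp: cutoff_time_c_def)
    show "(\<lambda>n. d_TV_c (PG n) (PQ n) (max 0 (1 / 2 * t n))) \<longlonglongrightarrow> 1"
    proof (rule lim)
      have "\<forall>a\<in>{0<..<1}. (\<lambda>n. d_TV_c (PG n) (PQ n) (a * t n)) \<longlonglongrightarrow> 1"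
        using t by (simp add: cutoff_time_c_def)
      then show "(\<lambda>n. d_TV_c (PG n) (PQ n) (1 / 2 * t n)) \<longlonglongrightarrow> 1" by (rule ballE[of _ _ "1 / 2"]) simp_all
    qed simp
    show "\<forall>\<^sub>F n in sequentially. max 0 (2 * t n) \<le> 2 * t n + 1"
      using pos by eventually_elim auto
    show "\<forall>\<^sub>F n in sequentially. t n / 2 - 1 \<le> max 0 (1 / 2 * t n)"
      using pos by eventually_elim auto
  qed auto
  then show "same_order t v"
    by (rule same_order_trans_eventually[OF _ c(3)[folded C.\<theta>_def] c(4)[folded C.\<theta>_def] C.critical_pos_ev c(1,2)])
qed

lemma discrete_cutoff:
  assumes lazy: "\<And>i. 1 \<le> i \<Longrightarrow> \<one>\<^bsub>G i\<^esub> \<in> set_pmf (Q i)"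
    and c: "0 < c" "0 < c'"
    "\<forall>\<^sub>F n in sequentially. rates.critical (Z n) (b n) \<le> c * v n"
    "\<forall>\<^sub>F n in sequentially. v n \<le> c' * rates.critical (Z n) (b n)"
    "filterlim (\<lambda>n. rates.slowest (Z n) (b n) * rates.critical (Z n) (b n)) at_top sequentially \<longleftrightarrow> X"
  shows "cutoff PG PQ \<longleftrightarrow> X" and "\<lbrakk>cutoff PG PQ; cutoff_time PG PQ t\<rbrakk> \<Longrightarrow> same_order t v"
proof -
  interpret C: cutoff_profile Z b "\<lambda>n t. d_TV (PG n) (PQ n) (nat \<lfloor>t\<rfloor>)" "range real" "\<lambda>n \<epsilon>. real (T_TV (PG n) (PQ n) \<epsilon>)"
     "heat_const \<eta> A D" "\<eta> / 4" "growth_product.threshold \<eta> A D" by (rule discrete_profile[OF lazy])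
  have iff: "cutoff PG PQ \<longleftrightarrow> filterlim (\<lambda>n. C.\<sigma> n * C.\<theta> n) at_top sequentially"
  proof
    assume "cutoff PG PQ"
    then show "filterlim (\<lambda>n. C.\<sigma> n * C.\<theta> n) at_top sequentially"
      unfolding cutoff_def by (subst C.cutoff_iff[symmetric]) blast
  next
    assume M: "filterlim (\<lambda>n. C.\<sigma> n * C.\<theta> n) at_top sequentially"
    have "filterlim (\<lambda>n. real (T_TV (PG n) (PQ n) (1 / 2))) at_top sequentially"
      by (rule C.mixing_tendsto[OF M]) auto
    then have "filterlim (\<lambda>n. T_TV (PG n) (PQ n) (1 / 2)) at_top sequentially"
      by (simp add: filterlim_sequentially_iff_filterlim_real)
    then have "\<exists>\<epsilon>0\<in>{0<..<1}. filterlim (\<lambda>n. T_TV (PG n) (PQ n) \<epsilon>0) at_top sequentially"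
      by (intro bexI[of _ "1 / 2"]) auto
    then show "cutoff PG PQ" unfolding cutoff_def using C.cutoff_iff M by blast
  qed
  then show "cutoff PG PQ \<longleftrightarrow> X" using c(5) by (simp add: C.\<sigma>_def C.\<theta>_def)
  assume cut: "cutoff PG PQ" and t: "cutoff_time PG PQ t"
  have pos: "\<forall>\<^sub>F n in sequentially. 0 < t n"
    using eventually_ge_at_top[of 1] by eventually_elim (use t in \<open>auto simp: cutoff_time_def\<close>)
  have "\<forall>\<^sub>F n in sequentially. C.\<theta> n / 8 \<le> t n \<and> t n \<le> 6 * C.\<theta> n"
  proof (rule C.cutoff_time_order)
    show "filterlim (\<lambda>n. C.\<sigma> n * C.\<theta> n) at_top sequentially" using iff cut by simp
    have "\<forall>a>1. (\<lambda>n. d_TV (PG n) (PQ n) (nat \<lceil>a * t n\<rceil>)) \<longlonglongrightarrow> 0"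
      using t by (simp add: cutoff_time_def)
    then have "(\<lambda>n. d_TV (PG n) (PQ n) (nat \<lceil>2 * t n\<rceil>)) \<longlonglongrightarrow> 0" by (rule allE[of _ 2]) simp
    then show "(\<lambda>n. d_TV (PG n) (PQ n) (nat \<lfloor>real (nat \<lceil>2 * t n\<rceil>)\<rfloor>)) \<longlonglongrightarrow> 0"
      by (simp only: floor_of_nat nat_int)
    have "\<forall>a\<in>{0<..<1}. (\<lambda>n. d_TV (PG n) (PQ n) (nat \<lfloor>a * t n\<rfloor>)) \<longlonglongrightarrow> 1"
      using t by (simp add: cutoff_time_def)
    then have "(\<lambda>n. d_TV (PG n) (PQ n) (nat \<lfloor>1 / 2 * t n\<rfloor>)) \<longlonglongrightarrow> 1" by (rule ballE[of _ _ "1 / 2"]) simp_all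
    then show "(\<lambda>n. d_TV (PG n) (PQ n) (nat \<lfloor>real (nat \<lfloor>1 / 2 * t n\<rfloor>)\<rfloor>)) \<longlonglongrightarrow> 1"
      by (simp only: floor_of_nat nat_int)
    show "\<forall>\<^sub>F n in sequentially. real (nat \<lceil>2 * t n\<rceil>) \<le> 2 * t n + 1"
      using pos by eventually_elim (simp add: of_nat_nat)
    show "\<forall>\<^sub>F n in sequentially. t n / 2 - 1 \<le> real (nat \<lfloor>1 / 2 * t n\<rfloor>)"
      using pos by eventually_elim linarith
  qed auto
  then show "same_order t v"
    by (rule same_order_trans_eventually[OF _ c(3)[folded C.\<theta>_def] c(4)[folded C.\<theta>_def] C.critical_pos_ev c(1,2)])
qed

end

text \<open>As \<open>m / \<rho> \<le> 1\<close>, the exponent \<open>d\<close> may be increased to a natural number, in particular when it is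
  negative.\<close>

lemma growth_walk_from_moderate_growth:
  assumes walk: "random_walk G Q" and sym: "symmetric_prob G Q" and A: "0 < A"
    and growth: "moderate_growth G (set_pmf Q) A d"
    and \<eta>: "0 < \<eta>" "\<And>s. s \<in> set_pmf Q \<Longrightarrow> \<eta> \<le> pmf Q s"
  shows "growth_walk G Q \<eta> A (nat \<lceil>d\<rceil>) (group_diameter G (set_pmf Q))"
proof -
  interpret sym_walk G Q
  proof -
    have "group G" "finite (carrier G)" "set_pmf Q \<subseteq> carrier G" using walk by (auto simp: random_walk_def)
    moreover have "pmf Q (inv\<^bsub>G\<^esub> g) = pmf Q g" if "g \<in> carrier G" for g
      using sym[unfolded symmetric_prob_def, rule_format, OF that] by (rule HOL.sym)
    ultimately show "sym_walk G Q"
      by (intro sym_walk.intro fin_walk.intro fin_walk_axioms.intro sym_walk_axioms.intro)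
  qed
  let ?E = "set_pmf Q" and ?\<rho> = "group_diameter G (set_pmf Q)"
  have full: "set_power G ?E m = carrier G \<longleftrightarrow> card (set_power G ?E m) = card (carrier G)" for m
    using card_subset_eq[OF fin set_power_closed[OF supp, of m]] by auto
  obtain k where k: "0 < k" "set_power G ?E k = carrier G"
    using growth by (auto simp: moderate_growth_def generating_set_def)
  have \<rho>: "1 \<le> ?\<rho> \<and> card (set_power G ?E ?\<rho>) = card (carrier G)"
    unfolding group_diameter_def by (rule LeastI[of _ k]) (use k in auto)
  show ?thesis
  proof (intro growth_walk.intro growth_walk_axioms.intro sym_walk_axioms)
    show "0 < \<eta>" by (rule \<eta>(1))
    show "\<eta> \<le> pmf Q s" if "s \<in> ?E" for s using \<eta>(2) that by auto
    show "1 \<le> ?\<rho>" "set_power G ?E ?\<rho> = carrier G" using \<rho> full by auto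
    show "?\<rho> \<le> m" if "1 \<le> m" "set_power G ?E m = carrier G" for m
      unfolding group_diameter_def by (rule Least_le) (use that in auto)
    show "0 < A" by (rule A)
    fix m assume m: "1 \<le> m" "m \<le> ?\<rho>"
    have x: "0 < real m / ?\<rho>" "real m / ?\<rho> \<le> 1" using m by auto
    have "(real m / ?\<rho>) ^ nat \<lceil>d\<rceil> = (real m / ?\<rho>) powr real (nat \<lceil>d\<rceil>)" using x by (simp add: powr_realpow)
    also have "\<dots> \<le> (real m / ?\<rho>) powr d" using x by (intro powr_mono') (auto, linarith)
    also have "\<dots> \<le> A * (card (set_power G ?E m) / card (set_power G ?E ?\<rho>))"
      using growth m A by (auto simp: moderate_growth_def Let_def field_simps)
    finally show "card (carrier G) * (real m / ?\<rho>) ^ nat \<lceil>d\<rceil> \<le> A * card (set_power G ?E m)"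
      using card_pos \<rho> by (simp add: field_simps)
  qed
qed

text \<open>In a trivial group the only possible support already generates with words of length one.\<close>

lemma trivial_group_diameter:
  assumes "random_walk G Q" "2 \<le> group_diameter G (set_pmf Q)"
  shows "1 < card (carrier G)"
proof (rule ccontr)
  assume "\<not> 1 < card (carrier G)"
  interpret group G using assms by (simp add: random_walk_def)
  have fin: "finite (carrier G)" and E: "set_pmf Q \<subseteq> carrier G" using assms by (auto simp: random_walk_def)
  have "card (carrier G) \<noteq> 0" using fin one_closed by auto
  then have "card (carrier G) = 1" using \<open>\<not> 1 < card (carrier G)\<close> by simp
  then obtain e where "carrier G = {e}" by (auto simp: card_1_singleton_iff)
  then have "set_pmf Q = carrier G" using E set_pmf_not_empty[of Q] by auto
  then have "set_power G (set_pmf Q) 1 = carrier G" using set_power_one[OF E] by simp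
  then have "group_diameter G (set_pmf Q) \<le> 1"
    unfolding group_diameter_def by (intro Least_le) simp
  then show False using assms(2) by simp
qed

text \<open>It remains to extract uniform constants from the hypotheses: the positive infimum bounds all driving
  weights from below, the order assumption bounds both quotients for all indices, and a diameter of at
  least 4 excludes trivial groups from some index on.\<close>

theorem theorem2p5:
  fixes G :: "nat \<Rightarrow> ('a, 'b) monoid_scheme"
    and Q :: "nat \<Rightarrow> 'a pmf"
    and p l :: "nat \<Rightarrow> real"
    and A d :: real
  assumes walks: "\<forall>n\<ge>1. random_walk (G n) (Q n)"
    and symmetric: "\<forall>n\<ge>1. symmetric_prob (G n) (Q n)"
    and p_pos: "\<forall>n\<ge>1. p n > 0"
    and l_pos: "\<forall>n\<ge>1. l n > 0"
    and A_pos: "A > 0"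
    and growth: "\<forall>n\<ge>1. moderate_growth (G n) (set_pmf (Q n)) A d"
    and inf_pos: "Inf {pmf (Q n) x | n x. n \<ge> 1 \<and> x \<in> set_pmf (Q n)} > 0"
    and diam: "\<forall>\<^sub>F n in sequentially. group_diameter (G n) (set_pmf (Q n)) \<ge> 4"
    and order: "same_order (\<lambda>n. p n / real (group_diameter (G n) (set_pmf (Q n))) ^ 2) l"
  shows
    "((\<forall>n\<ge>1. l n \<le> l (n + 1)) \<longrightarrow>
        (cutoff_c (prod_family_group G) (prod_family_prob G Q p) \<longleftrightarrow>
           filterlim (u_increasing l) at_top sequentially) \<and>
        (cutoff_c (prod_family_group G) (prod_family_prob G Q p) \<longrightarrow>
           (\<forall>t. cutoff_time_c (prod_family_group G) (prod_family_prob G Q p) t \<longrightarrow>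
              same_order t (\<lambda>n. u_increasing l n * partial_sum p n)))) \<and>
     ((\<forall>n\<ge>1. l n \<ge> l (n + 1)) \<longrightarrow>
        (cutoff_c (prod_family_group G) (prod_family_prob G Q p) \<longleftrightarrow>
           filterlim (\<lambda>n. u_decreasing l n * l n) at_top sequentially) \<and>
        (cutoff_c (prod_family_group G) (prod_family_prob G Q p) \<longrightarrow>
           (\<forall>t. cutoff_time_c (prod_family_group G) (prod_family_prob G Q p) t \<longrightarrow>
              same_order t (\<lambda>n. u_decreasing l n * partial_sum p n)))) \<and>
     ((\<forall>n\<ge>1. \<one>\<^bsub>G n\<^esub> \<in> set_pmf (Q n)) \<longrightarrow>
        ((\<forall>n\<ge>1. l n \<le> l (n + 1)) \<longrightarrow>
           (cutoff (prod_family_group G) (prod_family_prob G Q p) \<longleftrightarrow>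
              filterlim (u_increasing l) at_top sequentially) \<and>
           (cutoff (prod_family_group G) (prod_family_prob G Q p) \<longrightarrow>
              (\<forall>t. cutoff_time (prod_family_group G) (prod_family_prob G Q p) t \<longrightarrow>
                 same_order t (\<lambda>n. u_increasing l n * partial_sum p n)))) \<and>
        ((\<forall>n\<ge>1. l n \<ge> l (n + 1)) \<longrightarrow>
           (cutoff (prod_family_group G) (prod_family_prob G Q p) \<longleftrightarrow>
              filterlim (\<lambda>n. u_decreasing l n * l n) at_top sequentially) \<and>
           (cutoff (prod_family_group G) (prod_family_prob G Q p) \<longrightarrow>
              (\<forall>t. cutoff_time (prod_family_group G) (prod_family_prob G Q p) t \<longrightarrow>
                 same_order t (\<lambda>n. u_decreasing l n * partial_sum p n)))))"
proof -
  define \<rho> where "\<rho> n = group_diameter (G n) (set_pmf (Q n))" for n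
  define \<eta> where "\<eta> = Inf {pmf (Q n) x | n x. n \<ge> 1 \<and> x \<in> set_pmf (Q n)}"
  have \<eta>_le: "\<eta> \<le> pmf (Q n) x" if "1 \<le> n" "x \<in> set_pmf (Q n)" for n x
    unfolding \<eta>_def using that by (intro cInf_lower bdd_belowI[of _ 0]) auto
  have gw: "growth_walk (G n) (Q n) \<eta> A (nat \<lceil>d\<rceil>) (\<rho> n)" if "1 \<le> n" for n
    unfolding \<rho>_def using that walks symmetric growth A_pos inf_pos \<eta>_le
    by (intro growth_walk_from_moderate_growth) (auto simp: \<eta>_def)
  obtain n1 where n1: "\<And>n. n1 \<le> n \<Longrightarrow> 4 \<le> \<rho> n"
    using diam unfolding \<rho>_def eventually_sequentially by auto
  define n0 where "n0 = max 1 n1"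
  have nontriv: "1 < card (carrier (G n))" if "n0 \<le> n" for n
    using n1[of n] that walks by (intro trivial_group_diameter[of _ "Q n"]) (auto simp: n0_def \<rho>_def)
  obtain k1 where k1: "\<And>n. norm (p n / (real (\<rho> n))\<^sup>2 / l n) \<le> k1" and k1_pos: "0 < k1"
    using order unfolding same_order_def \<rho>_def by (auto simp: Bseq_def)
  obtain k2 where k2: "\<And>n. norm (l n / (p n / (real (\<rho> n))\<^sup>2)) \<le> k2" and k2_pos: "0 < k2"
    using order unfolding same_order_def \<rho>_def by (auto simp: Bseq_def)
  have ord: "l n / (k1 + k2) \<le> p n / (real (\<rho> n))\<^sup>2" "p n / (real (\<rho> n))\<^sup>2 \<le> (k1 + k2) * l n" if n: "1 \<le> n" for n
  proof -
    have pos: "0 < l n" "0 < p n / (real (\<rho> n))\<^sup>2"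
      using l_pos p_pos n growth_walk.\<rho>(1)[OF gw[OF n]] by auto
    have "l n / (p n / (real (\<rho> n))\<^sup>2) \<le> k1 + k2" "p n / (real (\<rho> n))\<^sup>2 / l n \<le> k1 + k2"
      using k1[of n] k2[of n] k1_pos k2_pos by (auto intro: order_trans[OF abs_ge_self])
    then show "l n / (k1 + k2) \<le> p n / (real (\<rho> n))\<^sup>2" "p n / (real (\<rho> n))\<^sup>2 \<le> (k1 + k2) * l n"
      using pos k1_pos k2_pos by (simp_all only: pos_divide_le_eq add_pos_pos mult.commute)
  qed
  interpret F: product_family G Q p l \<eta> A "nat \<lceil>d\<rceil>" \<rho> "k1 + k2" n0
  proof (rule product_family.intro)
    show "1 \<le> n0" by (simp add: n0_def)
    show "0 < k1 + k2" using k1_pos k2_pos by simp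
  qed (use gw p_pos l_pos nontriv ord in auto)
  show ?thesis
  proof (intro conjI impI)
    assume "\<forall>n\<ge>1. l n \<le> l (n + 1)"
    note incr = F.increasing_order[OF this]
    show "cutoff_c (prod_family_group G) (prod_family_prob G Q p) \<longleftrightarrow> filterlim (u_increasing l) at_top sequentially"
      by (rule incr) (rule F.heat_cutoff(1))
    show "\<forall>t. cutoff_time_c (prod_family_group G) (prod_family_prob G Q p) t \<longrightarrow>
        same_order t (\<lambda>n. u_increasing l n * partial_sum p n)"
      if "cutoff_c (prod_family_group G) (prod_family_prob G Q p)"
      using that by (auto intro: incr[OF F.heat_cutoff(2)])
  next
    assume "\<forall>n\<ge>1. l n \<ge> l (n + 1)"
    note decr = F.decreasing_order[OF this]
    show "cutoff_c (prod_family_group G) (prod_family_prob G Q p) \<longleftrightarrow>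
        filterlim (\<lambda>n. u_decreasing l n * l n) at_top sequentially"
      by (rule decr) (rule F.heat_cutoff(1))
    show "\<forall>t. cutoff_time_c (prod_family_group G) (prod_family_prob G Q p) t \<longrightarrow>
        same_order t (\<lambda>n. u_decreasing l n * partial_sum p n)"
      if "cutoff_c (prod_family_group G) (prod_family_prob G Q p)"
      using that by (auto intro: decr[OF F.heat_cutoff(2)])
  next
    assume lazy: "\<forall>n\<ge>1. \<one>\<^bsub>G n\<^esub> \<in> set_pmf (Q n)" and "\<forall>n\<ge>1. l n \<le> l (n + 1)"
    note incr = F.increasing_order[OF this(2)]
    show "cutoff (prod_family_group G) (prod_family_prob G Q p) \<longleftrightarrow> filterlim (u_increasing l) at_top sequentially"
      by (rule incr, rule F.discrete_cutoff(1)) (use lazy in auto)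
    show "\<forall>t. cutoff_time (prod_family_group G) (prod_family_prob G Q p) t \<longrightarrow>
        same_order t (\<lambda>n. u_increasing l n * partial_sum p n)"
      if "cutoff (prod_family_group G) (prod_family_prob G Q p)"
      using that lazy by (auto intro: incr[OF F.discrete_cutoff(2)])
  next
    assume lazy: "\<forall>n\<ge>1. \<one>\<^bsub>G n\<^esub> \<in> set_pmf (Q n)" and "\<forall>n\<ge>1. l n \<ge> l (n + 1)"
    note decr = F.decreasing_order[OF this(2)]
    show "cutoff (prod_family_group G) (prod_family_prob G Q p) \<longleftrightarrow>
        filterlim (\<lambda>n. u_decreasing l n * l n) at_top sequentially"
      by (rule decr, rule F.discrete_cutoff(1)) (use lazy in auto)
    show "\<forall>t. cutoff_time (prod_family_group G) (prod_family_prob G Q p) t \<longrightarrow>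
        same_order t (\<lambda>n. u_decreasing l n * partial_sum p n)"
      if "cutoff (prod_family_group G) (prod_family_prob G Q p)"
      using that lazy by (auto intro: decr[OF F.discrete_cutoff(2)])
  qed
qed

end
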